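(* Let $n\ge 3$ and let $M=\Gamma\backslash\mathbb{H}^n$ be a complete finite-volume hyperbolic $n$-manifold, with $\Gamma\subset SO^+(n,1)$ a torsion-free lattice, containing a branched totally geodesic hypersurface $\Delta$ with branching locus $\mathscr{B}$. Let $c_{n-1}$ be the number of $(n-1)$-dimensional complementary regions (connected components) of $\Delta\setminus\mathscr{B}$, and let $c_{n-2}$ be the number of connected components of $\mathscr{B}$. Let $\tilde\Delta$ be the preimage of $\Delta$ in the universal cover $\tilde M=\mathbb{H}^n$, and suppose that for every connected component $\delta$ of $\tilde M\setminus\tilde\Delta$ the setwise stabilizer $\mathrm{Fix}_\Gamma(\delta)=\{\gamma\in\Gamma:\gamma\delta=\delta\}$ is Zariski-dense in $SO^+(n,1)$. Then $$\dim_{\mathbb{R}} H^1(\Gamma,\nu_{n+1})\ \ge\ c_{n-1}-3c_{n-2}.$$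
   Context: $\nu_{n+1}$ is the orthogonal complement of $\mathfrak{so}(n,1)$ in $\mathfrak{sl}_{n+1}(\mathbb{R})$ with respect to the Killing form, so that $\mathfrak{sl}_{n+1}(\mathbb{R})=\mathfrak{so}(n,1)\oplus\nu_{n+1}$ is an $\mathrm{Ad}_{SO(n,1)}$-invariant splitting; explicitly, if $J$ is the Gram matrix of the signature-$(n,1)$ form, $\nu_{n+1}=\{X\in\mathfrak{sl}_{n+1}(\mathbb{R}): X^TJ=JX\}$. $\Gamma\subset SO^+(n,1)\subset SL_{n+1}(\mathbb{R})$ acts on it by conjugation. $H^1(\Gamma,\cdot)$ is group cohomology. A branched totally geodesic hypersurface $\Delta\subset M$ with branching locus $\mathscr{B}\subset\Delta$ is a (closed) piecewise totally geodesic complex of $(n-1)$-dimensional faces meeting along an $(n-2)$-dimensional locus: $\mathscr{B}$ has finitely many connected components ("bindings"), each a totally geodesic piece of codimension 2 in $M$ (so each lift to $\mathbb{H}^n$ lies in a totally geodesic copy of $\mathbb{H}^{n-2}$); $\Delta\setminus\mathscr{B}$ has finitely many connected components ("walls"), each a totally geodesic piece of codimension 1 in $M$ (so each lift lies in a totally geodesic copy of $\mathbb{H}^{n-1}$); and the walls meet one another along the bindings. Throughout, each wall in $M$ is taken with an (arbitrarily chosen) transverse orientation. *)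

theory Defs
  imports "HOL-Analysis.Analysis" "HOL-Algebra.Group"
begin

section \<open>The hyperboloid model\<close>

text \<open>
  \<open>\<real>\<^sup>n\<^sup>,\<^sup>1\<close> is \<open>real ^ ('n option)\<close> with \<open>n = CARD('n)\<close>: the coordinates \<open>Some i\<close> are the
  space-like ones and \<open>None\<close> is the time-like one.
\<close>

type_synonym 'n mink = "real ^ ('n option)"
type_synonym 'n mink_mat = "real ^ ('n option) ^ ('n option)"

definition gram :: "'n::finite mink_mat" where
  "gram = (\<chi> i j. if i = j then (if i = None then - 1 else 1) else 0)"

definition lorentz :: "'n::finite mink \<Rightarrow> 'n mink \<Rightarrow> real" where
  "lorentz x y = inner x (gram *v y)"

definition hyp :: "'n::finite mink set" where
  "hyp = {x. lorentz x x = - 1 \<and> x $ None > 0}"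

text \<open>Totally geodesic copies of \<open>\<bbbH>\<^sup>n\<^sup>-\<^sup>k\<close>: the nonempty intersections of the hyperboloid with
  linear subspaces of codimension \<open>k\<close>.\<close>

definition hyp_planes :: "nat \<Rightarrow> 'n::finite mink set set" where
  "hyp_planes k = {V \<inter> hyp | V. subspace V \<and> dim V + k = CARD('n option) \<and> V \<inter> hyp \<noteq> {}}"

text \<open>The Riemannian volume of the hyperboloid: in the coordinates \<open>y \<in> \<real>\<^sup>n\<close> given by the vertical
  projection, the volume form is \<open>dy / sqrt (1 + \<bar>y\<bar>\<^sup>2)\<close>.\<close>

definition hyp_point :: "real ^ 'n::finite \<Rightarrow> 'n mink" where
  "hyp_point y = (\<chi> i. case i of None \<Rightarrow> sqrt (1 + (norm y)\<^sup>2) | Some j \<Rightarrow> y $ j)"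

definition hyp_volume :: "'n::finite mink set \<Rightarrow> ennreal" where
  "hyp_volume S =
     (\<integral>\<^sup>+ y. ennreal (1 / sqrt (1 + (norm y)\<^sup>2)) * indicator S (hyp_point y) \<partial>lborel)"


section \<open>Torsion-free lattices in \<open>SO\<^sup>+(n,1)\<close>\<close>

definition SO_plus :: "'n::finite mink_mat monoid" where
  "SO_plus = \<lparr>carrier = {A. transpose A ** gram ** A = gram \<and> det A = 1 \<and> A $ None $ None > 0},
              mult = (**), one = mat 1\<rparr>"

definition orbit :: "'n::finite mink_mat set \<Rightarrow> 'n mink \<Rightarrow> 'n mink set" where
  "orbit \<Gamma> x = (\<lambda>\<gamma>. \<gamma> *v x) ` \<Gamma>"

text \<open>The volume of \<open>\<Gamma>\<backslash>\<bbbH>\<^sup>n\<close> is that of any Borel set of representatives of the orbits.\<close>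

definition finite_covolume :: "'n::finite mink_mat set \<Rightarrow> bool" where
  "finite_covolume \<Gamma> \<longleftrightarrow>
     (\<exists>F \<in> sets borel. F \<subseteq> hyp \<and> (\<forall>x\<in>hyp. \<exists>!y. y \<in> F \<and> y \<in> orbit \<Gamma> x) \<and> hyp_volume F < \<infinity>)"

definition torsion_free_lattice :: "'n::finite mink_mat set \<Rightarrow> bool" where
  "torsion_free_lattice \<Gamma> \<longleftrightarrow>
     subgroup \<Gamma> SO_plus \<and> discrete \<Gamma> \<and> finite_covolume \<Gamma> \<and>
     (\<forall>\<gamma>\<in>\<Gamma>. \<forall>k::nat. k > 0 \<longrightarrow> \<gamma> [^]\<^bsub>SO_plus\<^esub> k = \<one>\<^bsub>SO_plus\<^esub> \<longrightarrow> \<gamma> = \<one>\<^bsub>SO_plus\<^esub>)"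

text \<open>Zariski density: every polynomial in the matrix entries that vanishes on \<open>S\<close> vanishes
  on \<open>SO\<^sup>+(n,1)\<close>.\<close>

definition zariski_closure :: "'n::finite mink_mat set \<Rightarrow> 'n mink_mat set" where
  "zariski_closure S =
     {A. \<forall>p. real_polynomial_function p \<longrightarrow> (\<forall>B\<in>S. p B = 0) \<longrightarrow> p A = 0}"

definition zariski_dense_in_SO_plus :: "'n::finite mink_mat set \<Rightarrow> bool" where
  "zariski_dense_in_SO_plus S \<longleftrightarrow>
     S \<subseteq> carrier SO_plus \<and> carrier SO_plus \<subseteq> zariski_closure S"


section \<open>The quotient manifold\<close>

definition quotient_manifold :: "'n::finite mink_mat set \<Rightarrow> 'n mink set topology" where
  "quotient_manifold \<Gamma> =
     topology (\<lambda>U. U \<subseteq> orbit \<Gamma> ` hyp \<and> openin (top_of_set hyp) {x \<in> hyp. orbit \<Gamma> x \<in> U})"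

lemma quotient_map_orbit:
  "quotient_map (top_of_set hyp) (quotient_manifold \<Gamma>) (orbit \<Gamma>)"
proof -
  let ?P = "\<lambda>U. U \<subseteq> orbit \<Gamma> ` hyp \<and> openin (top_of_set hyp) {x \<in> hyp. orbit \<Gamma> x \<in> U}"
  have "istopology ?P"
    unfolding istopology_def
  proof (intro conjI allI impI)
    fix S T assume "?P S" "?P T"
    moreover have "{x \<in> hyp. orbit \<Gamma> x \<in> S \<inter> T} =
        {x \<in> hyp. orbit \<Gamma> x \<in> S} \<inter> {x \<in> hyp. orbit \<Gamma> x \<in> T}" by auto
    ultimately show "S \<inter> T \<subseteq> orbit \<Gamma> ` hyp"
      and "openin (top_of_set hyp) {x \<in> hyp. orbit \<Gamma> x \<in> S \<inter> T}"
      by (auto simp: openin_Int)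
  next
    fix K assume K: "\<forall>U\<in>K. ?P U"
    have "{x \<in> hyp. orbit \<Gamma> x \<in> \<Union>K} = (\<Union>U\<in>K. {x \<in> hyp. orbit \<Gamma> x \<in> U})" by auto
    then show "\<Union>K \<subseteq> orbit \<Gamma> ` hyp"
      and "openin (top_of_set hyp) {x \<in> hyp. orbit \<Gamma> x \<in> \<Union>K}"
      using K by auto
  qed
  then have o: "openin (quotient_manifold \<Gamma>) = ?P"
    unfolding quotient_manifold_def by (rule topology_inverse')
  have "{x \<in> hyp. orbit \<Gamma> x \<in> orbit \<Gamma> ` hyp} = hyp" by auto
  then have "?P (orbit \<Gamma> ` hyp)" using openin_subtopology_self by auto
  then have "topspace (quotient_manifold \<Gamma>) = orbit \<Gamma> ` hyp"
    unfolding topspace_def o by blast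
  then show ?thesis unfolding quotient_map_def o by auto
qed

text \<open>The preimage in \<open>\<bbbH>\<^sup>n\<close> of a subset of \<open>\<Gamma>\<backslash>\<bbbH>\<^sup>n\<close>.\<close>

definition lift :: "'n::finite mink_mat set \<Rightarrow> 'n mink set set \<Rightarrow> 'n mink set" where
  "lift \<Gamma> S = {x \<in> hyp. orbit \<Gamma> x \<in> S}"


section \<open>Branched totally geodesic hypersurfaces\<close>

abbreviation components_in ::
  "'n::finite mink_mat set \<Rightarrow> 'n mink set set \<Rightarrow> 'n mink set set set" where
  "components_in \<Gamma> S \<equiv> connected_components_of (subtopology (quotient_manifold \<Gamma>) S)"

text \<open>A totally geodesic piece of codimension \<open>k\<close>: near each of its points, the preimage coincides
  with a totally geodesic copy of \<open>\<bbbH>\<^sup>n\<^sup>-\<^sup>k\<close>. In particular each component of the preimage lies in one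
  such copy.\<close>

definition totally_geodesic_piece ::
  "'n::finite mink_mat set \<Rightarrow> nat \<Rightarrow> 'n mink set set \<Rightarrow> bool" where
  "totally_geodesic_piece \<Gamma> k S \<longleftrightarrow>
     (\<forall>x \<in> lift \<Gamma> S. \<exists>P \<in> hyp_planes k. \<exists>U. open U \<and> x \<in> U \<and> lift \<Gamma> S \<inter> U = P \<inter> U)"

text \<open>The bindings are the components of \<open>B\<close>, the walls are those of \<open>\<Delta> - B\<close>. The last clause says
  that the walls meet one another along the bindings: every lift of a binding is adjacent to at
  least two lifted walls (which may project to the same wall).\<close>

definition branched_hypersurface ::
  "'n::finite mink_mat set \<Rightarrow> 'n mink set set \<Rightarrow> 'n mink set set \<Rightarrow> bool" where
  "branched_hypersurface \<Gamma> \<Delta> B \<longleftrightarrow>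
     closedin (quotient_manifold \<Gamma>) \<Delta> \<and> closedin (quotient_manifold \<Gamma>) B \<and> B \<subseteq> \<Delta> \<and>
     finite (components_in \<Gamma> B) \<and>
     (\<forall>b \<in> components_in \<Gamma> B. totally_geodesic_piece \<Gamma> 2 b) \<and>
     finite (components_in \<Gamma> (\<Delta> - B)) \<and>
     (\<forall>w \<in> components_in \<Gamma> (\<Delta> - B). totally_geodesic_piece \<Gamma> 1 w) \<and>
     (\<forall>\<beta> \<in> components (lift \<Gamma> B).
        \<exists>\<omega> \<in> components (lift \<Gamma> (\<Delta> - B)). \<exists>\<omega>' \<in> components (lift \<Gamma> (\<Delta> - B)).
          \<omega> \<noteq> \<omega>' \<and> \<beta> \<subseteq> closure \<omega> \<and> \<beta> \<subseteq> closure \<omega>')"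

text \<open>A transverse orientation of a wall of \<open>M\<close>: a continuous \<open>\<Gamma>\<close>-equivariant field of unit normals
  on its preimage.\<close>

definition transverse_orientation ::
  "'n::finite mink_mat set \<Rightarrow> 'n mink set set \<Rightarrow> ('n mink \<Rightarrow> 'n mink) \<Rightarrow> bool" where
  "transverse_orientation \<Gamma> w N \<longleftrightarrow>
     continuous_on (lift \<Gamma> w) N \<and>
     (\<forall>x \<in> lift \<Gamma> w.
        lorentz (N x) (N x) = 1 \<and>
        (\<exists>U. open U \<and> x \<in> U \<and> lift \<Gamma> w \<inter> U = {y \<in> hyp. lorentz y (N x) = 0} \<inter> U) \<and>
        (\<forall>\<gamma>\<in>\<Gamma>. N (\<gamma> *v x) = \<gamma> *v N x))"

definition region_stabilizer ::
  "'n::finite mink_mat set \<Rightarrow> 'n mink set \<Rightarrow> 'n mink_mat set" where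
  "region_stabilizer \<Gamma> \<delta> = {\<gamma> \<in> \<Gamma>. (\<lambda>x. \<gamma> *v x) ` \<delta> = \<delta>}"


section \<open>First group cohomology\<close>

text \<open>The orthogonal complement of \<open>so(n,1)\<close> in \<open>sl\<^sub>n\<^sub>+\<^sub>1(\<real>)\<close> for the Killing form
  \<open>2 (n+1) tr (X Y)\<close>: since \<open>so(n,1)\<close> is given by \<open>X\<^sup>T J = - J X\<close> with \<open>J = gram\<close>, it consists of
  the trace-free \<open>X\<close> with \<open>X\<^sup>T J = J X\<close>.\<close>

definition nu :: "'n::finite mink_mat set" where
  "nu = {X. trace X = 0 \<and> transpose X ** gram = gram ** X}"

definition Ad :: "'n::finite mink_mat \<Rightarrow> 'n mink_mat \<Rightarrow> 'n mink_mat" where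
  "Ad \<gamma> X = \<gamma> ** X ** matrix_inv \<gamma>"

text \<open>Inhomogeneous cocycles and coboundaries \<open>\<Gamma> \<rightarrow> V\<close>, extended by zero outside \<open>\<Gamma>\<close>.\<close>

definition cocycles ::
  "'n::finite mink_mat set \<Rightarrow> 'n mink_mat set \<Rightarrow> ('n mink_mat \<Rightarrow> 'n mink_mat) set" where
  "cocycles \<Gamma> V =
     {z. (\<forall>\<gamma>\<in>\<Gamma>. z \<gamma> \<in> V) \<and> (\<forall>\<gamma>. \<gamma> \<notin> \<Gamma> \<longrightarrow> z \<gamma> = 0) \<and>
         (\<forall>\<gamma>\<in>\<Gamma>. \<forall>\<eta>\<in>\<Gamma>. z (\<gamma> ** \<eta>) = z \<gamma> + Ad \<gamma> (z \<eta>))}"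

definition coboundaries ::
  "'n::finite mink_mat set \<Rightarrow> 'n mink_mat set \<Rightarrow> ('n mink_mat \<Rightarrow> 'n mink_mat) set" where
  "coboundaries \<Gamma> V = {\<lambda>\<gamma>. if \<gamma> \<in> \<Gamma> then Ad \<gamma> X - X else 0 | X. X \<in> V}"

definition H1 ::
  "'n::finite mink_mat set \<Rightarrow> 'n mink_mat set \<Rightarrow> ('n mink_mat \<Rightarrow> 'n mink_mat) set set" where
  "H1 \<Gamma> V = cocycles \<Gamma> V //
     {(z, z'). z \<in> cocycles \<Gamma> V \<and> z' \<in> cocycles \<Gamma> V \<and> (\<lambda>\<gamma>. z' \<gamma> - z \<gamma>) \<in> coboundaries \<Gamma> V}"

text \<open>Linear independence of a finite set \<open>C\<close> of classes: a linear combination \<open>\<Sum>h\<in>C. c h \<cdot> h\<close> is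
  represented by \<open>\<Sum>h\<in>C. c h \<cdot> s h\<close> for any choice of representatives \<open>s h \<in> h\<close>, and it is zero in
  \<open>H\<^sup>1\<close> iff the latter is a coboundary.\<close>

definition H1_independent ::
  "'n::finite mink_mat set \<Rightarrow> 'n mink_mat set \<Rightarrow> ('n mink_mat \<Rightarrow> 'n mink_mat) set set \<Rightarrow> bool" where
  "H1_independent \<Gamma> V C \<longleftrightarrow>
     finite C \<and> C \<subseteq> H1 \<Gamma> V \<and>
     (\<forall>s c. (\<forall>h\<in>C. s h \<in> h) \<longrightarrow> (\<lambda>\<gamma>. \<Sum>h\<in>C. c h *\<^sub>R s h \<gamma>) \<in> coboundaries \<Gamma> V \<longrightarrow>
            (\<forall>h\<in>C. c h = 0))"

definition dim_H1 :: "'n::finite mink_mat set \<Rightarrow> 'n mink_mat set \<Rightarrow> enat" where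
  "dim_H1 \<Gamma> V = (SUP C \<in> {C. H1_independent \<Gamma> V C}. enat (card C))"

end

theory Submission
  imports Defs
begin

text \<open>
  The classes are obtained by infinitesimally bending \<open>\<Gamma>\<close> along the walls. For a vector \<open>v\<close> put
  \<open>bend v = v v\<^sup>T J - (\<langle>v, v\<rangle> / (n + 1)) I\<close>, an element of \<open>nu\<close> that does not change when \<open>v\<close> is replaced
  by \<open>- v\<close>; for a unit normal \<open>v\<close> of a wall it spans the part of \<open>nu\<close> that is fixed by the isometries
  preserving the hyperplane of the wall. Give every wall \<open>w\<close> of \<open>M\<close> a real weight \<open>c w\<close>, and look for a function \<open>f\<close>
  with values in \<open>nu\<close> that is locally constant on the complement of the lifted hypersurface and
  increases by \<open>c w \<cdot> bend v\<close> when one crosses a lift of \<open>w\<close> in the direction of its normal \<open>v\<close>.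

  Suppose that \<open>f\<close> exists. The prescribed jumps are \<open>\<Gamma>\<close>-equivariant and \<open>f\<close> is determined by them up to
  a constant, so \<open>f (\<gamma> y) - Ad \<gamma> (f y)\<close> does not depend on \<open>y\<close>; these constants form a cocycle. If
  the cocycle is the coboundary of \<open>X\<close>, then \<open>f + X\<close> is \<open>\<Gamma>\<close>-equivariant, so its value on a region is
  invariant under the stabilizer of that region, hence by Zariski density under all of \<open>SO\<^sup>+(n,1)\<close>, and
  therefore zero (\<open>equivariant_locally_constant_zero\<close>). Then \<open>f\<close> is constant, all its jumps vanish, and
  \<open>c = 0\<close>. So the dimension of \<open>H\<^sup>1\<close> is at least that of the space of weights for which \<open>f\<close> exists.

  Away from the bindings \<open>f\<close> exists locally, and on a convex set local solutions always fit
  together (\<open>good_global\<close>). The only obstruction is the total jump along a small loop around a lift of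
  a binding. All walls near such a lift contain the codimension 2 plane in which it lies
  (\<open>binding_normals\<close>), so their normals lie in a plane. Since \<open>bend\<close> is quadratic, it takes values in a
  space of dimension 3 on that plane, and the total jump vanishes as soon as the weights satisfy
  three linear equations (\<open>binding_obstruction\<close>, \<open>binding_equations\<close>). Whether it vanishes is the same
  question at all points of all lifts of one binding (\<open>locally_good_spreads\<close>). There are thus
  \<open>3 c\<^sub>n\<^sub>-\<^sub>2\<close> equations for \<open>c\<^sub>n\<^sub>-\<^sub>1\<close> weights.

  Hyperbolic space is replaced throughout by the cone of future time-like vectors, of which it is
  the set of rays. This cone is an open convex set, totally geodesic subspaces become linear
  subspaces, and the isometries act linearly; the first half of the argument is therefore carried
  out for walls in an arbitrary open convex set of a Euclidean space.
\<close>

section \<open>Rays and complements of codimension two\<close>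

text \<open>
  Linear independence of the two functionals \<open>v \<mapsto> a \<bullet> v\<close> and \<open>v \<mapsto> b \<bullet> v\<close>, in the form in which it
  is used: a point of their common zero set can be moved into any of the four quadrants.
\<close>

definition transverse_pair :: "'a::euclidean_space \<Rightarrow> 'a \<Rightarrow> bool" where
  "transverse_pair a b \<longleftrightarrow> (\<forall>s t. \<exists>v. a \<bullet> v = s \<and> b \<bullet> v = t)"

abbreviation slit :: "'a::real_inner \<Rightarrow> 'a \<Rightarrow> 'a set" where
  "slit a b \<equiv> {z. a \<bullet> z = 0 \<and> b \<bullet> z \<le> 0}"

lemma open_contains_ray:
  fixes x v :: "'a::real_normed_vector"
  assumes "open U" "x \<in> U"
  obtains t where "t > 0" "x + t *\<^sub>R v \<in> U" "x - t *\<^sub>R v \<in> U"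
proof -
  obtain e where e: "e > 0" "ball x e \<subseteq> U" using assms open_contains_ball by metis
  define t where "t = e / (2 * (norm v + 1))"
  have p: "norm v + 1 > 0" by (simp add: add_nonneg_pos)
  have "t > 0" using e p by (simp add: t_def)
  moreover have "t * norm v < e"
  proof -
    have "t * norm v < t * (2 * (norm v + 1))" using \<open>t > 0\<close> p by (intro mult_strict_left_mono) auto
    also have "\<dots> = e" using p by (simp add: t_def)
    finally show ?thesis .
  qed
  ultimately have "x + t *\<^sub>R v \<in> ball x e" "x - t *\<^sub>R v \<in> ball x e"
    by (auto simp: dist_norm)
  then show ?thesis using that \<open>t > 0\<close> e by blast
qed

text \<open>
  The four half-space pieces of \<open>L\<close> given by the signs of \<open>a \<bullet> z\<close> and \<open>b \<bullet> z\<close> are convex, and each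
  meets the next one. Going once around connects the complement of the codimension 2 subspace;
  leaving out the piece \<open>b \<bullet> z < 0\<close> gives the complement of a slit.
\<close>

lemma connected_convex_minus_codim2:
  fixes L :: "'a::euclidean_space set"
  assumes L: "convex L"
    and quadrants: "\<And>s t. s \<in> {1, -1} \<Longrightarrow> t \<in> {1, -1} \<Longrightarrow> \<exists>z\<in>L. s * (a \<bullet> z) > 0 \<and> t * (b \<bullet> z) > (0::real)"
  shows "connected (L - {z. a \<bullet> z = 0 \<and> b \<bullet> z = 0})"
    and "connected (L - slit a b)"
proof -
  let ?K = "\<lambda>m. L \<inter> {z. m \<bullet> z > (0::real)}"
  have K: "connected (?K m)" for m
    by (intro convex_connected convex_Int L convex_halfspace_gt)
  have m: "?K a \<inter> ?K b \<noteq> {}" "?K (-a) \<inter> ?K b \<noteq> {}" "?K a \<inter> ?K (-b) \<noteq> {}"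
    using quadrants[of 1 1] quadrants[of "-1" 1] quadrants[of 1 "-1"] by (force simp:)+
  have 1: "connected (?K a \<union> ?K b)" by (intro connected_Un K m)
  have 2: "connected ((?K a \<union> ?K b) \<union> ?K (-a))"
    by (intro connected_Un K 1) (use m in blast)
  have 3: "connected (((?K a \<union> ?K b) \<union> ?K (-a)) \<union> ?K (-b))"
    by (intro connected_Un K 2) (use m in blast)
  have "L - {z. a \<bullet> z = 0 \<and> b \<bullet> z = 0} = ((?K a \<union> ?K b) \<union> ?K (-a)) \<union> ?K (-b)" by auto
  then show "connected (L - {z. a \<bullet> z = 0 \<and> b \<bullet> z = 0})" using 3 by simp
  have "L - slit a b = (?K a \<union> ?K b) \<union> ?K (-a)" by auto
  then show "connected (L - slit a b)" using 2 by simp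
qed

lemma ball_meets_quadrants:
  fixes x :: "'a::euclidean_space"
  assumes ab: "transverse_pair a b" and x: "a \<bullet> x = 0" "b \<bullet> x = 0" and U: "open U" "x \<in> U"
    and st: "s \<in> {1, -1}" "t \<in> {1, -1}"
  shows "\<exists>z\<in>U. s * (a \<bullet> z) > 0 \<and> t * (b \<bullet> z) > (0::real)"
proof -
  obtain v where v: "a \<bullet> v = s" "b \<bullet> v = t" using ab by (auto simp: transverse_pair_def)
  obtain r where r: "r > 0" "x + r *\<^sub>R v \<in> U" by (rule open_contains_ray[OF U])
  have "s * (a \<bullet> (x + r *\<^sub>R v)) > 0" "t * (b \<bullet> (x + r *\<^sub>R v)) > 0"
    using v x r st by (auto simp: inner_add_right)
  then show ?thesis using r by blast
qed

lemma ball_minus_codim2_connected: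
  fixes x :: "'a::euclidean_space"
  assumes ab: "transverse_pair a b" and x: "a \<bullet> x = 0" "b \<bullet> x = 0" and e: "e > 0"
  shows "connected (ball x e - {z. a \<bullet> z = 0 \<and> b \<bullet> z = 0})"
    and "connected (ball x e - slit a b)"
  using connected_convex_minus_codim2[OF convex_ball ball_meets_quadrants[OF ab x open_ball]] e
  by (simp_all)

text \<open>
  A linear hyperplane is determined by any of its germs, which turns local coincidence of walls into
  proportionality of their normals.
\<close>

lemma parallel_of_local_hyperplane:
  fixes m n z :: "'a::euclidean_space"
  assumes U: "open U" "z \<in> U" and z: "m \<bullet> z = 0" "n \<bullet> z = 0"
    and sub: "\<And>y. y \<in> U \<Longrightarrow> n \<bullet> y = 0 \<Longrightarrow> m \<bullet> y = 0"
  shows "\<exists>c. m = c *\<^sub>R n"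
proof (cases "n = 0")
  case True
  obtain t where t: "t > 0" "z + t *\<^sub>R m \<in> U" by (rule open_contains_ray[OF U])
  then have "m \<bullet> (z + t *\<^sub>R m) = 0" using sub True by simp
  then have "m = 0" using z t by (simp add: inner_add_right)
  then show ?thesis by (intro exI[of _ 0]) simp
next
  case False
  define c where "c = (m \<bullet> n) / (n \<bullet> n)"
  define v where "v = m - c *\<^sub>R n"
  have nv: "n \<bullet> v = 0" using False by (simp add: v_def c_def inner_diff_right inner_commute)
  obtain t where t: "t > 0" "z + t *\<^sub>R v \<in> U" by (rule open_contains_ray[OF U])
  have "m \<bullet> (z + t *\<^sub>R v) = 0" by (rule sub[OF t(2)]) (simp add: nv z inner_add_right)
  then have mv: "m \<bullet> v = 0" using z t by (simp add: inner_add_right)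
  have "v \<bullet> v = 0" using nv mv by (simp add: v_def inner_diff_left)
  then show ?thesis by (auto simp: v_def)
qed

lemma nonspan_witness:
  fixes n :: "'a::euclidean_space"
  assumes "n \<notin> span S"
  obtains q where "\<And>s. s \<in> span S \<Longrightarrow> s \<bullet> q = 0" "n \<bullet> q \<noteq> 0"
proof -
  obtain p q where pq: "p \<in> span S" "\<And>w. w \<in> span S \<Longrightarrow> orthogonal q w" "n = p + q"
    using orthogonal_subspace_decomp_exists[of S n] by metis
  then have q: "s \<bullet> q = 0" if "s \<in> span S" for s
    using pq(2)[OF that] by (simp add: orthogonal_def inner_commute)
  have "q \<noteq> 0" using pq assms by auto
  then have "n \<bullet> q \<noteq> 0" using pq(3) q[OF pq(1)] by (simp add: inner_add_left)
  with q that show ?thesis by blast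
qed

section \<open>Systems of walls in a convex open set\<close>

text \<open>
  \<open>D\<close> is the union of all walls and bindings, \<open>B\<close> that of the bindings, and \<open>n x\<close> is a conormal of the
  wall through \<open>x\<close>. Walls and bindings are pieces of linear subspaces, of codimension 1 and 2. The last
  clause says that every point of a binding is a limit of points of walls whose hyperplane contains
  the binding; that all walls near that point have this property is a consequence.
\<close>

locale wall_system =
  fixes C D B :: "'a::euclidean_space set" and n :: "'a \<Rightarrow> 'a"
  assumes open_C: "open C" and convex_C: "convex C" and BD: "B \<subseteq> D" and DC: "D \<subseteq> C"
    and off: "x \<in> C - D \<Longrightarrow> \<exists>U. open U \<and> x \<in> U \<and> U \<subseteq> C - D"
    and n_nonzero: "x \<in> D - B \<Longrightarrow> n x \<noteq> 0"
    and wall: "x \<in> D - B \<Longrightarrow> \<exists>U. open U \<and> x \<in> U \<and> U \<subseteq> C - B \<and>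
                 (\<forall>y\<in>U. (y \<in> D \<longleftrightarrow> n x \<bullet> y = 0) \<and> (y \<in> D \<longrightarrow> n y = n x))"
    and binding: "x \<in> B \<Longrightarrow> \<exists>a b U. transverse_pair a b \<and> open U \<and> x \<in> U \<and> U \<subseteq> C \<and>
                 (\<forall>y\<in>U. y \<in> B \<longleftrightarrow> a \<bullet> y = 0 \<and> b \<bullet> y = 0) \<and>
                 (\<forall>O'. open O' \<longrightarrow> x \<in> O' \<longrightarrow> (\<exists>y\<in>O' \<inter> (D - B). n y \<in> span {a, b}))"
begin

lemma wall_normal_orthogonal: "x \<in> D - B \<Longrightarrow> n x \<bullet> x = 0"
  using wall by blast

text \<open>
  A wall can only end at a binding: inside a connected subset of its hyperplane that avoids the
  bindings, it is both open and closed.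
\<close>

lemma wall_propagates:
  assumes L: "connected L" "L \<subseteq> C - B" and p: "p \<in> L" "p \<in> D"
    and flat: "\<And>z. z \<in> L \<Longrightarrow> n p \<bullet> z = 0" and z: "z \<in> L"
  shows "z \<in> D \<and> n z = n p"
proof (rule connected_induction_simple[OF L(1) p(1) z, of "\<lambda>z. z \<in> D \<and> n z = n p"])
  show "p \<in> D \<and> n p = n p" using p by simp
  fix a assume a: "a \<in> L"
  show "\<exists>T. openin (top_of_set L) T \<and> a \<in> T \<and>
          (\<forall>x\<in>T. \<forall>y\<in>T. x \<in> D \<and> n x = n p \<longrightarrow> y \<in> D \<and> n y = n p)"
  proof (cases "a \<in> D")
    case True
    then obtain U where U: "open U" "a \<in> U" "\<And>y. y \<in> U \<Longrightarrow> (y \<in> D \<longleftrightarrow> n a \<bullet> y = 0)"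
        "\<And>y. y \<in> U \<Longrightarrow> y \<in> D \<Longrightarrow> n y = n a"
      using wall[of a] a L by blast
    show ?thesis
      by (rule exI[of _ "L \<inter> U"]) (use U a flat in \<open>auto simp: openin_open_Int\<close>)
  next
    case False
    then obtain U where U: "open U" "a \<in> U" "U \<subseteq> C - D" using off a L by blast
    show ?thesis
      by (rule exI[of _ "L \<inter> U"]) (use U a flat in \<open>auto simp: openin_open_Int\<close>)
  qed
qed

section \<open>The walls near a binding\<close>

text \<open>
  Let walls \<open>P\<^sub>k\<close> through \<open>y\<^sub>k\<close> approach \<open>x\<close> with unit normals tending to \<open>\<nu>\<close>. Choose a fixed point \<open>z\<close> near
  \<open>x\<close> in the hyperplane orthogonal to \<open>\<nu>\<close> but off the binding. The projection \<open>w\<^sub>k\<close> of \<open>z\<close> to the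
  hyperplane of \<open>P\<^sub>k\<close> tends to \<open>z\<close>, and if the segment from \<open>y\<^sub>k\<close> to \<open>w\<^sub>k\<close> misses the binding, the wall \<open>P\<^sub>k\<close>
  extends to \<open>w\<^sub>k\<close>. Near \<open>z\<close> there is at most one wall, so the normal of \<open>P\<^sub>k\<close> is that of the wall through
  \<open>z\<close>. The segment can be obstructed, but not both for \<open>z\<close> and for its mirror image in \<open>x\<close>, because
  these lie on opposite sides of the binding. Hence the normals eventually belong to a set of two
  vectors, and a sequence in a finite set is eventually equal to its limit.
\<close>

lemma unit_normals_eventually_constant:
  fixes y :: "nat \<Rightarrow> 'a"
  assumes ab: "transverse_pair a b"
    and e: "e > 0" "ball x e \<subseteq> C" and B: "\<And>z. z \<in> ball x e \<Longrightarrow> z \<in> B \<longleftrightarrow> a \<bullet> z = 0 \<and> b \<bullet> z = 0"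
    and x: "x \<in> B"
    and y: "\<And>k. y k \<in> D - B" "y \<longlonglongrightarrow> x" and lim: "(\<lambda>k. sgn (n (y k))) \<longlonglongrightarrow> \<nu>"
  shows "eventually (\<lambda>k. sgn (n (y k)) = \<nu>) sequentially"
proof -
  define u where "u k = sgn (n (y k))" for k
  have u1: "norm (u k) = 1" for k using n_nonzero[OF y(1)] by (simp add: u_def norm_sgn)
  have nu_n: "n (y k) \<bullet> z = 0 \<longleftrightarrow> u k \<bullet> z = 0" for k z
    using n_nonzero[OF y(1)] by (simp add: u_def sgn_div_norm)
  have lim: "u \<longlonglongrightarrow> \<nu>" using lim by (simp add: u_def[abs_def])
  have uy: "u k \<bullet> y k = 0" for k using wall_normal_orthogonal[OF y(1)] nu_n by blast
  have "(\<lambda>k. u k \<bullet> y k) \<longlonglongrightarrow> \<nu> \<bullet> x" by (intro tendsto_inner lim y)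
  then have \<nu>x: "\<nu> \<bullet> x = 0" using uy by (simp add: LIMSEQ_const_iff)
  have abx: "a \<bullet> x = 0" "b \<bullet> x = 0" using B[of x] x e by auto
  obtain v where v: "\<nu> \<bullet> v = 0" "a \<bullet> v \<noteq> 0 \<or> b \<bullet> v \<noteq> 0"
  proof -
    obtain v1 v2 where v1: "a \<bullet> v1 = 1" "b \<bullet> v1 = 0" and v2: "a \<bullet> v2 = 0" "b \<bullet> v2 = 1"
      using ab unfolding transverse_pair_def by meson
    show ?thesis
    proof (cases "\<nu> \<bullet> v1 = 0")
      case True then show ?thesis using that v1 by force
    next
      case False
      define v where "v = v2 - ((\<nu> \<bullet> v2) / (\<nu> \<bullet> v1)) *\<^sub>R v1"
      have "\<nu> \<bullet> v = 0" "b \<bullet> v = 1" using False v1 v2 by (auto simp: v_def inner_diff_right)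
      then show ?thesis using that by force
    qed
  qed
  obtain t where t: "t > 0" "x + t *\<^sub>R v \<in> ball x e" "x - t *\<^sub>R v \<in> ball x e"
    using open_contains_ray[of "ball x e" x v] e by auto
  define z where "z \<sigma> = x + (\<sigma> * t) *\<^sub>R v" for \<sigma> :: real
  define w where "w \<sigma> k = z \<sigma> - (u k \<bullet> z \<sigma>) *\<^sub>R u k" for \<sigma> k
  have z: "z \<sigma> \<in> ball x e" "z \<sigma> \<in> C" "\<nu> \<bullet> z \<sigma> = 0" "z \<sigma> \<notin> B" if "\<sigma> \<in> {1,-1}" for \<sigma>
  proof -
    show 1: "z \<sigma> \<in> ball x e" using that t by (auto simp: z_def)
    show "z \<sigma> \<in> C" using 1 e by blast
    show "\<nu> \<bullet> z \<sigma> = 0" by (simp add: z_def inner_add_right \<nu>x v)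
    show "z \<sigma> \<notin> B" unfolding B[OF 1] using v abx t that by (auto simp: z_def inner_add_right)
  qed
  have uw: "u k \<bullet> w \<sigma> k = 0" for k \<sigma>
  proof -
    have "u k \<bullet> u k = 1" using u1 by (simp add: dot_square_norm)
    then show ?thesis by (simp add: w_def inner_diff_right)
  qed
  have wlim: "w \<sigma> \<longlonglongrightarrow> z \<sigma>" if "\<sigma> \<in> {1,-1}" for \<sigma>
  proof -
    have "w \<sigma> \<longlonglongrightarrow> z \<sigma> - (\<nu> \<bullet> z \<sigma>) *\<^sub>R \<nu>" unfolding w_def by (intro tendsto_intros lim)
    then show ?thesis using z(3)[OF that] by simp
  qed
  have ev_ball: "eventually (\<lambda>k. w \<sigma> k \<in> ball x e) sequentially" if "\<sigma> \<in> {1,-1}" for \<sigma>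
    using topological_tendstoD[OF wlim[OF that] open_ball z(1)[OF that]] .
  have ev_y: "eventually (\<lambda>k. y k \<in> ball x e) sequentially"
    by (rule topological_tendstoD[OF y(2)]) (use e in auto)
  have ev_n: "eventually (\<lambda>k. w \<sigma> k \<in> D \<longrightarrow> n (w \<sigma> k) = n (z \<sigma>)) sequentially" if \<sigma>: "\<sigma> \<in> {1,-1}" for \<sigma>
  proof (cases "z \<sigma> \<in> D")
    case True
    then obtain U where U: "open U" "z \<sigma> \<in> U" "\<And>y. y \<in> U \<Longrightarrow> y \<in> D \<Longrightarrow> n y = n (z \<sigma>)"
      using wall[of "z \<sigma>"] z(4)[OF \<sigma>] by blast
    show ?thesis by (rule eventually_mono[OF topological_tendstoD[OF wlim[OF \<sigma>] U(1,2)]]) (use U in auto)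
  next
    case False
    then obtain U where U: "open U" "z \<sigma> \<in> U" "U \<subseteq> C - D" using off z(2)[OF \<sigma>] by blast
    show ?thesis by (rule eventually_mono[OF topological_tendstoD[OF wlim[OF \<sigma>] U(1,2)]]) (use U in auto)
  qed
  \<comment> \<open>In the coordinates given by \<open>a\<close> and \<open>b\<close>, the two target points tend to opposite nonzero vectors.\<close>
  have ev_neg: "eventually (\<lambda>k. (a \<bullet> w 1 k) * (a \<bullet> w (-1) k) + (b \<bullet> w 1 k) * (b \<bullet> w (-1) k) < 0) sequentially"
  proof (rule order_tendstoD(2))
    show "(\<lambda>k. (a \<bullet> w 1 k) * (a \<bullet> w (-1) k) + (b \<bullet> w 1 k) * (b \<bullet> w (-1) k)) \<longlonglongrightarrow>
        (a \<bullet> z 1) * (a \<bullet> z (-1)) + (b \<bullet> z 1) * (b \<bullet> z (-1))"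
      by (intro tendsto_intros wlim) auto
    have "(a \<bullet> z 1) * (a \<bullet> z (-1)) + (b \<bullet> z 1) * (b \<bullet> z (-1)) = - t\<^sup>2 * ((a \<bullet> v)\<^sup>2 + (b \<bullet> v)\<^sup>2)"
      by (simp add: z_def inner_add_right inner_diff_right abx power2_eq_square algebra_simps)
    also have "\<dots> < 0"
    proof -
      have "(a \<bullet> v)\<^sup>2 + (b \<bullet> v)\<^sup>2 > 0" using v(2) by (simp add: sum_power2_gt_zero_iff)
      then show ?thesis using t(1) by (simp add: mult_pos_pos)
    qed
    finally show "(a \<bullet> z 1) * (a \<bullet> z (-1)) + (b \<bullet> z 1) * (b \<bullet> z (-1)) < 0" .
  qed
  define F where "F = {sgn (n (z 1)), sgn (n (z (-1)))}"
  have pm: "1 \<in> {1, - 1 :: real}" "- 1 \<in> {1, - 1 :: real}" by auto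
  have "eventually (\<lambda>k. u k \<in> F) sequentially"
    using ev_neg ev_y ev_ball[OF pm(1)] ev_ball[OF pm(2)] ev_n[OF pm(1)] ev_n[OF pm(2)]
  proof (eventually_elim, goal_cases)
    case (1 k)
    have hit: "closed_segment (y k) (w \<sigma> k) \<inter> B \<noteq> {}" if F: "u k \<notin> F" and \<sigma>: "\<sigma> \<in> {1,-1}" for \<sigma>
    proof
      assume disj: "closed_segment (y k) (w \<sigma> k) \<inter> B = {}"
      have wb: "w \<sigma> k \<in> ball x e" using 1 \<sigma> by auto
      have seg: "closed_segment (y k) (w \<sigma> k) \<subseteq> ball x e"
        using 1 wb by (intro closed_segment_subset convex_ball)
      have "w \<sigma> k \<in> D \<and> n (w \<sigma> k) = n (y k)"
      proof (rule wall_propagates[of "closed_segment (y k) (w \<sigma> k)"])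
        show "closed_segment (y k) (w \<sigma> k) \<subseteq> C - B" using disj seg e by blast
        show "y k \<in> D" using y by blast
        fix q assume "q \<in> closed_segment (y k) (w \<sigma> k)"
        then obtain s where "q = (1 - s) *\<^sub>R y k + s *\<^sub>R w \<sigma> k" by (auto simp: in_segment)
        then show "n (y k) \<bullet> q = 0" unfolding nu_n by (simp add: inner_add_right uy uw)
      qed auto
      then have "n (y k) = n (z \<sigma>)" using 1 \<sigma> by auto
      then have "u k \<in> F" using \<sigma> by (auto simp: F_def u_def)
      then show False using F by blast
    qed
    \<comment> \<open>If the segment from \<open>y k\<close> is obstructed, its end point lies opposite to \<open>y k\<close> across the binding;
      if both are, then the two end points lie on the same side.\<close>
    have mult: "\<exists>c\<ge>0. a \<bullet> w \<sigma> k = - c * (a \<bullet> y k) \<and> b \<bullet> w \<sigma> k = - c * (b \<bullet> y k)"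
      if F: "u k \<notin> F" and \<sigma>: "\<sigma> \<in> {1,-1}" for \<sigma>
    proof -
      have wb: "w \<sigma> k \<in> ball x e" using 1 \<sigma> by auto
      have seg: "closed_segment (y k) (w \<sigma> k) \<subseteq> ball x e"
        using 1 wb by (intro closed_segment_subset convex_ball)
      obtain q where q: "q \<in> closed_segment (y k) (w \<sigma> k)" "q \<in> B" using hit[OF F \<sigma>] by blast
      then obtain s where s: "0 \<le> s" "s \<le> 1" "q = (1 - s) *\<^sub>R y k + s *\<^sub>R w \<sigma> k"
        by (auto simp: in_segment)
      have s0: "s \<noteq> 0" using s q y(1)[of k] by auto
      have "a \<bullet> q = 0" "b \<bullet> q = 0" using B q seg by blast+
      then have "(1 - s) * (a \<bullet> y k) + s * (a \<bullet> w \<sigma> k) = 0" "(1 - s) * (b \<bullet> y k) + s * (b \<bullet> w \<sigma> k) = 0"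
        unfolding s(3) by (simp_all only: inner_add_right inner_scaleR_right)
      then have "a \<bullet> w \<sigma> k = - ((1 - s) / s) * (a \<bullet> y k) \<and> b \<bullet> w \<sigma> k = - ((1 - s) / s) * (b \<bullet> y k)"
        using s0 by (simp add: field_simps)
      then show ?thesis using s s0 by (intro exI[of _ "(1 - s) / s"]) auto
    qed
    show "u k \<in> F"
    proof (rule ccontr)
      assume F: "u k \<notin> F"
      obtain c where c: "c \<ge> 0" "a \<bullet> w 1 k = - c * (a \<bullet> y k)" "b \<bullet> w 1 k = - c * (b \<bullet> y k)"
        using mult[OF F, of 1] by auto
      obtain d where d: "d \<ge> 0" "a \<bullet> w (-1) k = - d * (a \<bullet> y k)" "b \<bullet> w (-1) k = - d * (b \<bullet> y k)"
        using mult[OF F, of "-1"] by auto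
      have "(a \<bullet> w 1 k) * (a \<bullet> w (-1) k) + (b \<bullet> w 1 k) * (b \<bullet> w (-1) k) =
          c * d * ((a \<bullet> y k)\<^sup>2 + (b \<bullet> y k)\<^sup>2)"
        by (simp add: c d power2_eq_square algebra_simps)
      also have "\<dots> \<ge> 0" using c d by simp
      finally show False using 1 by linarith
    qed
  qed
  moreover have "eventually (\<lambda>k. u k \<in> - (F - {\<nu>})) sequentially"
  proof (rule topological_tendstoD[OF lim])
    have "finite (F - {\<nu>})" by (simp add: F_def)
    then show "open (- (F - {\<nu>}))" by (intro open_Compl finite_imp_closed)
  qed simp
  ultimately have "eventually (\<lambda>k. u k = \<nu>) sequentially"
    by eventually_elim blast
  then show ?thesis by (simp add: u_def)
qed

text \<open>
  A wall \<open>P\<close> whose hyperplane passes through \<open>x\<close> without containing the binding would run on through the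
  whole ball, as it meets the binding only in codimension 3. It would therefore cross the half-space
  wall through \<open>y0\<close> that ends at the binding, at a point where two different walls meet; but off
  the bindings there is only one wall through each point.
\<close>

lemma all_walls_contain_binding:
  assumes ab: "transverse_pair a b"
    and e: "e > 0" "ball x e \<subseteq> C" and B: "\<And>z. z \<in> ball x e \<Longrightarrow> z \<in> B \<longleftrightarrow> a \<bullet> z = 0 \<and> b \<bullet> z = 0"
    and x: "x \<in> B" and y0: "y0 \<in> ball x e" "y0 \<in> D - B" "n y0 \<in> span {a, b}"
    and y: "y \<in> ball x e" "y \<in> D - B" "n y \<bullet> x = 0"
  shows "n y \<in> span {a, b}"
proof (rule ccontr)
  assume "n y \<notin> span {a, b}"
  then obtain q where q: "\<And>s. s \<in> span {a, b} \<Longrightarrow> s \<bullet> q = 0" "n y \<bullet> q \<noteq> 0"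
    using nonspan_witness by blast
  have qab: "a \<bullet> q = 0" "b \<bullet> q = 0" using q(1) by (auto simp: span_base)
  have abx: "a \<bullet> x = 0" "b \<bullet> x = 0" using B[of x] x e by auto
  define L where "L = ball x e \<inter> {z. n y \<bullet> z = 0}"
  define Q where "Q = {z. a \<bullet> z = 0 \<and> b \<bullet> z = 0}"
  have conn: "connected (L - Q)"
    unfolding Q_def
  proof (rule connected_convex_minus_codim2(1))
    show "convex L" unfolding L_def by (intro convex_Int convex_ball convex_hyperplane)
    fix s t :: real assume st: "s \<in> {1, -1}" "t \<in> {1, -1}"
    obtain v where v: "a \<bullet> v = s" "b \<bullet> v = t" using ab by (auto simp: transverse_pair_def)
    define v' where "v' = v - ((n y \<bullet> v) / (n y \<bullet> q)) *\<^sub>R q"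
    have v': "n y \<bullet> v' = 0" "a \<bullet> v' = s" "b \<bullet> v' = t"
      using q v qab by (auto simp: v'_def inner_diff_right)
    obtain r where r: "r > 0" "x + r *\<^sub>R v' \<in> ball x e"
      using open_contains_ray[of "ball x e" x v'] e by auto
    have "x + r *\<^sub>R v' \<in> L" using r v' y by (simp add: L_def inner_add_right)
    moreover have "s * (a \<bullet> (x + r *\<^sub>R v')) > 0 \<and> t * (b \<bullet> (x + r *\<^sub>R v')) > 0"
      using st v' abx r by (auto simp: inner_add_right)
    ultimately show "\<exists>z\<in>L. s * (a \<bullet> z) > 0 \<and> t * (b \<bullet> z) > 0" by blast
  qed
  have LB: "L - Q \<subseteq> C - B" using B e by (auto simp: L_def Q_def)
  have Ln: "z \<in> D \<and> n z = n y" if "z \<in> L - Q" for z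
  proof (rule wall_propagates[OF conn LB _ _ _ that])
    show "y \<in> L - Q" using y B wall_normal_orthogonal by (auto simp: L_def Q_def)
  qed (use y in \<open>auto simp: L_def\<close>)
  obtain m where m: "m \<in> span {a, b}" "m \<bullet> y0 > 0"
  proof -
    have "a \<bullet> y0 \<noteq> 0 \<or> b \<bullet> y0 \<noteq> 0" using B y0 by blast
    then consider "a \<bullet> y0 > 0" | "(-a) \<bullet> y0 > 0" | "b \<bullet> y0 > 0" | "(-b) \<bullet> y0 > 0" by force
    then show ?thesis
      by cases (use that in \<open>auto intro: span_base span_neg simp del: inner_minus_left\<close>)
  qed
  have orth_x: "s \<bullet> x = 0" if "s \<in> span {a, b}" for s
    using that
  proof (induction rule: span_induct_alt)
    case (step c v w) then show ?case using abx by (auto simp: inner_add_left)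
  qed simp
  define H where "H = ball x e \<inter> {z. n y0 \<bullet> z = 0} \<inter> {z. m \<bullet> z > 0}"
  have orth_Q: "s \<bullet> z = 0" if "s \<in> span {a, b}" "z \<in> Q" for s z
    using that(1)
  proof (induction rule: span_induct_alt)
    case (step c v w) then show ?case using that by (auto simp: inner_add_left Q_def)
  qed simp
  have HB: "H \<subseteq> C - B"
  proof
    fix z assume z: "z \<in> H"
    then have "z \<notin> Q" using orth_Q[OF m(1)] by (force simp: H_def)
    then show "z \<in> C - B" using z B e by (auto simp: H_def Q_def)
  qed
  have Hc: "connected H" unfolding H_def
    by (intro convex_connected convex_Int convex_ball convex_hyperplane convex_halfspace_gt)
  have Hn: "z \<in> D \<and> n z = n y0" if "z \<in> H" for z
  proof (rule wall_propagates[OF Hc HB _ _ _ that])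
    show "y0 \<in> H" using y0 m wall_normal_orthogonal by (auto simp: H_def)
  qed (use y0 in \<open>auto simp: H_def\<close>)
  \<comment> \<open>Moving from \<open>x\<close> in the direction of \<open>y0\<close>, corrected along the binding, stays in both walls.\<close>
  define h where "h = (y0 - x) - ((n y \<bullet> (y0 - x)) / (n y \<bullet> q)) *\<^sub>R q"
  have h: "n y \<bullet> h = 0" using q by (simp add: h_def inner_diff_right)
  have hm: "m \<bullet> h > 0" using m q orth_x by (simp add: h_def inner_diff_right)
  have hn: "n y0 \<bullet> h = 0"
    using y0 q orth_x wall_normal_orthogonal[OF y0(2)] by (simp add: h_def inner_diff_right)
  obtain r where r: "r > 0" "x + r *\<^sub>R h \<in> ball x e"
    using open_contains_ray[of "ball x e" x h] e by auto
  have zH: "x + r *\<^sub>R h \<in> H"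
    using r hm hn orth_x[OF m(1)] orth_x[OF y0(3)] by (simp add: H_def inner_add_right)
  moreover have "x + r *\<^sub>R h \<in> L - Q"
    using r h y(3) zH orth_Q[OF m(1)] by (force simp: L_def H_def inner_add_right)
  ultimately have "n y = n y0" using Hn Ln by metis
  then show False using \<open>n y \<notin> span {a, b}\<close> y0 by simp
qed

text \<open>
  If walls whose normals are not in \<open>span {a, b}\<close> came arbitrarily close to \<open>x\<close>, a subsequence of
  their unit normals would converge, hence be eventually constant. The hyperplanes of late members
  would then pass through \<open>x\<close> itself, which is excluded.
\<close>

lemma binding_normals:
  assumes "x \<in> B"
  obtains a b e where "transverse_pair a b" "e > 0" "ball x e \<subseteq> C"
    "\<And>y. y \<in> ball x e \<Longrightarrow> y \<in> B \<longleftrightarrow> a \<bullet> y = 0 \<and> b \<bullet> y = 0"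
    "\<And>y. y \<in> ball x e \<Longrightarrow> y \<in> D - B \<Longrightarrow> n y \<in> span {a, b}"
proof -
  obtain a b U where ab: "transverse_pair a b" and U: "open U" "x \<in> U" "U \<subseteq> C"
    and UB: "\<And>y. y \<in> U \<Longrightarrow> y \<in> B \<longleftrightarrow> a \<bullet> y = 0 \<and> b \<bullet> y = 0"
    and adj: "\<And>O'. open O' \<Longrightarrow> x \<in> O' \<Longrightarrow> \<exists>y\<in>O' \<inter> (D - B). n y \<in> span {a, b}"
    using binding[OF assms] by metis
  obtain e where e: "e > 0" "ball x e \<subseteq> U" using U open_contains_ball by metis
  have eC: "ball x e \<subseteq> C" using e U by blast
  have eB: "\<And>y. y \<in> ball x e \<Longrightarrow> y \<in> B \<longleftrightarrow> a \<bullet> y = 0 \<and> b \<bullet> y = 0" using e UB by blast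
  have "\<exists>d>0. \<forall>y\<in>ball x d \<inter> (D - B). n y \<in> span {a, b}"
  proof (rule ccontr)
    assume "\<not> ?thesis"
    then have *: "\<exists>y\<in>ball x d \<inter> (D - B). n y \<notin> span {a, b}" if "d > 0" for d
      using that by blast
    have "\<forall>k. \<exists>y. y \<in> ball x (1 / real (Suc k)) \<inter> (D - B) \<and> n y \<notin> span {a, b}"
      using * by (metis divide_pos_pos of_nat_0_less_iff zero_less_Suc zero_less_one)
    then obtain y where y: "\<And>k. y k \<in> ball x (1 / real (Suc k))" "\<And>k. y k \<in> D - B"
      "\<And>k. n (y k) \<notin> span {a, b}" by (metis Int_iff)
    have ylim: "y \<longlonglongrightarrow> x"
    proof (rule tendstoI)
      fix r :: real assume r: "r > 0"
      obtain N where N: "inverse (real (Suc N)) < r" using reals_Archimedean[OF r] by blast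
      have "dist (y k) x < r" if "k \<ge> N" for k
      proof -
        have "dist (y k) x < 1 / real (Suc k)" using y(1)[of k] by (simp add: dist_commute)
        also have "\<dots> \<le> inverse (real (Suc N))" using that by (simp add: field_simps)
        finally show ?thesis using N by simp
      qed
      then show "eventually (\<lambda>k. dist (y k) x < r) sequentially"
        by (auto simp: eventually_sequentially)
    qed
    have "\<forall>k. sgn (n (y k)) \<in> sphere 0 1" using n_nonzero[OF y(2)] by (simp add: norm_sgn)
    then obtain \<nu> r where r: "strict_mono (r :: nat \<Rightarrow> nat)" "((\<lambda>k. sgn (n (y k))) \<circ> r) \<longlonglongrightarrow> \<nu>"
      using compact_sphere[of "0::'a" 1] unfolding compact_def by meson
    have yr: "(\<lambda>k. y (r k)) \<longlonglongrightarrow> x" using LIMSEQ_subseq_LIMSEQ[OF ylim r(1)] by (simp add: o_def)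
    have lim: "(\<lambda>k. sgn (n (y (r k)))) \<longlonglongrightarrow> \<nu>" using r(2) by (simp add: o_def)
    have "eventually (\<lambda>k. sgn (n (y (r k))) = \<nu>) sequentially"
      by (rule unit_normals_eventually_constant[OF ab e(1) eC eB assms y(2) yr lim])
    moreover have "eventually (\<lambda>k. y (r k) \<in> ball x e) sequentially"
      by (rule topological_tendstoD[OF yr]) (use e in auto)
    ultimately have "eventually (\<lambda>k. sgn (n (y (r k))) = \<nu> \<and> y (r k) \<in> ball x e) sequentially"
      by (rule eventually_conj)
    then obtain k where k: "sgn (n (y (r k))) = \<nu>" "y (r k) \<in> ball x e"
      using eventually_happens by force
    have "(\<lambda>k. sgn (n (y (r k))) \<bullet> y (r k)) \<longlonglongrightarrow> \<nu> \<bullet> x" by (intro tendsto_inner lim yr)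
    moreover have "sgn (n (y (r k))) \<bullet> y (r k) = 0" for k
      using wall_normal_orthogonal[OF y(2)] by (simp add: sgn_div_norm)
    ultimately have "\<nu> \<bullet> x = 0" by (simp add: LIMSEQ_const_iff)
    then have nx: "n (y (r k)) \<bullet> x = 0"
      using k n_nonzero[OF y(2)] by (auto simp: sgn_div_norm)
    obtain y0 where "y0 \<in> ball x e \<inter> (D - B)" "n y0 \<in> span {a, b}"
      using adj[of "ball x e"] e by auto
    then have "n (y (r k)) \<in> span {a, b}"
      using all_walls_contain_binding[OF ab e(1) eC eB assms _ _ _ k(2) y(2) nx] by blast
    then show False using y(3) by blast
  qed
  then obtain d where d: "d > 0" "\<And>y. y \<in> ball x d \<Longrightarrow> y \<in> D - B \<Longrightarrow> n y \<in> span {a, b}" by blast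
  show ?thesis
    by (rule that[of a b "min d e"]) (use ab d e eC eB in auto)
qed

section \<open>Locally constant functions with prescribed jumps\<close>

text \<open>
  \<open>f\<close> is locally constant on \<open>W - D\<close> and has the jump \<open>J x\<close> at the points \<open>x\<close> of walls in \<open>W\<close>. The
  bindings are left out because solutions for \<open>W - B\<close> and for \<open>W\<close> are the same; what the bindings
  restrict is the existence of a solution.
\<close>

definition good :: "('a \<Rightarrow> 'b::real_vector) \<Rightarrow> 'a set \<Rightarrow> ('a \<Rightarrow> 'b) \<Rightarrow> bool" where
  "good J W f \<longleftrightarrow> (\<forall>x\<in>W - B. \<exists>U v. open U \<and> x \<in> U \<and>
     (\<forall>y\<in>U - D. f y = v + (if x \<in> D \<and> n x \<bullet> y > 0 then J x else 0)))"

definition locally_const :: "('a \<Rightarrow> 'b) \<Rightarrow> bool" where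
  "locally_const J \<longleftrightarrow> (\<forall>x\<in>D - B. \<exists>U. open U \<and> x \<in> U \<and> (\<forall>y\<in>U \<inter> D. J y = J x))"

lemma complement_dense:
  assumes "x \<in> C" "open U" "x \<in> U"
  shows "\<exists>y. y \<in> U - D"
proof -
  have D: "\<exists>y. y \<in> U - D" if x: "x \<in> D - B" "x \<in> U" for x
  proof -
    obtain V where V: "open V" "x \<in> V" "\<And>y. y \<in> V \<Longrightarrow> (y \<in> D \<longleftrightarrow> n x \<bullet> y = 0)"
      using wall[OF x(1)] by blast
    obtain t where t: "t > 0" "x + t *\<^sub>R n x \<in> U \<inter> V"
      using open_contains_ray[of "U \<inter> V" x "n x"] V assms x by blast
    have "n x \<bullet> (x + t *\<^sub>R n x) \<noteq> 0"
      using wall_normal_orthogonal[OF x(1)] n_nonzero[OF x(1)] t by (simp add: inner_add_right)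
    then show ?thesis using V t by blast
  qed
  consider "x \<notin> D" | "x \<in> D - B" | "x \<in> B" by blast
  then show ?thesis
  proof cases
    case 3
    then obtain y where "y \<in> U \<inter> (D - B)" using binding[OF 3] assms by metis
    then show ?thesis using D by blast
  qed (use D assms in blast)+
qed

text \<open>
  Since the complement of \<open>D\<close> is dense, overlapping neighbourhoods share points off \<open>D\<close>, so local
  constancy modulo \<open>S\<close> passes across the walls. Both uniqueness (\<open>S = {0}\<close>) and the position of the
  values of \<open>f\<close> come from this.
\<close>

lemma constant_mod_subspace:
  fixes h :: "'a \<Rightarrow> 'b::real_vector"
  assumes W: "connected W" "open W" "W \<subseteq> C" and S: "subspace S"
    and loc: "\<And>x. x \<in> W \<Longrightarrow> \<exists>U. open U \<and> x \<in> U \<and> (\<forall>y\<in>U - D. \<forall>y'\<in>U - D. h y - h y' \<in> S)"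
    and ab: "a \<in> W - D" "b \<in> W - D"
  shows "h a - h b \<in> S"
proof (rule connected_equivalence_relation_gen[OF W(1), of a b "\<lambda>z. z \<notin> D" "\<lambda>x y. h x - h y \<in> S"])
  fix x y z assume "h x - h y \<in> S" "h y - h z \<in> S"
  then have "(h x - h y) + (h y - h z) \<in> S" by (rule subspace_add[OF S])
  then show "h x - h z \<in> S" by simp
next
  fix T a assume T: "openin (top_of_set W) T" "a \<in> T"
  then have "open T" "T \<subseteq> W" using W openin_open_trans openin_imp_subset by blast+
  then show "\<exists>z. z \<in> T \<and> z \<notin> D" using complement_dense[of a T] T W by blast
next
  fix x assume x: "x \<in> W"
  obtain U where U: "open U" "x \<in> U" "\<forall>y\<in>U - D. \<forall>y'\<in>U - D. h y - h y' \<in> S" using loc[OF x] by blast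
  show "\<exists>T. openin (top_of_set W) T \<and> x \<in> T \<and> (\<forall>x\<in>T. \<forall>y\<in>T. x \<notin> D \<and> y \<notin> D \<longrightarrow> h x - h y \<in> S)"
    by (rule exI[of _ "W \<inter> U"]) (use U x in \<open>auto simp: openin_open_Int\<close>)
qed (use ab in auto)

lemma good_subset: "good J W f \<Longrightarrow> V - B \<subseteq> W \<Longrightarrow> good J V f"
  unfolding good_def by blast

lemma good_Un: "good J (V \<union> W) f \<longleftrightarrow> good J V f \<and> good J W f"
  unfolding good_def by blast

lemma good_cong:
  assumes f: "good J W f" and W: "open W" and eq: "\<And>y. y \<in> W - D \<Longrightarrow> g y = f y"
  shows "good J W g"
  unfolding good_def
proof
  fix x assume x: "x \<in> W - B"
  then obtain U v where U: "open U" "x \<in> U"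
      "\<forall>y\<in>U - D. f y = v + (if x \<in> D \<and> n x \<bullet> y > 0 then J x else 0)"
    using f unfolding good_def by meson
  show "\<exists>U v. open U \<and> x \<in> U \<and> (\<forall>y\<in>U - D. g y = v + (if x \<in> D \<and> n x \<bullet> y > 0 then J x else 0))"
    by (rule exI[of _ "U \<inter> W"], rule exI[of _ v]) (use U W x eq in auto)
qed

lemma good_add:
  assumes "good J W f" "good J' W f'"
  shows "good (\<lambda>x. J x + J' x) W (\<lambda>y. f y + f' y)"
  unfolding good_def
proof
  fix x assume x: "x \<in> W - B"
  obtain U v where U: "open U" "x \<in> U"
      "\<forall>y\<in>U - D. f y = v + (if x \<in> D \<and> n x \<bullet> y > 0 then J x else 0)"
    using assms x unfolding good_def by meson
  obtain U' v' where U': "open U'" "x \<in> U'"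
      "\<forall>y\<in>U' - D. f' y = v' + (if x \<in> D \<and> n x \<bullet> y > 0 then J' x else 0)"
    using assms x unfolding good_def by meson
  show "\<exists>U v. open U \<and> x \<in> U \<and>
      (\<forall>y\<in>U - D. f y + f' y = v + (if x \<in> D \<and> n x \<bullet> y > 0 then J x + J' x else 0))"
    by (rule exI[of _ "U \<inter> U'"], rule exI[of _ "v + v'"]) (use U U' in auto)
qed

lemma good_scale:
  assumes "good J W f"
  shows "good (\<lambda>x. c *\<^sub>R J x) W (\<lambda>y. c *\<^sub>R f y)"
  unfolding good_def
proof
  fix x assume x: "x \<in> W - B"
  obtain U v where U: "open U" "x \<in> U"
      "\<forall>y\<in>U - D. f y = v + (if x \<in> D \<and> n x \<bullet> y > 0 then J x else 0)"
    using assms x unfolding good_def by meson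
  show "\<exists>U v. open U \<and> x \<in> U \<and>
      (\<forall>y\<in>U - D. c *\<^sub>R f y = v + (if x \<in> D \<and> n x \<bullet> y > 0 then c *\<^sub>R J x else 0))"
    by (rule exI[of _ U], rule exI[of _ "c *\<^sub>R v"]) (use U in \<open>auto simp: scaleR_add_right\<close>)
qed

lemma good_const: "good (\<lambda>x. 0) W (\<lambda>y. v)"
  unfolding good_def by (auto intro!: exI[of _ UNIV] exI[of _ v])

lemma good_shift: "good J W f \<Longrightarrow> good J W (\<lambda>y. f y + v)"
  using good_add[OF _ good_const] by force

lemma good_sum:
  assumes "finite I" "\<And>i. i \<in> I \<Longrightarrow> good (J i) W (f i)"
  shows "good (\<lambda>x. \<Sum>i\<in>I. c i *\<^sub>R J i x) W (\<lambda>y. \<Sum>i\<in>I. c i *\<^sub>R f i y)"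
  using assms
proof (induction I)
  case empty then show ?case by (simp add: good_const)
next
  case (insert i I)
  then have "good (\<lambda>x. c i *\<^sub>R J i x + (\<Sum>i\<in>I. c i *\<^sub>R J i x)) W
      (\<lambda>y. c i *\<^sub>R f i y + (\<Sum>i\<in>I. c i *\<^sub>R f i y))"
    by (intro good_add good_scale) auto
  with insert show ?case by simp
qed

lemma good_glue:
  assumes "good J V f" "good J W g" "open V" "open W"
    and "\<And>y. y \<in> V \<Longrightarrow> y \<in> W \<Longrightarrow> y \<notin> D \<Longrightarrow> f y = g y"
  shows "good J (V \<union> W) (\<lambda>y. if y \<in> V then f y else g y)"
  unfolding good_Un
proof
  show "good J V (\<lambda>y. if y \<in> V then f y else g y)" by (rule good_cong[OF assms(1,3)]) auto
  show "good J W (\<lambda>y. if y \<in> V then f y else g y)" by (rule good_cong[OF assms(2,4)]) (use assms in auto)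
qed

lemma good_constant_mod_off_bindings:
  assumes f: "good J W f" and W: "connected W" "open W" "W \<subseteq> C - B" and S: "subspace S"
    and J: "\<And>x. x \<in> W \<Longrightarrow> x \<in> D - B \<Longrightarrow> J x \<in> S"
    and ab: "a \<in> W - D" "b \<in> W - D"
  shows "f a - f b \<in> S"
proof (rule constant_mod_subspace[OF W(1,2) _ S _ ab])
  show "W \<subseteq> C" using W by blast
  fix x assume x: "x \<in> W"
  then have "x \<in> W - B" using W by blast
  then obtain U v where U: "open U" "x \<in> U"
      "\<forall>y\<in>U - D. f y = v + (if x \<in> D \<and> n x \<bullet> y > 0 then J x else 0)"
    using f unfolding good_def by meson
  have "f y - f y' \<in> S" if "y \<in> U - D" "y' \<in> U - D" for y y'
  proof -
    have "x \<in> D \<Longrightarrow> J x \<in> S" using J x W by blast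
    then show ?thesis using U that S by (auto simp: subspace_0 subspace_neg)
  qed
  then show "\<exists>U. open U \<and> x \<in> U \<and> (\<forall>y\<in>U - D. \<forall>y'\<in>U - D. f y - f y' \<in> S)" using U by blast
qed

text \<open>
  At a binding point there is no local condition to start from, but a ball minus a codimension 2
  subspace is connected, so \<open>f\<close> is constant modulo \<open>S\<close> on the ball anyway.
\<close>

lemma good_constant_mod:
  assumes f: "good J W f" and W: "connected W" "open W" "W \<subseteq> C" and S: "subspace S"
    and J: "\<And>x. x \<in> W \<Longrightarrow> x \<in> D - B \<Longrightarrow> J x \<in> S"
    and ab: "a \<in> W - D" "b \<in> W - D"
  shows "f a - f b \<in> S"
proof (rule constant_mod_subspace[OF W S _ ab])
  fix x assume x: "x \<in> W"
  obtain V where V: "open V" "x \<in> V" "connected (V - B)" "open (V - B)" "V \<subseteq> W"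
  proof (cases "x \<in> B")
    case True
    then obtain a b e where ab: "transverse_pair a b" "e > 0" "ball x e \<subseteq> C"
        "\<And>y. y \<in> ball x e \<Longrightarrow> y \<in> B \<longleftrightarrow> a \<bullet> y = 0 \<and> b \<bullet> y = 0"
      using binding_normals by metis
    obtain e' where e': "e' > 0" "ball x e' \<subseteq> W" using W x open_contains_ball by metis
    define d where "d = min e e'"
    have d: "d > 0" "ball x d \<subseteq> ball x e" "ball x d \<subseteq> W" using ab e' by (auto simp: d_def)
    have x0: "a \<bullet> x = 0" "b \<bullet> x = 0" using ab(4)[of x] ab(2) True by auto
    have eq: "ball x d - B = ball x d - {z. a \<bullet> z = 0 \<and> b \<bullet> z = 0}" using ab(4) d by blast
    have "closed {z. a \<bullet> z = 0 \<and> b \<bullet> z = 0}"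
      unfolding Collect_conj_eq by (intro closed_Int closed_hyperplane)
    then have "open (ball x d - B)" unfolding eq by (intro open_Diff open_ball)
    moreover have "connected (ball x d - B)"
      unfolding eq by (rule ball_minus_codim2_connected[OF ab(1) x0 d(1)])
    ultimately show ?thesis using that[of "ball x d"] d by auto
  next
    case False
    have "\<exists>U. open U \<and> x \<in> U \<and> U \<subseteq> C - B"
    proof (cases "x \<in> D")
      case True then show ?thesis using wall[of x] False by blast
    next
      case False then show ?thesis using off[of x] x W BD by blast
    qed
    then obtain U where U: "open U" "x \<in> U" "U \<subseteq> C - B" by blast
    then obtain e where e: "e > 0" "ball x e \<subseteq> U \<inter> W"
      using open_contains_ball[of "U \<inter> W"] W x by blast
    then have "ball x e - B = ball x e" using U by blast
    then show ?thesis using that[of "ball x e"] e by (auto)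
  qed
  have "f y - f y' \<in> S" if "y \<in> V - D" "y' \<in> V - D" for y y'
  proof (rule good_constant_mod_off_bindings[OF _ V(3,4) _ S])
    show "good J (V - B) f" by (rule good_subset[OF f]) (use V in auto)
  qed (use V W J that BD in auto)
  then show "\<exists>U. open U \<and> x \<in> U \<and> (\<forall>y\<in>U - D. \<forall>y'\<in>U - D. f y - f y' \<in> S)" using V by blast
qed

lemma good_unique:
  assumes "good J W f" "good J W g" and W: "connected W" "open W" "W \<subseteq> C"
    and ab: "a \<in> W - D" "b \<in> W - D"
  shows "f a - g a = f b - g b"
proof -
  have "good (\<lambda>x. J x + (-1) *\<^sub>R J x) W (\<lambda>y. f y + (-1) *\<^sub>R g y)"
    by (intro good_add good_scale assms)
  then have "(f a + (-1) *\<^sub>R g a) - (f b + (-1) *\<^sub>R g b) \<in> {0}"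
    by (rule good_constant_mod[OF _ W _ _ ab]) (auto simp: subspace_single_0)
  then show ?thesis by simp
qed

lemma good_exists_off_bindings:
  assumes x: "x \<in> C - B" and J: "locally_const J"
  shows "\<exists>U f. open U \<and> x \<in> U \<and> good J U f"
proof (cases "x \<in> D")
  case True
  then obtain U1 where U1: "open U1" "x \<in> U1" "U1 \<subseteq> C - B"
      "\<And>y. y \<in> U1 \<Longrightarrow> (y \<in> D \<longleftrightarrow> n x \<bullet> y = 0)" "\<And>y. y \<in> U1 \<Longrightarrow> y \<in> D \<Longrightarrow> n y = n x"
    using wall[of x] x by blast
  obtain U2 where U2: "open U2" "x \<in> U2" "\<And>y. y \<in> U2 \<Longrightarrow> y \<in> D \<Longrightarrow> J y = J x"
    using J True x unfolding locally_const_def by (metis DiffD2 DiffI IntI)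
  define U where "U = U1 \<inter> U2"
  define f where "f y = (if n x \<bullet> y > 0 then J x else 0)" for y
  have "good J U f"
    unfolding good_def
  proof
    fix z assume z: "z \<in> U - B"
    consider "z \<in> D" | "n x \<bullet> z > 0" | "n x \<bullet> z < 0" using z U1(4)[of z] by (force simp: U_def)
    then show "\<exists>U v. open U \<and> z \<in> U \<and> (\<forall>y\<in>U - D. f y = v + (if z \<in> D \<and> n z \<bullet> y > 0 then J z else 0))"
    proof cases
      case 1
      then have "n z = n x" "J z = J x" using U1 U2 z by (auto simp: U_def)
      then show ?thesis using 1 by (intro exI[of _ UNIV] exI[of _ 0]) (auto simp: f_def)
    next
      case 2
      then have "z \<notin> D" using U1(4)[of z] z by (auto simp: U_def)
      then show ?thesis using 2
        by (intro exI[of _ "{y. n x \<bullet> y > 0}"] exI[of _ "J x"]) (auto simp: f_def open_halfspace_gt)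
    next
      case 3
      then have "z \<notin> D" using U1(4)[of z] z by (auto simp: U_def)
      then show ?thesis using 3
        by (intro exI[of _ "{y. n x \<bullet> y < 0}"] exI[of _ 0]) (auto simp: f_def open_halfspace_lt)
    qed
  qed
  then show ?thesis using U1 U2 by (intro exI[of _ U] exI[of _ f]) (auto simp: U_def)
next
  case False
  then obtain U where U: "open U" "x \<in> U" "U \<subseteq> C - D" using off x by blast
  have "good J U (\<lambda>y. 0)"
    unfolding good_def by (intro ballI exI[of _ U] exI[of _ 0]) (use U in auto)
  then show ?thesis using U by blast
qed

text \<open>
  On a connected intersection the two functions differ by a constant, which can be absorbed into \<open>g\<close>.
\<close>

lemma good_glue_connected:
  assumes fg: "good J V f" "good J W g" and VW: "open V" "open W" "connected (V \<inter> W)" "V \<subseteq> C"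
  obtains h where "good J (V \<union> W) h" "\<And>y. y \<in> V \<Longrightarrow> h y = f y"
proof (cases "V \<inter> W - D = {}")
  case True
  have "good J (V \<union> W) (\<lambda>y. if y \<in> V then f y else g y)"
    by (rule good_glue[OF fg VW(1,2)]) (use True in blast)
  then show ?thesis using that by force
next
  case False
  then obtain p where p: "p \<in> V \<inter> W - D" by blast
  define g' where "g' y = g y + (f p - g p)" for y
  have g': "good J W g'" unfolding g'_def by (rule good_shift[OF fg(2)])
  have "good J (V \<union> W) (\<lambda>y. if y \<in> V then f y else g' y)"
  proof (rule good_glue[OF fg(1) g' VW(1,2)])
    fix y assume y: "y \<in> V" "y \<in> W" "y \<notin> D"
    have "f y - g' y = f p - g' p"
    proof (rule good_unique[of J "V \<inter> W"])
      show "good J (V \<inter> W) f" by (rule good_subset[OF fg(1)]) auto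
      show "good J (V \<inter> W) g'" by (rule good_subset[OF g']) auto
    qed (use VW p y in \<open>auto simp: open_Int\<close>)
    then show "f y = g' y" by (simp add: g'_def)
  qed
  then show ?thesis using that by force
qed

section \<open>Functions with prescribed jumps on convex sets\<close>

text \<open>
  The neighbourhood is the convex tube of all points within \<open>e / 2\<close> of the segment, for a Lebesgue
  number \<open>e\<close> of a cover by sets that carry a solution. The segment is cut into steps shorter than \<open>e / 2\<close>;
  the part of the tube around one step lies in a single ball of radius \<open>e\<close>, and it meets the part around
  the previous steps in a convex set.
\<close>

lemma good_along_segment:
  fixes J :: "'a \<Rightarrow> 'b::real_vector"
  assumes W: "open W" "convex W" "W \<subseteq> C" and pq: "p \<in> W" "q \<in> W"
    and loc: "\<And>x. x \<in> W \<Longrightarrow> \<exists>U f. open U \<and> x \<in> U \<and> good J U f"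
  obtains T f where "open T" "convex T" "p \<in> T" "q \<in> T" "T \<subseteq> W" "good J T f"
proof -
  define K where "K = closed_segment p q"
  have K: "compact K" "K \<subseteq> W"
    unfolding K_def by (rule compact_segment, rule closed_segment_subset[OF pq W(2)])
  define \<G> where "\<G> = {U. open U \<and> U \<subseteq> W \<and> (\<exists>f. good J U f)}"
  have cover: "K \<subseteq> \<Union>\<G>"
  proof
    fix x assume "x \<in> K"
    then have x: "x \<in> W" using K by blast
    then obtain U f where U: "open U" "x \<in> U" "good J U f" using loc by metis
    have "good J (U \<inter> W) f" by (rule good_subset[OF U(3)]) blast
    then have "U \<inter> W \<in> \<G>" using U W(1) by (auto simp: \<G>_def)
    then show "x \<in> \<Union>\<G>" using x U by blast
  qed
  have "\<And>G. G \<in> \<G> \<Longrightarrow> open G" by (simp add: \<G>_def)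
  then obtain e where e: "e > 0" "\<And>x. x \<in> K \<Longrightarrow> \<exists>G\<in>\<G>. ball x e \<subseteq> G"
    using Heine_Borel_lemma[OF K(1) cover] by metis
  have gb: "ball x e \<subseteq> W \<and> (\<exists>f. good J (ball x e) f)" if x: "x \<in> K" for x
  proof -
    obtain U f where U: "ball x e \<subseteq> U" "U \<subseteq> W" "good J U f" using e(2)[OF x] by (auto simp: \<G>_def)
    have "good J (ball x e) f" by (rule good_subset[OF U(3)]) (use U in blast)
    then show ?thesis using U by blast
  qed
  obtain m :: nat where m: "m > 0" "norm (q - p) / real m < e / 2"
  proof -
    obtain m :: nat where m: "norm (q - p) < real m * (e / 2)"
      using reals_Archimedean3[of "e / 2"] e(1) by auto
    then have "m > 0" by (cases m) auto
    moreover have "norm (q - p) / real m < e / 2"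
      using m \<open>m > 0\<close> by (simp add: pos_divide_less_eq mult.commute)
    ultimately show ?thesis by (rule that)
  qed
  define pt where "pt k = p + (real k / real m) *\<^sub>R (q - p)" for k
  define Tb where "Tb A = (\<Union>z\<in>A. ball z (e / 2))" for A :: "'a set"
  have Tb_open: "open (Tb A)" for A unfolding Tb_def by auto
  have Tb_convex: "convex (Tb (closed_segment x y))" for x y
  proof -
    have "Tb (closed_segment x y) = (\<Union>u\<in>closed_segment x y. \<Union>v\<in>ball 0 (e / 2). {u + v})"
    proof (intro equalityI subsetI)
      fix z assume "z \<in> Tb (closed_segment x y)"
      then obtain u where "u \<in> closed_segment x y" "dist u z < e / 2" by (auto simp: Tb_def)
      then have "u \<in> closed_segment x y" "z - u \<in> ball 0 (e / 2)" "z = u + (z - u)"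
        by (auto simp: dist_norm norm_minus_commute)
      then show "z \<in> (\<Union>u\<in>closed_segment x y. \<Union>v\<in>ball 0 (e / 2). {u + v})" by blast
    next
      fix z assume "z \<in> (\<Union>u\<in>closed_segment x y. \<Union>v\<in>ball 0 (e / 2). {u + v})"
      then obtain u v where uv: "u \<in> closed_segment x y" "norm v < e / 2" "z = u + v" by auto
      then have "dist u z < e / 2" by (simp add: dist_norm)
      then show "z \<in> Tb (closed_segment x y)" using uv(1) by (auto simp: Tb_def)
    qed
    moreover have "convex (\<Union>u\<in>closed_segment x y. \<Union>v\<in>ball 0 (e / 2). {u + v})"
      by (intro convex_sums convex_closed_segment convex_ball)
    ultimately show ?thesis by simp
  qed
  have Tb_W: "Tb A \<subseteq> W" if "A \<subseteq> K" for A
  proof -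
    have "ball z (e / 2) \<subseteq> W" if "z \<in> A" for z
    proof -
      have "ball z (e / 2) \<subseteq> ball z e" using e(1) by (intro subset_ball) simp
      then show ?thesis using gb \<open>A \<subseteq> K\<close> that by blast
    qed
    then show ?thesis unfolding Tb_def by blast
  qed
  have Tb_I: "z \<in> Tb A" if "z \<in> A" for z A
    unfolding Tb_def using that e(1) by (intro UN_I[of z]) auto
  have ptK: "pt k \<in> K" if "k \<le> m" for k
  proof -
    have "pt k = (1 - real k / real m) *\<^sub>R p + (real k / real m) *\<^sub>R q"
      by (simp add: pt_def scaleR_left_diff_distrib scaleR_right_diff_distrib)
    moreover have "real k / real m \<le> 1" using that m(1) by simp
    ultimately show ?thesis unfolding K_def in_segment by (meson divide_nonneg_nonneg of_nat_0_le_iff)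
  qed
  have "\<exists>f. good J (Tb (closed_segment p (pt k))) f" if "k \<le> m" for k
    using that
  proof (induction k)
    case 0
    have "Tb (closed_segment p (pt 0)) = ball p (e / 2)" by (simp add: Tb_def pt_def)
    also have "\<dots> \<subseteq> ball p e" using e(1) by (intro subset_ball) simp
    finally have sub: "Tb (closed_segment p (pt 0)) \<subseteq> ball p e" .
    have "p \<in> K" by (simp add: K_def)
    then obtain f where "good J (ball p e) f" using gb by blast
    then have "good J (Tb (closed_segment p (pt 0))) f" by (rule good_subset) (use sub in blast)
    then show ?case by blast
  next
    case (Suc k)
    then obtain f where f: "good J (Tb (closed_segment p (pt k))) f" by (meson Suc_leD)
    have k: "pt k \<in> K" by (rule ptK) (use Suc.prems in simp)
    have near: "Tb (closed_segment (pt k) (pt (Suc k))) \<subseteq> ball (pt k) e"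
    proof
      fix z assume "z \<in> Tb (closed_segment (pt k) (pt (Suc k)))"
      then obtain u where u: "u \<in> closed_segment (pt k) (pt (Suc k))" "dist u z < e / 2"
        by (auto simp: Tb_def)
      have "dist (pt k) u \<le> dist (pt k) (pt (Suc k))"
        using dist_in_closed_segment[OF u(1)] by (simp add: dist_commute)
      also have "\<dots> = norm ((1 / real m) *\<^sub>R (q - p))"
      proof -
        have "pt (Suc k) - pt k = (1 / real m) *\<^sub>R (q - p)"
          by (simp add: pt_def add_divide_distrib scaleR_add_left)
        then show ?thesis by (metis dist_commute dist_norm)
      qed
      also have "\<dots> < e / 2" using m by simp
      finally show "z \<in> ball (pt k) e" using u(2) dist_triangle[of "pt k" z u] by simp
    qed
    obtain g where "good J (ball (pt k) e) g" using gb[OF k] by blast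
    then have g: "good J (Tb (closed_segment (pt k) (pt (Suc k)))) g"
      by (rule good_subset) (use near in blast)
    have "closed_segment p (pt k) \<subseteq> K"
      using k unfolding K_def by (simp add: subset_closed_segment)
    then have sub: "Tb (closed_segment p (pt k)) \<subseteq> C" using Tb_W W(3) by blast
    have "pt k \<in> closed_segment p (pt (Suc k))"
    proof -
      define u c where "u = real k / real (Suc k)" and "c = real (Suc k) / real m"
      have "pt (Suc k) = p + c *\<^sub>R (q - p)" by (simp only: pt_def c_def)
      moreover have "pt k = p + (u * c) *\<^sub>R (q - p)" by (simp add: pt_def u_def c_def)
      ultimately have "pt k = (1 - u) *\<^sub>R p + u *\<^sub>R pt (Suc k)"
        by (simp add: scaleR_left_diff_distrib scaleR_add_right)
      moreover have "0 \<le> u" "u \<le> 1" by (auto simp: u_def)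
      ultimately show ?thesis unfolding in_segment by blast
    qed
    then have un: "Tb (closed_segment p (pt (Suc k))) =
        Tb (closed_segment p (pt k)) \<union> Tb (closed_segment (pt k) (pt (Suc k)))"
      using Un_closed_segment[of "pt k" p "pt (Suc k)"] unfolding Tb_def by blast
    have conn: "connected (Tb (closed_segment p (pt k)) \<inter> Tb (closed_segment (pt k) (pt (Suc k))))"
      by (intro convex_connected convex_Int Tb_convex)
    show ?case unfolding un
      by (rule good_glue_connected[OF f g Tb_open Tb_open conn sub]) blast
  qed
  moreover have "closed_segment p (pt m) = K" using m(1) by (simp add: pt_def K_def)
  ultimately obtain f where f: "good J (Tb K) f" by (metis order_refl)
  have "p \<in> K" "q \<in> K" by (auto simp: K_def)
  then have "p \<in> Tb K" "q \<in> Tb K" by (auto intro: Tb_I)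
  moreover have "convex (Tb K)" using Tb_convex by (simp add: K_def)
  ultimately show ?thesis using that[OF Tb_open _ _ _ _ f] Tb_W[of K] by blast
qed

text \<open>
  Normalize the solutions along segments from a fixed point \<open>p\<close> to vanish at \<open>p\<close>. Two of them agree on
  the intersection of their domains, which is convex and contains \<open>p\<close>, so their values at the end
  points of the segments define one function that is a solution everywhere.
\<close>

lemma good_global:
  fixes J :: "'a \<Rightarrow> 'b::real_vector"
  assumes W: "open W" "convex W" "W \<subseteq> C"
    and loc: "\<And>x. x \<in> W \<Longrightarrow> \<exists>U f. open U \<and> x \<in> U \<and> good J U f"
  shows "\<exists>f. good J W f"
proof (cases "W = {}")
  case True then show ?thesis by (simp add: good_def)
next
  case False
  then obtain p where p: "p \<in> W - D" using complement_dense[of _ W] W by blast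
  define P where "P y T f \<longleftrightarrow> open T \<and> convex T \<and> p \<in> T \<and> y \<in> T \<and> T \<subseteq> W \<and> good J T f \<and> f p = 0"
    for y T and f :: "'a \<Rightarrow> 'b"
  have "\<forall>y\<in>W. \<exists>T f. P y T f"
  proof
    fix y assume y: "y \<in> W"
    obtain T f where T: "open T" "convex T" "p \<in> T" "y \<in> T" "T \<subseteq> W" "good J T f"
      using good_along_segment[OF W _ y loc] p by (metis DiffD1)
    have "good J T (\<lambda>z. f z + (- f p))" by (rule good_shift[OF T(6)])
    then show "\<exists>T f. P y T f"
      unfolding P_def using T by (intro exI[of _ T] exI[of _ "\<lambda>z. f z + (- f p)"]) auto
  qed
  then obtain T where "\<forall>y\<in>W. \<exists>f. P y (T y) f" using bchoice by meson
  then obtain F where TF: "\<forall>y\<in>W. P y (T y) (F y)" using bchoice by meson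
  then have T: "\<And>y. y \<in> W \<Longrightarrow> open (T y)" "\<And>y. y \<in> W \<Longrightarrow> convex (T y)"
      "\<And>y. y \<in> W \<Longrightarrow> p \<in> T y" "\<And>y. y \<in> W \<Longrightarrow> y \<in> T y" "\<And>y. y \<in> W \<Longrightarrow> T y \<subseteq> W"
      "\<And>y. y \<in> W \<Longrightarrow> good J (T y) (F y)" "\<And>y. y \<in> W \<Longrightarrow> F y p = 0"
    by (auto simp: P_def)
  have eq: "F z z = F y z" if "y \<in> W" "z \<in> T y - D" for y z
  proof -
    have z: "z \<in> W" using T that by blast
    have y: "y \<in> W" using that by blast
    have "F z z - F y z = F z p - F y p"
    proof (rule good_unique[of J "T y \<inter> T z"])
      show "connected (T y \<inter> T z)" by (intro convex_connected convex_Int T(2) y z)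
      show "open (T y \<inter> T z)" by (intro open_Int T(1) y z)
      show "T y \<inter> T z \<subseteq> C" using T(5)[OF y] W(3) by blast
      show "good J (T y \<inter> T z) (F z)" by (rule good_subset[OF T(6)[OF z]]) blast
      show "good J (T y \<inter> T z) (F y)" by (rule good_subset[OF T(6)[OF y]]) blast
      show "z \<in> T y \<inter> T z - D" using that T(4)[OF z] by blast
      show "p \<in> T y \<inter> T z - D" using p T(3)[OF y] T(3)[OF z] by blast
    qed
    then show ?thesis using T(7)[OF y] T(7)[OF z] by simp
  qed
  have "good J W (\<lambda>y. F y y)"
    unfolding good_def
  proof
    fix x assume x: "x \<in> W - B"
    have "good J (T x) (\<lambda>y. F y y)" by (rule good_cong[OF T(6) T(1)]) (use x eq in auto)
    then show "\<exists>U v. open U \<and> x \<in> U \<and>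
        (\<forall>y\<in>U - D. F y y = v + (if x \<in> D \<and> n x \<bullet> y > 0 then J x else 0))"
      using x T unfolding good_def by blast
  qed
  then show ?thesis by blast
qed

section \<open>Monodromy around a binding\<close>

text \<open>
  Here \<open>a\<close> and \<open>b\<close> define a binding in \<open>W\<close>, and \<open>f\<close> solves the jump problem on the complement of a slit that
  ends at the binding. Apart from the binding, the slit lies in the domain of \<open>g\<close>, which continues \<open>f\<close> across it from the side
  \<open>a \<bullet> y < 0\<close>, and \<open>m\<close> measures by how much this continuation misses \<open>f\<close> on the other side. Only existence of
  \<open>f\<close> and \<open>g\<close> is asked for, which makes additivity in \<open>J\<close> immediate.
\<close>

definition monodromy :: "('a \<Rightarrow> 'b::real_vector) \<Rightarrow> 'a \<Rightarrow> 'a \<Rightarrow> 'a set \<Rightarrow> 'b \<Rightarrow> bool" where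
  "monodromy J a b W m \<longleftrightarrow> (\<exists>f g. good J (W - slit a b) f \<and>
     good J (W \<inter> {z. b \<bullet> z < 0}) g \<and>
     (\<forall>y\<in>W - D. b \<bullet> y < 0 \<longrightarrow> (a \<bullet> y < 0 \<longrightarrow> g y = f y) \<and> (a \<bullet> y > 0 \<longrightarrow> g y = f y + m)))"

lemma monodromy_sum:
  fixes J :: "'i \<Rightarrow> 'a \<Rightarrow> 'b::real_vector"
  assumes "finite I" "\<And>i. i \<in> I \<Longrightarrow> monodromy (J i) a b W (m i)"
  shows "monodromy (\<lambda>x. \<Sum>i\<in>I. c i *\<^sub>R J i x) a b W (\<Sum>i\<in>I. c i *\<^sub>R m i)"
proof -
  define P where "P i f g \<longleftrightarrow> good (J i) (W - slit a b) f \<and>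
     good (J i) (W \<inter> {z. b \<bullet> z < 0}) g \<and>
     (\<forall>y\<in>W - D. b \<bullet> y < 0 \<longrightarrow> (a \<bullet> y < 0 \<longrightarrow> g y = f y) \<and> (a \<bullet> y > 0 \<longrightarrow> g y = f y + m i))"
    for i f g
  have "\<forall>i\<in>I. \<exists>f g. P i f g" using assms(2) unfolding monodromy_def P_def by simp
  then obtain f where "\<forall>i\<in>I. \<exists>g. P i (f i) g" using bchoice by meson
  then obtain g where "\<forall>i\<in>I. P i (f i) (g i)" using bchoice by meson
  then have fg: "\<And>i. i \<in> I \<Longrightarrow> good (J i) (W - slit a b) (f i)"
     "\<And>i. i \<in> I \<Longrightarrow> good (J i) (W \<inter> {z. b \<bullet> z < 0}) (g i)"
     "\<And>i. i \<in> I \<Longrightarrow> \<forall>y\<in>W - D. b \<bullet> y < 0 \<longrightarrow>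
        (a \<bullet> y < 0 \<longrightarrow> g i y = f i y) \<and> (a \<bullet> y > 0 \<longrightarrow> g i y = f i y + m i)"
    unfolding P_def by simp_all
  show ?thesis
    unfolding monodromy_def
  proof (intro exI conjI ballI impI)
    show "good (\<lambda>x. \<Sum>i\<in>I. c i *\<^sub>R J i x) (W - slit a b) (\<lambda>y. \<Sum>i\<in>I. c i *\<^sub>R f i y)"
      by (rule good_sum[OF assms(1) fg(1)])
    show "good (\<lambda>x. \<Sum>i\<in>I. c i *\<^sub>R J i x) (W \<inter> {z. b \<bullet> z < 0}) (\<lambda>y. \<Sum>i\<in>I. c i *\<^sub>R g i y)"
      by (rule good_sum[OF assms(1) fg(2)])
    fix y assume y: "y \<in> W - D" "b \<bullet> y < 0"
    show "(\<Sum>i\<in>I. c i *\<^sub>R g i y) = (\<Sum>i\<in>I. c i *\<^sub>R f i y)" if "a \<bullet> y < 0"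
      by (rule sum.cong) (use fg(3) y that in auto)
    show "(\<Sum>i\<in>I. c i *\<^sub>R g i y) = (\<Sum>i\<in>I. c i *\<^sub>R f i y) + (\<Sum>i\<in>I. c i *\<^sub>R m i)" if "a \<bullet> y > 0"
      unfolding sum.distrib[symmetric] scaleR_add_right[symmetric]
      by (rule sum.cong) (use fg(3) y that in auto)
  qed
qed

lemma open_slit_complement: "open W \<Longrightarrow> open (W - slit a b)"
  unfolding Collect_conj_eq by (intro open_Diff closed_Int closed_hyperplane closed_halfspace_le)

lemma complement_meets_lower_quadrants:
  assumes ab: "transverse_pair a b" and x: "a \<bullet> x = 0" "b \<bullet> x = 0" and e: "e > 0" "ball x e \<subseteq> C"
  obtains p q where "p \<in> ball x e - D" "b \<bullet> p < 0" "a \<bullet> p < 0"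
    "q \<in> ball x e - D" "b \<bullet> q < 0" "a \<bullet> q > 0"
proof -
  have quad: "\<exists>p\<in>ball x e - D. b \<bullet> p < 0 \<and> s * (a \<bullet> p) > 0" if s: "s \<in> {1, -1}" for s
  proof -
    obtain z where z: "z \<in> ball x e" "s * (a \<bullet> z) > 0" "b \<bullet> z < 0"
      using ball_meets_quadrants[OF ab x, of "ball x e" s "-1"] e s by auto
    have "open (ball x e \<inter> {z. b \<bullet> z < 0} \<inter> {z. (s *\<^sub>R a) \<bullet> z > 0})"
      by (intro open_Int open_ball open_halfspace_lt open_halfspace_gt)
    moreover have "z \<in> C" using z(1) e(2) by blast
    ultimately obtain y where "y \<in> ball x e \<inter> {z. b \<bullet> z < 0} \<inter> {z. (s *\<^sub>R a) \<bullet> z > 0} - D"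
      using complement_dense z by fastforce
    then show ?thesis by (intro bexI[of _ y]) auto
  qed
  show ?thesis using quad[of "-1"] quad[of 1] that by auto
qed

text \<open>
  The three half-balls off the slit and the one around it avoid the binding, so each carries a
  solution; consecutive ones meet in convex sets and can be adjusted to each other, one after
  the other, until the circle closes up to a constant.
\<close>

lemma monodromy_exists:
  fixes J :: "'a \<Rightarrow> 'b::real_vector"
  assumes J: "locally_const J" and ab: "transverse_pair a b" and e: "e > 0" "ball x e \<subseteq> C"
    and B: "\<And>z. z \<in> ball x e \<Longrightarrow> z \<in> B \<longleftrightarrow> a \<bullet> z = 0 \<and> b \<bullet> z = 0" and x: "x \<in> B"
  shows "\<exists>m. monodromy J a b (ball x e) m"
proof -
  let ?K = "\<lambda>m. ball x e \<inter> {z. m \<bullet> z > (0::real)}"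
  have abx: "a \<bullet> x = 0" "b \<bullet> x = 0" using B[of x] x e by auto
  have K: "convex (?K m)" "open (?K m)" "?K m \<subseteq> C" for m
    using e by (auto intro: convex_Int convex_halfspace_gt open_Int open_halfspace_gt)
  have ex: "\<exists>f. good J (?K m) f" if "m \<in> {a, -a, b, -b}" for m
  proof (rule good_global[OF K(2,1,3)])
    fix z assume z: "z \<in> ?K m"
    then have "z \<in> C - B" using B[of z] that e by auto
    then show "\<exists>U f. open U \<and> z \<in> U \<and> good J U f" by (rule good_exists_off_bindings[OF _ J])
  qed
  obtain f1 f2 f3 f4 where f: "good J (?K a) f1" "good J (?K b) f2" "good J (?K (-a)) f3" "good J (?K (-b)) f4"
    using ex[of a] ex[of b] ex[of "-a"] ex[of "-b"] by auto
  obtain f12 where f12: "good J (?K a \<union> ?K b) f12"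
    by (rule good_glue_connected[OF f(1,2) K(2) K(2) convex_connected[OF convex_Int[OF K(1) K(1)]] K(3)])
  have "(?K a \<union> ?K b) \<inter> ?K (-a) = ?K b \<inter> ?K (-a)" by auto
  then have conn: "connected ((?K a \<union> ?K b) \<inter> ?K (-a))"
    using convex_connected[OF convex_Int[OF K(1) K(1)]] by metis
  obtain f' where f': "good J ((?K a \<union> ?K b) \<union> ?K (-a)) f'"
    by (rule good_glue_connected[OF f12 f(3) _ K(2) conn]) (use K in auto)
  have eq: "(?K a \<union> ?K b) \<union> ?K (-a) = ball x e - slit a b" by auto
  have f'K: "good J (?K m) f'" if "m \<in> {a, b, -a}" for m
    using that by (intro good_subset[OF f']) auto
  obtain p q where p: "p \<in> (?K (-a) \<inter> ?K (-b)) - D" and q: "q \<in> (?K a \<inter> ?K (-b)) - D"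
  proof -
    obtain p q where "p \<in> ball x e - D" "b \<bullet> p < 0" "a \<bullet> p < 0"
      "q \<in> ball x e - D" "b \<bullet> q < 0" "a \<bullet> q > 0"
      by (rule complement_meets_lower_quadrants[OF ab abx e])
    then show ?thesis using that[of p q] by simp
  qed
  define g where "g y = f4 y + (f' p - f4 p)" for y
  have g: "good J (?K (-b)) g" unfolding g_def by (rule good_shift[OF f(4)])
  have u: "g y - f' y = g z - f' z" if "m \<in> {a, -a}" "y \<in> (?K m \<inter> ?K (-b)) - D" "z \<in> (?K m \<inter> ?K (-b)) - D" for m y z
  proof (rule good_unique[of J "?K m \<inter> ?K (-b)" g f'])
    show "good J (?K m \<inter> ?K (-b)) g" using g by (rule good_subset) auto
    show "good J (?K m \<inter> ?K (-b)) f'" by (rule good_subset[OF f'K[of m]]) (use that in auto)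
    show "connected (?K m \<inter> ?K (-b))" by (intro convex_connected convex_Int[OF K(1) K(1)])
    show "open (?K m \<inter> ?K (-b))" by (intro open_Int K(2))
    show "?K m \<inter> ?K (-b) \<subseteq> C" using K(3) by blast
  qed (use that in blast)+
  have "monodromy J a b (ball x e) (g q - f' q)"
    unfolding monodromy_def
  proof (rule exI[of _ f'], rule exI[of _ g], intro conjI ballI impI)
    show "good J (ball x e - slit a b) f'" using f' eq by simp
    show "good J (ball x e \<inter> {z. b \<bullet> z < 0}) g" using g by simp
    fix y assume y: "y \<in> ball x e - D" "b \<bullet> y < 0"
    show "g y = f' y" if "a \<bullet> y < 0"
    proof -
      have "g y - f' y = g p - f' p" by (rule u[of "-a"]) (use p y that in auto)
      then show ?thesis by (simp add: g_def)
    qed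
    show "g y = f' y + (g q - f' q)" if "a \<bullet> y > 0"
    proof -
      have "g y - f' y = g q - f' q" by (rule u[of a]) (use q y that in auto)
      then show ?thesis by (simp add: algebra_simps)
    qed
  qed
  then show ?thesis by blast
qed

text \<open>
  Going around the binding crosses only walls in the ball, so the total jump is a combination of their
  jumps.
\<close>

lemma monodromy_in_subspace:
  assumes m: "monodromy J a b (ball x e) m" and ab: "transverse_pair a b" and e: "e > 0" "ball x e \<subseteq> C"
    and B: "\<And>z. z \<in> ball x e \<Longrightarrow> z \<in> B \<longleftrightarrow> a \<bullet> z = 0 \<and> b \<bullet> z = 0" and x: "x \<in> B"
    and S: "subspace S" and J: "\<And>y. y \<in> ball x e \<Longrightarrow> y \<in> D - B \<Longrightarrow> J y \<in> S"
  shows "m \<in> S"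
proof -
  let ?W = "ball x e - slit a b" and ?V = "ball x e \<inter> {z. b \<bullet> z < 0}"
  have abx: "a \<bullet> x = 0" "b \<bullet> x = 0" using B[of x] x e by auto
  obtain f g where f: "good J ?W f" and g: "good J ?V g"
    and fg: "\<And>y. y \<in> ball x e - D \<Longrightarrow> b \<bullet> y < 0 \<Longrightarrow> a \<bullet> y < 0 \<Longrightarrow> g y = f y"
        "\<And>y. y \<in> ball x e - D \<Longrightarrow> b \<bullet> y < 0 \<Longrightarrow> a \<bullet> y > 0 \<Longrightarrow> g y = f y + m"
    using m unfolding monodromy_def by blast
  obtain p q where p: "p \<in> ball x e - D" "b \<bullet> p < 0" "a \<bullet> p < 0"
    and q: "q \<in> ball x e - D" "b \<bullet> q < 0" "a \<bullet> q > 0"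
    using complement_meets_lower_quadrants[OF ab abx e] by metis
  have "f q - f p \<in> S"
    by (rule good_constant_mod[OF f ball_minus_codim2_connected(2)[OF ab abx e(1)] open_slit_complement[OF open_ball] _ S])
      (use p q e J in auto)
  moreover have "g q - g p \<in> S"
    by (rule good_constant_mod[OF g _ _ _ S])
      (use p q e J in \<open>auto intro: convex_connected convex_Int convex_halfspace_lt open_Int open_halfspace_lt\<close>)
  ultimately have "(g q - g p) - (f q - f p) \<in> S" by (metis subspace_diff[OF S])
  then show ?thesis using fg(1)[OF p] fg(2)[OF q] by simp
qed

lemma good_of_trivial_monodromy:
  assumes "monodromy J a b (ball x e) 0"
    and B: "\<And>z. z \<in> ball x e \<Longrightarrow> z \<in> B \<longleftrightarrow> a \<bullet> z = 0 \<and> b \<bullet> z = 0"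
  shows "\<exists>f. good J (ball x e) f"
proof -
  let ?W = "ball x e - slit a b" and ?V = "ball x e \<inter> {z. b \<bullet> z < 0}"
  obtain f g where f: "good J ?W f" and g: "good J ?V g"
    and fg: "\<And>y. y \<in> ball x e - D \<Longrightarrow> b \<bullet> y < 0 \<Longrightarrow> a \<bullet> y \<noteq> 0 \<Longrightarrow> g y = f y"
  proof -
    obtain f g where "good J ?W f" "good J ?V g"
      and fg: "\<forall>y\<in>ball x e - D. b \<bullet> y < 0 \<longrightarrow> (a \<bullet> y < 0 \<longrightarrow> g y = f y) \<and> (a \<bullet> y > 0 \<longrightarrow> g y = f y + 0)"
      using assms(1) unfolding monodromy_def by blast
    moreover have "g y = f y" if "y \<in> ball x e - D" "b \<bullet> y < 0" "a \<bullet> y \<noteq> 0" for y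
      using fg that by (cases "a \<bullet> y < 0") auto
    ultimately show ?thesis using that by blast
  qed
  have "open ?V" by (intro open_Int open_ball open_halfspace_lt)
  then have "good J (?W \<union> ?V) (\<lambda>y. if y \<in> ?W then f y else g y)"
  proof (intro good_glue f g open_slit_complement open_ball)
    fix y assume "y \<in> ?W" "y \<in> ?V" "y \<notin> D"
    then show "f y = g y" using fg[of y] by auto
  qed
  moreover have "ball x e - B \<subseteq> ?W \<union> ?V" using B by force
  ultimately show ?thesis using good_subset[of J "?W \<union> ?V" _ "ball x e"] by blast
qed

text \<open>
  A solution on a small ball around one point of the binding forces the constant mismatch to vanish, and
  this mismatch is the same for the whole of the big ball.
\<close>

lemma monodromy_trivial:
  assumes m: "monodromy J a b (ball x e) m" and ab: "transverse_pair a b" and e: "ball x e \<subseteq> C"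
    and x': "x' \<in> ball x e" "a \<bullet> x' = 0" "b \<bullet> x' = 0" and U: "open U" "x' \<in> U" "good J U h"
  shows "m = 0"
proof -
  let ?W = "ball x e - slit a b" and ?V = "ball x e \<inter> {z. b \<bullet> z < 0}"
  obtain r where r: "r > 0" "ball x' r \<subseteq> U \<inter> ball x e"
    using U x' open_contains_ball[of "U \<inter> ball x e"] by (meson IntI open_Int open_ball)
  obtain f g where f: "good J ?W f" and g: "good J ?V g"
    and fg: "\<And>y. y \<in> ball x e - D \<Longrightarrow> b \<bullet> y < 0 \<Longrightarrow> a \<bullet> y < 0 \<Longrightarrow> g y = f y"
        "\<And>y. y \<in> ball x e - D \<Longrightarrow> b \<bullet> y < 0 \<Longrightarrow> a \<bullet> y > 0 \<Longrightarrow> g y = f y + m"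
    using m unfolding monodromy_def by blast
  have "ball x' r \<subseteq> C" using r e by blast
  then obtain p q where p: "p \<in> ball x' r - D" "b \<bullet> p < 0" "a \<bullet> p < 0"
    and q: "q \<in> ball x' r - D" "b \<bullet> q < 0" "a \<bullet> q > 0"
    using complement_meets_lower_quadrants[OF ab x'(2,3) r(1)] by metis
  have "f q - h q = f p - h p"
  proof (rule good_unique[of J "ball x' r - slit a b"])
    show "connected (ball x' r - slit a b)"
      by (rule ball_minus_codim2_connected[OF ab x'(2,3) r(1)])
    show "open (ball x' r - slit a b)" by (rule open_slit_complement[OF open_ball])
    show "good J (ball x' r - slit a b) f" by (rule good_subset[OF f]) (use r in auto)
    show "good J (ball x' r - slit a b) h" by (rule good_subset[OF U(3)]) (use r in auto)
  qed (use p q e r in auto)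
  moreover have "g q - h q = g p - h p"
  proof (rule good_unique[of J "ball x' r \<inter> {z. b \<bullet> z < 0}"])
    show "connected (ball x' r \<inter> {z. b \<bullet> z < 0})"
      by (intro convex_connected convex_Int convex_ball convex_halfspace_lt)
    show "open (ball x' r \<inter> {z. b \<bullet> z < 0})" by (intro open_Int open_ball open_halfspace_lt)
    show "good J (ball x' r \<inter> {z. b \<bullet> z < 0}) g" by (rule good_subset[OF g]) (use r in auto)
    show "good J (ball x' r \<inter> {z. b \<bullet> z < 0}) h" by (rule good_subset[OF U(3)]) (use r in auto)
  qed (use p q e r in auto)
  moreover have "g p = f p" "g q = f q + m" using fg p q r by blast+
  ultimately show ?thesis by (simp add: algebra_simps)
qed

text \<open>
  The obstruction at \<open>x\<close> for a combination of the jump functions \<open>J i\<close> is the same combination of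
  elements \<open>m i\<close> of \<open>S\<close>, where \<open>S\<close> has to contain only the jumps at walls with normal in the plane
  spanned by \<open>a\<close> and \<open>b\<close>.
\<close>

lemma binding_obstruction:
  fixes J :: "'i \<Rightarrow> 'a \<Rightarrow> 'b::real_vector"
  assumes x: "x \<in> B"
  obtains a b where "transverse_pair a b"
    "\<And>S J I. \<lbrakk>subspace S; finite I; \<And>i. i \<in> I \<Longrightarrow> locally_const (J i);
       \<And>i y. i \<in> I \<Longrightarrow> y \<in> D - B \<Longrightarrow> n y \<in> span {a, b} \<Longrightarrow> J i y \<in> S\<rbrakk> \<Longrightarrow>
      \<exists>m. (\<forall>i\<in>I. m i \<in> S) \<and> (\<forall>c. (\<Sum>i\<in>I. c i *\<^sub>R m i) = 0 \<longrightarrow>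
        (\<exists>U f. open U \<and> x \<in> U \<and> good (\<lambda>y. \<Sum>i\<in>(I::'i set). c i *\<^sub>R (J i y :: 'b)) U f))"
proof -
  obtain a b e where ab: "transverse_pair a b" and e: "e > 0" "ball x e \<subseteq> C"
    and B: "\<And>y. y \<in> ball x e \<Longrightarrow> y \<in> B \<longleftrightarrow> a \<bullet> y = 0 \<and> b \<bullet> y = 0"
    and N: "\<And>y. y \<in> ball x e \<Longrightarrow> y \<in> D - B \<Longrightarrow> n y \<in> span {a, b}"
    using binding_normals[OF x] by metis
  show ?thesis
  proof (rule that[OF ab])
    fix S :: "'b set" and J :: "'i \<Rightarrow> 'a \<Rightarrow> 'b" and I :: "'i set"
    assume S: "subspace S" and I: "finite I" and lc: "\<And>i. i \<in> I \<Longrightarrow> locally_const (J i)"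
      and JS: "\<And>i y. i \<in> I \<Longrightarrow> y \<in> D - B \<Longrightarrow> n y \<in> span {a, b} \<Longrightarrow> J i y \<in> S"
    obtain m where m: "\<And>i. i \<in> I \<Longrightarrow> monodromy (J i) a b (ball x e) (m i)"
      using monodromy_exists[OF lc ab e B x] by metis
    have "m i \<in> S" if "i \<in> I" for i
      by (rule monodromy_in_subspace[OF m[OF that] ab e B x S]) (use JS N that in auto)
    moreover have "\<exists>U f. open U \<and> x \<in> U \<and> good (\<lambda>y. \<Sum>i\<in>I. c i *\<^sub>R J i y) U f"
      if "(\<Sum>i\<in>I. c i *\<^sub>R m i) = 0" for c
    proof -
      have "monodromy (\<lambda>y. \<Sum>i\<in>I. c i *\<^sub>R J i y) a b (ball x e) 0"
        using monodromy_sum[OF I m, of "\<lambda>i. i" c] that by simp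
      then obtain f where "good (\<lambda>y. \<Sum>i\<in>I. c i *\<^sub>R J i y) (ball x e) f"
        using good_of_trivial_monodromy[OF _ B] by blast
      then show ?thesis using e by (intro exI[of _ "ball x e"] exI[of _ f]) auto
    qed
    ultimately show "\<exists>m. (\<forall>i\<in>I. m i \<in> S) \<and> (\<forall>c. (\<Sum>i\<in>I. c i *\<^sub>R m i) = 0 \<longrightarrow>
        (\<exists>U f. open U \<and> x \<in> U \<and> good (\<lambda>y. \<Sum>i\<in>I. c i *\<^sub>R J i y) U f))" by blast
  qed
qed

lemma good_locus_closed:
  fixes J :: "'a \<Rightarrow> 'b::real_vector"
  assumes J: "locally_const J" and x: "x \<in> B"
    and cl: "x \<in> closure {y \<in> B. \<exists>U f. open U \<and> y \<in> U \<and> good J U f}"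
  shows "\<exists>U f. open U \<and> x \<in> U \<and> good J U f"
proof -
  obtain a b e where ab: "transverse_pair a b" and e: "e > 0" "ball x e \<subseteq> C"
    and B: "\<And>y. y \<in> ball x e \<Longrightarrow> y \<in> B \<longleftrightarrow> a \<bullet> y = 0 \<and> b \<bullet> y = 0"
    using binding_normals[OF x] by metis
  obtain m where m: "monodromy J a b (ball x e) m" using monodromy_exists[OF J ab e B x] by blast
  obtain y where "y \<in> {y \<in> B. \<exists>U f. open U \<and> y \<in> U \<and> good J U f}" "dist y x < e"
    using cl e unfolding closure_approachable by blast
  then obtain U h where y: "y \<in> B" "y \<in> ball x e" "open U" "y \<in> U" "good J U h"
    by (auto simp: dist_commute)
  have "m = 0" by (rule monodromy_trivial[OF m ab e(2) y(2) _ _ y(3-5)]) (use B y in auto)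
  then show ?thesis using good_of_trivial_monodromy[OF _ B] m e by (metis centre_in_ball open_ball)
qed

definition locally_good :: "('a \<Rightarrow> 'b::real_vector) \<Rightarrow> 'a \<Rightarrow> bool" where
  "locally_good J x \<longleftrightarrow> (\<exists>U f. open U \<and> x \<in> U \<and> good J U f)"

text \<open>
  The symmetries of a wall system act on solutions. This is applied to the elements of \<open>\<Gamma>\<close> and to
  dilations.
\<close>

lemma good_transport:
  fixes L :: "'b::real_vector \<Rightarrow> 'b"
  assumes f: "good J W f" and T': "continuous_on UNIV T'" and inv: "\<And>y. T (T' y) = y"
    and D: "\<And>x. T x \<in> D \<longleftrightarrow> x \<in> D" and B: "\<And>x. T x \<in> B \<longleftrightarrow> x \<in> B" and L: "linear L"
    and side: "\<And>x y. x \<in> D - B \<Longrightarrow> n (T x) \<bullet> y > 0 \<longleftrightarrow> n x \<bullet> T' y > 0"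
    and jump: "\<And>x. x \<in> D - B \<Longrightarrow> J (T x) = L (J x)"
  shows "good J (T' -` W) (\<lambda>y. L (f (T' y)))"
  unfolding good_def
proof
  fix z assume z: "z \<in> T' -` W - B"
  define x where "x = T' z"
  have Tx: "T x = z" by (simp add: x_def inv)
  have xB: "x \<notin> B" using z B[of x] Tx by simp
  have xW: "x \<in> W - B" using z xB by (simp add: x_def)
  obtain U v where U: "open U" "x \<in> U"
      "\<forall>y\<in>U - D. f y = v + (if x \<in> D \<and> n x \<bullet> y > 0 then J x else 0)"
    using f xW unfolding good_def by meson
  have "L (f (T' y)) = L v + (if z \<in> D \<and> n z \<bullet> y > 0 then J z else 0)" if y: "y \<in> T' -` U - D" for y
  proof -
    have "T' y \<in> U - D" using y D[of "T' y"] inv by simp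
    then have fy: "f (T' y) = v + (if x \<in> D \<and> n x \<bullet> T' y > 0 then J x else 0)" using U(3) by blast
    show ?thesis
    proof (cases "x \<in> D")
      case True
      then have xDB: "x \<in> D - B" using xB by blast
      have "z \<in> D" using True D[of x] Tx by simp
      moreover have "n z \<bullet> y > 0 \<longleftrightarrow> n x \<bullet> T' y > 0" using side[OF xDB, of y] by (simp add: Tx)
      moreover have "J z = L (J x)" using jump[OF xDB] by (simp add: Tx)
      ultimately show ?thesis using True by (simp add: fy linear_add[OF L] linear_0[OF L])
    next
      case False
      then have "z \<notin> D" using D[of x] Tx by simp
      then show ?thesis using False by (simp add: fy)
    qed
  qed
  moreover have "open (T' -` U)" using T' U(1) by (simp add: continuous_on_open_vimage)
  ultimately show "\<exists>U v. open U \<and> z \<in> U \<and>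
      (\<forall>y\<in>U - D. L (f (T' y)) = v + (if z \<in> D \<and> n z \<bullet> y > 0 then J z else 0))"
    using U(2) by (intro exI[of _ "T' -` U"] exI[of _ "L v"]) (simp add: x_def)
qed

lemma good_constant_off_walls:
  assumes f: "good J C f" and L: "connected L" "L \<subseteq> C - D" "x \<in> L" "y \<in> L"
  shows "f x = f y"
proof -
  have "f constant_on L"
  proof (rule locally_constant_imp_constant[OF L(1)])
    fix a assume a: "a \<in> L"
    then have aD: "a \<in> C - B" "a \<notin> D" using L(2) BD by auto
    then obtain U v where U: "open U" "a \<in> U"
        "\<forall>y\<in>U - D. f y = v + (if a \<in> D \<and> n a \<bullet> y > 0 then J a else 0)"
      using f unfolding good_def by meson
    have "f y = v" if "y \<in> L \<inter> U" for y
    proof -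
      have "y \<in> U - D" using that L(2) by blast
      then show ?thesis using U(3) aD(2) by simp
    qed
    then have "\<forall>y\<in>L \<inter> U. f y = f a" using a U(2) by blast
    then show "\<exists>T. openin (top_of_set L) T \<and> a \<in> T \<and> (\<forall>x\<in>T. f x = f a)"
      using openin_open_Int[OF U(1), of L] U(2) a by blast
  qed
  then obtain k where "\<And>z. z \<in> L \<Longrightarrow> f z = k" unfolding constant_on_def by blast
  then show ?thesis using L by simp
qed

lemma good_constant_jump_zero:
  assumes f: "good J C f" and const: "\<And>y. y \<in> C - D \<Longrightarrow> f y = k" and x: "x \<in> D - B"
  shows "J x = 0"
proof -
  have "x \<in> C - B" using x DC by blast
  then obtain U v where U: "open U" "x \<in> U"
      "\<And>y. y \<in> U - D \<Longrightarrow> f y = v + (if x \<in> D \<and> n x \<bullet> y > 0 then J x else 0)"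
    using f unfolding good_def by meson
  obtain V where V: "open V" "x \<in> V" "V \<subseteq> C - B" "\<And>y. y \<in> V \<Longrightarrow> (y \<in> D \<longleftrightarrow> n x \<bullet> y = 0)"
    using wall[OF x] by blast
  obtain t where t: "t > 0" "x + t *\<^sub>R n x \<in> U \<inter> V" "x - t *\<^sub>R n x \<in> U \<inter> V"
    by (rule open_contains_ray[of "U \<inter> V" x "n x"]) (use U V in auto)
  have pos: "n x \<bullet> n x > 0" using n_nonzero[OF x] by simp
  have p: "n x \<bullet> (x + t *\<^sub>R n x) > 0" "n x \<bullet> (x - t *\<^sub>R n x) < 0"
    using wall_normal_orthogonal[OF x] t(1) pos by (simp_all add: inner_add_right inner_diff_right)
  have "x + t *\<^sub>R n x \<in> U - D" "x + t *\<^sub>R n x \<in> C" using t(2) V p(1) by auto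
  then have 1: "v + J x = k" using const U(3) p(1) x by fastforce
  have "x - t *\<^sub>R n x \<in> U - D" "x - t *\<^sub>R n x \<in> C" using t(3) V p(2) by auto
  then have 2: "v = k" using const U(3) p(2) by fastforce
  show ?thesis using 1 2 by simp
qed

end

section \<open>Counting solutions of linear equations\<close>

text \<open>
  Gaussian elimination, one equation at a time: if some solution \<open>c p\<close> violates the new equation, it
  is used to correct the others and \<open>p\<close> is dropped from the set \<open>F\<close> of free variables. The duality
  between \<open>F\<close> and the family of solutions makes the family linearly independent.
\<close>

lemma free_solutions:
  fixes A :: "'e \<Rightarrow> 'w \<Rightarrow> real"
  assumes "finite E" and W: "finite W"
  shows "\<exists>F c. F \<subseteq> W \<and> card W \<le> card F + card E \<and>
     (\<forall>j\<in>F. \<forall>e\<in>E. (\<Sum>w\<in>W. c j w * A e w) = 0) \<and>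
     (\<forall>j\<in>F. \<forall>i\<in>F. c j i = (if i = j then 1 else 0))"
  using assms(1)
proof (induction E)
  case empty
  show ?case by (rule exI[of _ W], rule exI[of _ "\<lambda>j i. if i = j then 1 else 0"]) auto
next
  case (insert e E)
  then obtain F c where F: "F \<subseteq> W" "card W \<le> card F + card E"
    and sol: "\<And>j e. j \<in> F \<Longrightarrow> e \<in> E \<Longrightarrow> (\<Sum>w\<in>W. c j w * A e w) = 0"
    and dual: "\<And>j i. j \<in> F \<Longrightarrow> i \<in> F \<Longrightarrow> c j i = (if i = j then 1 else 0)"
    by blast
  have finF: "finite F" using F W finite_subset by blast
  define t where "t j = (\<Sum>w\<in>W. c j w * A e w)" for j
  show ?case
  proof (cases "\<forall>j\<in>F. t j = 0")
    case True
    then show ?thesis using F sol dual insert.hyps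
      by (intro exI[of _ F] exI[of _ c]) (auto simp: t_def)
  next
    case False
    then obtain p where p: "p \<in> F" "t p \<noteq> 0" by blast
    define c' where "c' j w = c j w - (t j / t p) * c p w" for j w
    have lin: "(\<Sum>w\<in>W. c' j w * A e' w) =
        (\<Sum>w\<in>W. c j w * A e' w) - (t j / t p) * (\<Sum>w\<in>W. c p w * A e' w)" for j e'
      by (simp add: c'_def left_diff_distrib sum_subtractf sum_distrib_left mult.assoc)
    have "(\<Sum>w\<in>W. c' j w * A e' w) = 0" if "j \<in> F - {p}" "e' \<in> insert e E" for j e'
    proof (cases "e' = e")
      case True
      have "(\<Sum>w\<in>W. c' j w * A e w) = t j - (t j / t p) * t p" unfolding lin t_def ..
      then show ?thesis using True p by simp
    next
      case False
      then show ?thesis unfolding lin using sol that p by simp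
    qed
    moreover have "c' j i = (if i = j then 1 else 0)" if "j \<in> F - {p}" "i \<in> F - {p}" for j i
      using that dual p by (auto simp: c'_def)
    moreover have "card W \<le> card (F - {p}) + card (insert e E)"
    proof -
      have "card F = Suc (card (F - {p}))" using finF p(1) by (metis card.remove)
      then show ?thesis using F(2) insert.hyps by simp
    qed
    moreover have "F - {p} \<subseteq> W" using F by blast
    ultimately show ?thesis by blast
  qed
qed

section \<open>The future cone\<close>

definition spatial :: "'n::finite mink \<Rightarrow> real ^ 'n" where
  "spatial x = (\<chi> i. x $ Some i)"

definition future_cone :: "'n::finite mink set" where
  "future_cone = {x. norm (spatial x) < x $ None}"

text \<open>
  The hyperboloid meets every ray of the future cone once, here.
\<close>

definition to_hyp :: "'n::finite mink \<Rightarrow> 'n mink" where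
  "to_hyp x = (1 / sqrt (- lorentz x x)) *\<^sub>R x"

lemma sum_UNIV_option: "(\<Sum>k\<in>UNIV. f k) = f None + (\<Sum>i\<in>UNIV. f (Some i))"
  for f :: "'n::finite option \<Rightarrow> 'b::comm_monoid_add"
proof -
  have "(\<Sum>k\<in>UNIV. f k) = (\<Sum>k\<in>insert None (range Some). f k)" by (simp add: UNIV_option_conv)
  also have "\<dots> = f None + (\<Sum>k\<in>range Some. f k)" by (subst sum.insert) auto
  finally show ?thesis by (simp add: sum.reindex)
qed

lemma gram_mult_vec: "(gram *v x) $ k = (if k = None then - 1 else 1) * x $ k"
  unfolding gram_def matrix_vector_mult_def
  by (simp add: if_distrib[of "\<lambda>t. t * _"] sum.delta cong: if_cong)

lemma lorentz_spatial: "lorentz x y = spatial x \<bullet> spatial y - x $ None * y $ None"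
  by (simp add: lorentz_def inner_vec_def sum_UNIV_option gram_mult_vec spatial_def)

lemma spatial_add: "spatial (x + y) = spatial x + spatial y"
  and spatial_scaleR: "spatial (c *\<^sub>R x) = c *\<^sub>R spatial x"
  by (simp_all add: spatial_def vec_eq_iff)

lemma lorentz_commute: "lorentz x y = lorentz y x"
  by (simp add: lorentz_spatial inner_commute)

lemma lorentz_add_right: "lorentz x (y + z) = lorentz x y + lorentz x z"
  and lorentz_add_left: "lorentz (y + z) x = lorentz y x + lorentz z x"
  and lorentz_scaleR_right: "lorentz x (c *\<^sub>R y) = c * lorentz x y"
  and lorentz_scaleR_left: "lorentz (c *\<^sub>R x) y = c * lorentz x y"
  by (simp_all add: lorentz_spatial spatial_add spatial_scaleR inner_add_right inner_add_left algebra_simps)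

lemma future_cone_iff: "x \<in> future_cone \<longleftrightarrow> lorentz x x < 0 \<and> x $ None > 0"
proof -
  have "lorentz x x < 0 \<longleftrightarrow> (norm (spatial x))\<^sup>2 < (x $ None)\<^sup>2"
    by (simp add: lorentz_spatial dot_square_norm power2_eq_square[of "x $ None"])
  moreover have "(norm (spatial x))\<^sup>2 < (x $ None)\<^sup>2 \<longleftrightarrow> norm (spatial x) < x $ None" if "x $ None > 0"
    using that by (meson less_imp_le norm_ge_zero pos2 power2_less_imp_less power_strict_mono)
  moreover have "x $ None > 0" if "norm (spatial x) < x $ None"
    using that norm_ge_zero[of "spatial x"] by linarith
  ultimately show ?thesis by (auto simp: future_cone_def)
qed

lemma hyp_subset_future_cone: "hyp \<subseteq> future_cone"
  by (auto simp: hyp_def future_cone_iff)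

lemma continuous_on_spatial: "continuous_on S spatial"
  unfolding spatial_def by (intro continuous_intros)

lemma open_future_cone: "open future_cone"
  unfolding future_cone_def
  by (intro open_Collect_less continuous_intros continuous_on_spatial)

lemma future_cone_add: "x \<in> future_cone \<Longrightarrow> y \<in> future_cone \<Longrightarrow> x + y \<in> future_cone"
  unfolding future_cone_def mem_Collect_eq spatial_add vector_add_component
  using norm_triangle_ineq[of "spatial x" "spatial y"] by linarith

lemma future_cone_scaleR: "x \<in> future_cone \<Longrightarrow> c > 0 \<Longrightarrow> c *\<^sub>R x \<in> future_cone"
  unfolding future_cone_def by (simp add: spatial_scaleR)

lemma convex_future_cone: "convex (future_cone :: 'n::finite mink set)"
proof (rule convexI)
  fix x y :: "'n mink" and u v :: real
  assume xy: "x \<in> future_cone" "y \<in> future_cone" and uv: "0 \<le> u" "0 \<le> v" "u + v = 1"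
  consider "u = 0" | "v = 0" | "u > 0" "v > 0" using uv by linarith
  then show "u *\<^sub>R x + v *\<^sub>R y \<in> future_cone"
  proof cases
    case 3
    then show ?thesis using xy by (intro future_cone_add future_cone_scaleR)
  qed (use xy uv in auto)
qed

lemma to_hyp_scale:
  assumes "x \<in> future_cone"
  obtains s where "s > 0" "to_hyp x = s *\<^sub>R x" "x = (1 / s) *\<^sub>R to_hyp x"
  using assms that[of "1 / sqrt (- lorentz x x)"] by (auto simp: to_hyp_def future_cone_iff)

lemma to_hyp_in_hyp: "x \<in> future_cone \<Longrightarrow> to_hyp x \<in> hyp"
proof -
  assume x: "x \<in> future_cone"
  then have l: "lorentz x x < 0" "x $ None > 0" by (auto simp: future_cone_iff)
  have "lorentz (to_hyp x) (to_hyp x) = (1 / sqrt (- lorentz x x))\<^sup>2 * lorentz x x"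
    by (simp add: to_hyp_def lorentz_scaleR_left lorentz_scaleR_right power2_eq_square)
  also have "\<dots> = - 1" using l by (simp add: power_divide)
  finally show "to_hyp x \<in> hyp" using l by (simp add: hyp_def to_hyp_def)
qed

lemma to_hyp_hyp: "x \<in> hyp \<Longrightarrow> to_hyp x = x"
  by (simp add: hyp_def to_hyp_def)

lemma to_hyp_scaleR: "c > 0 \<Longrightarrow> to_hyp (c *\<^sub>R x) = to_hyp x"
proof -
  assume c: "c > 0"
  have "lorentz (c *\<^sub>R x) (c *\<^sub>R x) = c\<^sup>2 * lorentz x x"
    by (simp add: lorentz_scaleR_left lorentz_scaleR_right power2_eq_square)
  then have "sqrt (- lorentz (c *\<^sub>R x) (c *\<^sub>R x)) = c * sqrt (- lorentz x x)"
    using c by (metis mult_minus_right real_sqrt_abs real_sqrt_mult abs_of_pos)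
  then show ?thesis using c by (simp add: to_hyp_def)
qed

lemma continuous_on_to_hyp: "continuous_on future_cone to_hyp"
proof -
  have "continuous_on future_cone (\<lambda>x::'a mink. lorentz x x)"
    unfolding lorentz_spatial by (intro continuous_intros continuous_on_spatial)
  then show ?thesis
    unfolding to_hyp_def
    by (intro continuous_intros) (auto simp: future_cone_iff)
qed

lemma to_hyp_neighbourhood:
  assumes "x \<in> future_cone" "open U" "to_hyp x \<in> U"
  obtains V where "open V" "x \<in> V" "V \<subseteq> future_cone" "\<And>y. y \<in> V \<Longrightarrow> to_hyp y \<in> U"
proof -
  have "open (future_cone \<inter> to_hyp -` U)"
    by (rule continuous_open_preimage[OF continuous_on_to_hyp open_future_cone assms(2)])
  then show ?thesis using that[of "future_cone \<inter> to_hyp -` U"] assms by auto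
qed

section \<open>The group of isometries\<close>

lemma gram_gram: "gram ** gram = mat 1"
  unfolding matrix_eq matrix_vector_mul_assoc[symmetric]
  by (simp add: vec_eq_iff gram_mult_vec)

lemma SO_plusD:
  assumes "A \<in> carrier SO_plus"
  shows "transpose A ** gram ** A = gram" "det A = 1" "A $ None $ None > 0"
  using assms by (auto simp: SO_plus_def)

lemma lorentz_isometry:
  assumes "A \<in> carrier SO_plus"
  shows "lorentz (A *v x) (A *v y) = lorentz x y"
proof -
  have "lorentz (A *v x) (A *v y) = x \<bullet> (transpose A *v (gram *v (A *v y)))"
    unfolding lorentz_def by (metis dot_lmul_matrix vector_transpose_matrix inner_commute)
  also have "\<dots> = x \<bullet> ((transpose A ** gram ** A) *v y)" by (simp add: matrix_vector_mul_assoc matrix_mul_assoc)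
  finally show ?thesis using SO_plusD[OF assms] by (simp add: lorentz_def)
qed

lemma time_axis_in_future_cone: "axis None 1 \<in> (future_cone :: 'n::finite mink set)"
proof -
  have "spatial (axis None 1 :: 'n mink) = 0" by (simp add: spatial_def axis_def vec_eq_iff)
  then show "(axis None 1 :: 'n mink) \<in> future_cone" by (simp add: future_cone_def)
qed

lemma time_axis_image: "(A *v axis None 1) $ k = A $ k $ None"
  for A :: "'n::finite mink_mat"
  by (simp add: matrix_vector_mult_basis column_def)

text \<open>
  If \<open>A x\<close> were in the past cone, then a positive combination of \<open>x\<close> and the time axis would be a
  time-like vector that \<open>A\<close> maps to one with vanishing time coordinate, which is impossible.
\<close>

lemma preserves_future_cone:
  fixes A :: "'n::finite mink_mat"
  assumes A: "\<And>x. lorentz (A *v x) (A *v x) = lorentz x x" and A0: "A $ None $ None > 0"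
    and x: "x \<in> future_cone"
  shows "A *v x \<in> future_cone"
proof (rule ccontr)
  assume not: "A *v x \<notin> future_cone"
  then have neg: "(A *v x) $ None \<le> 0" using x A by (auto simp: future_cone_iff)
  have nonzero: "(A *v z) $ None \<noteq> 0" if "z \<in> future_cone" for z
  proof
    assume "(A *v z) $ None = 0"
    then have "lorentz (A *v z) (A *v z) \<ge> 0" by (simp add: lorentz_spatial)
    then show False using that A by (simp add: future_cone_iff)
  qed
  define z where "z = (A $ None $ None) *\<^sub>R x + (- (A *v x) $ None) *\<^sub>R axis None 1"
  have "(A *v x) $ None < 0" using neg nonzero[OF x] by simp
  then have "z \<in> future_cone"
    unfolding z_def using A0 x by (intro future_cone_add future_cone_scaleR time_axis_in_future_cone) auto
  moreover have "(A *v z) $ None = 0"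
    by (simp add: z_def matrix_vector_mult_diff_distrib matrix_vector_mult_scaleR time_axis_image)
  ultimately show False using nonzero by blast
qed

lemma SO_plus_future_cone: "A \<in> carrier SO_plus \<Longrightarrow> x \<in> future_cone \<Longrightarrow> A *v x \<in> future_cone"
  by (rule preserves_future_cone) (auto simp: lorentz_isometry SO_plusD)

lemma SO_plus_to_hyp: "A \<in> carrier SO_plus \<Longrightarrow> to_hyp (A *v x) = A *v to_hyp x"
  by (simp add: to_hyp_def lorentz_isometry matrix_vector_mult_scaleR)

lemma det_square_one:
  fixes A :: "'a::finite mink_mat"
  assumes "transpose A ** gram ** A = gram"
  shows "det A * det A = 1"
proof -
  have "det (gram :: 'a mink_mat) * det (gram :: 'a mink_mat) = 1"
    by (metis det_I det_mul gram_gram)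
  then have "det (gram :: 'a mink_mat) \<noteq> 0" by auto
  moreover have "det A * det (gram :: 'a mink_mat) * det A = det (gram :: 'a mink_mat)"
    using arg_cong[OF assms, of det] by (simp add: det_mul)
  ultimately show ?thesis by (simp add: mult.commute mult.left_commute)
qed

lemma SO_plus_inverse:
  assumes A: "A \<in> carrier SO_plus"
  defines "A' \<equiv> gram ** transpose A ** gram"
  shows "A' ** A = mat 1" "A ** A' = mat 1" "A' \<in> carrier SO_plus"
proof -
  note D = SO_plusD[OF A]
  show 1: "A' ** A = mat 1"
    unfolding A'_def using D(1) by (metis gram_gram matrix_mul_assoc)
  then show 2: "A ** A' = mat 1" by (simp add: matrix_left_right_inverse)
  have 3: "transpose A' ** gram ** A' = gram"
  proof -
    have "transpose A' ** (transpose A ** gram ** A) ** A' = transpose A' ** gram ** A'" using D(1) by simp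
    moreover have "transpose A' ** (transpose A ** gram ** A) ** A' = transpose (A ** A') ** gram ** (A ** A')"
      by (simp add: matrix_transpose_mul matrix_mul_assoc)
    ultimately show ?thesis using 2 by (simp add: transpose_mat)
  qed
  have "A' $ None $ None = A $ None $ None"
    unfolding A'_def time_axis_image[symmetric] matrix_vector_mul_assoc[symmetric] gram_mult_vec
    by (simp add: matrix_vector_mult_def sum_UNIV_option gram_def axis_def transpose_def)
  moreover have "det A' = 1"
    using 1 D(2) by (metis det_I det_mul mult.right_neutral)
  ultimately show "A' \<in> carrier SO_plus" using 3 D(3) by (simp add: SO_plus_def)
qed

lemma SO_plus_mult: "A \<in> carrier SO_plus \<Longrightarrow> B \<in> carrier SO_plus \<Longrightarrow> A ** B \<in> carrier SO_plus"
proof -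
  assume A: "A \<in> carrier SO_plus" and B: "B \<in> carrier SO_plus"
  have "transpose (A ** B) ** gram ** (A ** B) = transpose B ** (transpose A ** gram ** A) ** B"
    by (simp add: matrix_transpose_mul matrix_mul_assoc)
  then have "transpose (A ** B) ** gram ** (A ** B) = gram" using SO_plusD[OF A] SO_plusD[OF B] by simp
  moreover have "det (A ** B) = 1" using SO_plusD[OF A] SO_plusD[OF B] by (simp add: det_mul)
  moreover have "(A ** B) $ None $ None > 0"
    using SO_plus_future_cone[OF A SO_plus_future_cone[OF B time_axis_in_future_cone]]
    by (simp add: future_cone_iff matrix_vector_mul_assoc time_axis_image)
  ultimately show ?thesis by (simp add: SO_plus_def)
qed

lemma group_SO_plus: "group (SO_plus :: 'n::finite mink_mat monoid)"
proof (rule groupI)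
  fix A :: "'n mink_mat" assume "A \<in> carrier SO_plus"
  then show "\<exists>y\<in>carrier SO_plus. y \<otimes>\<^bsub>SO_plus\<^esub> A = \<one>\<^bsub>SO_plus\<^esub>"
    using SO_plus_inverse by (auto simp: SO_plus_def)
next
  show "\<one>\<^bsub>SO_plus\<^esub> \<in> carrier (SO_plus :: 'n mink_mat monoid)"
    by (simp add: SO_plus_def transpose_mat mat_def[of 1])
      (simp add: mat_def[symmetric])
qed (use SO_plus_mult in \<open>auto simp: SO_plus_def matrix_mul_assoc\<close>)

lemma matrix_inv_eqI:
  fixes A B :: "real ^ 'n ^ 'n"
  assumes "A ** B = mat 1" "B ** A = mat 1"
  shows "matrix_inv A = B"
proof -
  have "A ** matrix_inv A = mat 1 \<and> matrix_inv A ** A = mat 1"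
    unfolding matrix_inv_def by (rule someI[of _ B]) (use assms in simp)
  then show ?thesis using assms by (metis matrix_mul_assoc matrix_mul_lid matrix_mul_rid)
qed

lemma gram_diag: "gram $ i $ i = (if i = None then - 1 else 1)"
  by (simp add: gram_def)

lemma matrix_inv_SO_plus:
  assumes "A \<in> carrier SO_plus"
  shows "matrix_inv A = gram ** transpose A ** gram"
  by (rule matrix_inv_eqI) (use SO_plus_inverse[OF assms] in auto)

lemma SO_plus_matrix_inv:
  assumes "A \<in> carrier SO_plus"
  shows "matrix_inv A ** A = mat 1" "A ** matrix_inv A = mat 1" "matrix_inv A \<in> carrier SO_plus"
  using SO_plus_inverse[OF assms] by (simp_all add: matrix_inv_SO_plus[OF assms])

lemma matrix_mult_scaleR:
  fixes X :: "real ^ 'n ^ 'm"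
  shows "(c *\<^sub>R X) ** Y = c *\<^sub>R (X ** Y)" "X ** (c *\<^sub>R Y) = c *\<^sub>R (X ** Y)"
  by (simp_all add: matrix_matrix_mult_def vec_eq_iff sum_distrib_left mult.assoc mult.left_commute)

lemma matrix_mult_add_right: "(X + Y) ** Z = X ** Z + Y ** Z" for X :: "real ^ 'n ^ 'm"
  by (simp add: matrix_matrix_mult_def vec_eq_iff sum.distrib distrib_right)

lemma linear_Ad: "linear (Ad \<gamma>)"
  by (rule linearI)
    (simp_all add: Ad_def matrix_mult_add_right matrix_add_ldistrib matrix_mult_scaleR)

lemma nu_iff: "X \<in> nu \<longleftrightarrow> trace X = 0 \<and>
    (\<forall>i j. X $ j $ i * gram $ j $ j = gram $ i $ i * X $ i $ j)" for X :: "'n::finite mink_mat"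
proof -
  have "(transpose X ** gram) $ i $ j = X $ j $ i * gram $ j $ j" for i j
    by (simp add: matrix_matrix_mult_def transpose_def gram_def if_distrib[of "\<lambda>t. _ * t"] sum.delta cong: if_cong)
  moreover have "(gram ** X) $ i $ j = gram $ i $ i * X $ i $ j" for i j
    by (simp add: matrix_matrix_mult_def gram_def if_distrib[of "\<lambda>t. t * _"] sum.delta cong: if_cong)
  ultimately show ?thesis by (simp add: nu_def vec_eq_iff)
qed

lemma subspace_nu: "subspace (nu :: 'n::finite mink_mat set)"
proof (rule subspaceI)
  fix X Y :: "'n mink_mat" and c :: real
  show "0 \<in> (nu :: 'n mink_mat set)" by (simp add: nu_iff trace_def)
  show "X + Y \<in> nu" if "X \<in> nu" "Y \<in> nu"
    using that by (simp add: nu_iff trace_add algebra_simps)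
  show "c *\<^sub>R X \<in> nu" if "X \<in> nu"
    using that by (simp add: nu_iff trace_def sum_distrib_left[symmetric] algebra_simps)
qed

section \<open>Bending directions\<close>

text \<open>
  The matrix \<open>v v\<^sup>T J\<close>, with its trace removed.
\<close>

definition bend :: "'n::finite mink \<Rightarrow> 'n mink_mat" where
  "bend v = (\<chi> i j. v $ i * (gram *v v) $ j) - (lorentz v v / real CARD('n option)) *\<^sub>R mat 1"

lemma bend_mult: "bend v *v x = lorentz v x *\<^sub>R v - (lorentz v v / real CARD('n option)) *\<^sub>R x"
  for v x :: "'n::finite mink"
proof -
  have "(\<chi> i j. v $ i * (gram *v v) $ j) *v x = lorentz x v *\<^sub>R v"
    by (simp add: vec_eq_iff matrix_vector_mult_def[of _ x] lorentz_def inner_vec_def sum_distrib_right sum_distrib_left mult_ac)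
  then show ?thesis
    by (simp add: bend_def matrix_vector_mult_diff_rdistrib scaleR_matrix_vector_assoc[symmetric] lorentz_commute)
qed

lemma bend_in_nu: "bend v \<in> nu" for v :: "'n::finite mink"
proof -
  have "trace (\<chi> i j. v $ i * (gram *v v) $ j) = lorentz v v"
    by (simp add: trace_def lorentz_def inner_vec_def)
  moreover have "trace (c *\<^sub>R mat 1 :: 'n mink_mat) = c * real CARD('n option)" for c
    by (simp add: trace_def mat_def)
  ultimately have "trace (bend v) = 0" by (simp add: bend_def trace_sub)
  moreover have "bend v $ j $ i * gram $ j $ j = gram $ i $ i * bend v $ i $ j" for i j
    by (cases "i = j") (simp_all add: bend_def mat_def gram_mult_vec gram_diag)
  ultimately show ?thesis by (simp add: nu_iff)
qed

lemma bend_equivariant: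
  assumes A: "A \<in> carrier SO_plus"
  shows "bend (A *v v) = Ad A (bend v)"
  unfolding matrix_eq
proof
  fix x
  have "lorentz (A *v v) x = lorentz (A *v v) (A *v (matrix_inv A *v x))"
    using SO_plus_matrix_inv(2)[OF A] by (simp add: matrix_vector_mul_assoc)
  then have l: "lorentz (A *v v) x = lorentz v (matrix_inv A *v x)" by (simp add: lorentz_isometry[OF A])
  have "Ad A (bend v) *v x = A *v (bend v *v (matrix_inv A *v x))"
    by (simp add: Ad_def matrix_vector_mul_assoc matrix_mul_assoc)
  also have "\<dots> = bend (A *v v) *v x"
  proof -
    have "A *v (matrix_inv A *v x) = x"
      using SO_plus_matrix_inv(2)[OF A] by (simp add: matrix_vector_mul_assoc)
    then show ?thesis
      by (simp add: bend_mult matrix_vector_mult_diff_distrib matrix_vector_mult_scaleR l lorentz_isometry[OF A])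
  qed
  finally show "bend (A *v v) *v x = Ad A (bend v) *v x" by simp
qed

text \<open>
  Polarization of the quadratic map \<open>bend\<close>, written so that its values on the plane spanned by \<open>u\<close> and
  \<open>v\<close> visibly lie in the span of three of them.
\<close>

lemma bend_quadratic:
  "bend (s *\<^sub>R u + t *\<^sub>R v) =
     (s * s - s * t) *\<^sub>R bend u + (t * t - s * t) *\<^sub>R bend v + (s * t) *\<^sub>R bend (u + v)"
proof -
  have 1: "lorentz (u + v) x = lorentz u x + lorentz v x" for x by (rule lorentz_add_left)
  show ?thesis
    unfolding matrix_eq
    by (simp add: matrix_vector_mult_add_rdistrib scaleR_matrix_vector_assoc[symmetric] bend_mult
      lorentz_add_left lorentz_add_right lorentz_scaleR_left lorentz_scaleR_right lorentz_commute[of v u]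
      algebra_simps add_divide_distrib diff_divide_distrib)
qed

lemma bend_nonzero: "lorentz v v = 1 \<Longrightarrow> bend v \<noteq> 0" for v :: "'n::finite mink"
proof
  assume v: "lorentz v v = 1" and "bend v = 0"
  then have "bend v *v v = 0" by simp
  then have "(1 - 1 / real CARD('n option)) *\<^sub>R v = 0" using v by (simp add: bend_mult scaleR_left_diff_distrib)
  moreover have "real CARD('n option) \<noteq> 1" by simp
  ultimately have "v = 0" by simp
  then show False using v by (simp add: lorentz_def)
qed

section \<open>Invariants of the orthogonal complement\<close>

definition half_turn :: "'n::finite \<Rightarrow> 'n \<Rightarrow> 'n mink_mat" where
  "half_turn i j = (\<chi> a b. if a = b then (if a \<in> {Some i, Some j} then - 1 else 1) else 0)"

definition boost :: "'n::finite \<Rightarrow> 'n mink_mat" where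
  "boost i = (\<chi> a b. if a = b then (if a \<in> {None, Some i} then 5 / 3 else 1)
     else if {a, b} = {None, Some i} then 4 / 3 else 0)"

lemma half_turn_mult_vec: "(half_turn i j *v x) $ a = (if a \<in> {Some i, Some j} then - 1 else 1) * x $ a"
  by (simp add: half_turn_def matrix_vector_mult_def if_distrib[of "\<lambda>t. t * _"] sum.delta cong: if_cong)

lemma half_turn_in_SO_plus:
  assumes "i \<noteq> j"
  shows "half_turn i j \<in> carrier SO_plus"
proof -
  have "transpose (half_turn i j) = half_turn i j"
    by (auto simp: half_turn_def transpose_def vec_eq_iff)
  then have "transpose (half_turn i j) ** gram ** half_turn i j = gram"
    unfolding matrix_eq matrix_vector_mul_assoc[symmetric]
    by (simp add: vec_eq_iff half_turn_mult_vec gram_mult_vec)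
  moreover have "det (half_turn i j) = 1"
  proof -
    have "det (half_turn i j) = (\<Prod>a\<in>UNIV. if a \<in> {Some i, Some j} then - 1 else 1 :: real)"
      by (subst det_diagonal) (auto simp: half_turn_def)
    also have "\<dots> = (- 1) ^ card {Some i, Some j}"
      by (subst prod.If_cases) (auto simp: Collect_disj_eq insert_commute)
    also have "card {Some i, Some j} = 2" using assms by simp
    finally show ?thesis by simp
  qed
  moreover have "half_turn i j $ None $ None > 0" by (simp add: half_turn_def)
  ultimately show ?thesis by (simp add: SO_plus_def)
qed

lemma boost_mult_vec: "(boost i *v x) $ a =
   (if a = None then 5 / 3 * x $ None + 4 / 3 * x $ Some i
    else if a = Some i then 4 / 3 * x $ None + 5 / 3 * x $ Some i else x $ a)"
proof -
  have "(\<Sum>k\<in>UNIV. boost i $ a $ Some k * x $ Some k) =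
     boost i $ a $ Some i * x $ Some i + (\<Sum>k\<in>UNIV - {i}. boost i $ a $ Some k * x $ Some k)"
    by (subst sum.remove[of UNIV i]) auto
  also have "(\<Sum>k\<in>UNIV - {i}. boost i $ a $ Some k * x $ Some k) =
     (\<Sum>k\<in>UNIV - {i}. if a = Some k then x $ Some k else 0)"
    by (rule sum.cong) (auto simp: boost_def doubleton_eq_iff)
  also have "\<dots> = (if a = None \<or> a = Some i then 0 else x $ a)"
    by (cases a) (auto simp: sum.delta)
  finally show ?thesis
    by (cases a) (auto simp: matrix_vector_mult_def[of _ x] sum_UNIV_option, auto simp: boost_def doubleton_eq_iff)
qed

lemma boost_square_in_SO_plus: "boost i ** boost i \<in> carrier SO_plus"
proof -
  have T: "transpose (boost i) = boost i"
    by (auto simp: boost_def transpose_def vec_eq_iff doubleton_eq_iff)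
  have 1: "transpose (boost i) ** gram ** boost i = gram"
    unfolding T matrix_eq matrix_vector_mul_assoc[symmetric]
    by (auto simp: vec_eq_iff boost_mult_vec gram_mult_vec field_simps)
  have "transpose (boost i ** boost i) ** gram ** (boost i ** boost i) =
      transpose (boost i) ** (transpose (boost i) ** gram ** boost i) ** boost i"
    by (simp add: matrix_transpose_mul matrix_mul_assoc)
  then have "transpose (boost i ** boost i) ** gram ** (boost i ** boost i) = gram" using 1 by simp
  moreover have "det (boost i ** boost i) = 1" using det_square_one[OF 1] by (simp add: det_mul)
  moreover have "(boost i ** boost i) $ None $ None > 0"
    unfolding time_axis_image[symmetric] matrix_vector_mul_assoc[symmetric]
    by (simp add: boost_mult_vec axis_def)
  ultimately show ?thesis by (simp add: SO_plus_def)
qed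

text \<open>
  Half-turns in a space-like plane that contains the \<open>i\<close>-th axis but not the other axis in question
  kill the off-diagonal entries; here a third space-like direction is needed. A boost relates
  the time-like diagonal entry to a space-like one, so \<open>X\<close> is scalar, and its trace is zero. Squares
  of boosts are used because their determinant is visibly 1.
\<close>

lemma nu_invariant_zero:
  fixes X :: "'n::finite mink_mat"
  assumes n: "CARD('n) \<ge> 3" and X: "X \<in> nu"
    and inv: "\<And>A. A \<in> carrier SO_plus \<Longrightarrow> A ** X = X ** A"
  shows "X = 0"
proof -
  have inv': "A *v (X *v x) = X *v (A *v x)" if "A \<in> carrier SO_plus" for A x
    using inv[OF that] by (simp add: matrix_vector_mul_assoc)
  have entry: "X $ a $ b = (X *v axis b 1) $ a" for a b by (simp add: matrix_vector_mult_basis column_def)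
  have off: "X $ a $ Some i = 0 \<and> X $ Some i $ a = 0" if a: "a \<noteq> Some i" for a i
  proof -
    have "\<exists>j. j \<noteq> i \<and> Some j \<noteq> a"
    proof (rule ccontr)
      assume "\<nexists>j. j \<noteq> i \<and> Some j \<noteq> a"
      then have "UNIV \<subseteq> {i, the a}" by force
      then have "CARD('n) \<le> card {i, the a}" by (intro card_mono) auto
      also have "\<dots> \<le> 2" by (simp add: card_insert_if)
      finally show False using n by simp
    qed
    then obtain j where j: "j \<noteq> i" "Some j \<noteq> a" by blast
    have H: "half_turn i j \<in> carrier SO_plus" using j by (intro half_turn_in_SO_plus) auto
    have h1: "half_turn i j *v axis (Some i) 1 = (- 1) *\<^sub>R axis (Some i) 1"
      by (simp add: vec_eq_iff half_turn_mult_vec axis_def)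
    have h2: "half_turn i j *v axis a 1 = axis a 1"
      using a j by (auto simp: vec_eq_iff half_turn_mult_vec axis_def)
    have "(half_turn i j *v (X *v axis (Some i) 1)) $ a = ((- 1) *\<^sub>R (X *v axis (Some i) 1)) $ a"
      using inv'[OF H] h1 matrix_vector_mult_scaleR by metis
    then have "(X *v axis (Some i) 1) $ a = - (X *v axis (Some i) 1) $ a"
      using a j by (simp add: half_turn_mult_vec)
    moreover have "(half_turn i j *v (X *v axis a 1)) $ Some i = (X *v axis a 1) $ Some i"
      using inv'[OF H] h2 by metis
    then have "- (X *v axis a 1) $ Some i = (X *v axis a 1) $ Some i"
      by (simp add: half_turn_mult_vec)
    ultimately show ?thesis unfolding entry by simp
  qed
  have diag: "X *v x = (\<chi> a. X $ a $ a * x $ a)" for x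
  proof -
    have "X $ a $ b = (if b = a then X $ a $ a else 0)" for a b
      using off by (cases a; cases b) auto
    then have "(X *v x) $ a = (\<Sum>b\<in>UNIV. (if b = a then X $ a $ a else 0) * x $ b)" for a
      unfolding matrix_vector_mult_def by simp
    then show ?thesis
      by (simp add: vec_eq_iff if_distrib[of "\<lambda>t. t * _"] sum.delta cong: if_cong)
  qed
  have eq: "X $ Some i $ Some i = X $ None $ None" for i
  proof -
    have "((boost i ** boost i) *v (X *v axis None 1)) $ Some i = (X *v ((boost i ** boost i) *v axis None 1)) $ Some i"
      using inv'[OF boost_square_in_SO_plus] by metis
    then show ?thesis
      unfolding diag matrix_vector_mul_assoc[symmetric] by (simp add: boost_mult_vec axis_def)
  qed
  have "trace X = real CARD('n option) * X $ None $ None"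
    unfolding trace_def sum_UNIV_option eq by (simp add: algebra_simps)
  then have "X $ None $ None = 0" using X by (simp add: nu_def)
  then show "X = 0" using eq off by (simp add: vec_eq_iff) (metis option.exhaust)
qed

text \<open>
  Commuting with \<open>X\<close> is a set of linear equations in the entries of \<open>A\<close>.
\<close>

lemma zariski_dense_centralizer:
  assumes dense: "zariski_dense_in_SO_plus S" and X: "\<And>A. A \<in> S \<Longrightarrow> A ** X = X ** A"
    and A: "A \<in> carrier SO_plus"
  shows "A ** X = X ** A"
proof -
  have "(A ** X) $ i $ j - (X ** A) $ i $ j = 0" for i j
  proof -
    have "linear (\<lambda>A. (A ** X) $ i $ j - (X ** A) $ i $ j)"
      by (rule linearI) (simp_all add: matrix_mult_add_right matrix_add_ldistrib matrix_mult_scaleR algebra_simps)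
    then have "real_polynomial_function (\<lambda>A. (A ** X) $ i $ j - (X ** A) $ i $ j)"
      by (intro real_polynomial_function.intros(1) linear_conv_bounded_linear[THEN iffD1])
    then show ?thesis
      using dense A X unfolding zariski_dense_in_SO_plus_def zariski_closure_def by force
  qed
  then show ?thesis by (simp add: vec_eq_iff)
qed

lemma subspace_codim2_equations:
  fixes V :: "'a::euclidean_space set"
  assumes V: "subspace V" and dim: "dim V + 2 = DIM('a)"
  obtains a b where "transverse_pair a b" "V = {y. a \<bullet> y = 0 \<and> b \<bullet> y = 0}"
    "\<And>w. (\<And>v. v \<in> V \<Longrightarrow> w \<bullet> v = 0) \<Longrightarrow> w \<in> span {a, b}"
proof -
  define W where "W = {y. \<forall>x\<in>V. orthogonal x y}"
  have W: "subspace W"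
    unfolding W_def orthogonal_def by (rule subspaceI) (auto simp: inner_add_right)
  have "dim {y \<in> UNIV. \<forall>x\<in>V. orthogonal x y} + dim V = dim (UNIV :: 'a set)"
    by (rule dim_subspace_orthogonal_to_vectors[OF V subspace_UNIV]) simp
  then have "dim W = 2" using dim by (simp add: W_def dim_UNIV)
  then obtain A where A: "A \<subseteq> W" "pairwise orthogonal A" "\<And>x. x \<in> A \<Longrightarrow> norm x = 1" "card A = 2" "span A = W"
    using orthonormal_basis_subspace[OF W] by metis
  then obtain a b where ab: "A = {a, b}" "a \<noteq> b" by (meson card_2_iff)
  have orth: "a \<bullet> b = 0" using A(2) ab by (auto simp: pairwise_def orthogonal_def)
  have unit: "a \<bullet> a = 1" "b \<bullet> b = 1" using A(3) ab by (auto simp: dot_square_norm)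
  have tp: "transverse_pair a b"
    unfolding transverse_pair_def
  proof (intro allI)
    fix s t
    show "\<exists>v. a \<bullet> v = s \<and> b \<bullet> v = t"
      by (rule exI[of _ "s *\<^sub>R a + t *\<^sub>R b"])
        (use orth unit in \<open>simp add: inner_add_right inner_commute[of b a]\<close>)
  qed
  have span: "span {a, b} = W" using A ab by simp
  have "V = {y. a \<bullet> y = 0 \<and> b \<bullet> y = 0}"
  proof (intro equalityI subsetI)
    fix y assume "y \<in> V"
    moreover have "a \<in> W" "b \<in> W" using A ab by auto
    ultimately show "y \<in> {y. a \<bullet> y = 0 \<and> b \<bullet> y = 0}"
      by (auto simp: W_def orthogonal_def inner_commute)
  next
    fix y assume y: "y \<in> {y. a \<bullet> y = 0 \<and> b \<bullet> y = 0}"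
    obtain p q where pq: "p \<in> span V" "\<And>w. w \<in> span V \<Longrightarrow> orthogonal q w" "y = p + q"
      using orthogonal_subspace_decomp_exists[of V y] by metis
    have pV: "p \<in> V" using pq(1) span_eq_iff[of V] V by blast
    have "q \<in> W"
      using pq(2) by (auto simp: W_def orthogonal_commute span_base)
    then have "q \<in> span {a, b}" by (simp add: span)
    then obtain s where "q - s *\<^sub>R a \<in> span {b}" by (auto simp: span_breakdown_eq)
    then obtain t where "q - s *\<^sub>R a = t *\<^sub>R b" by (auto simp: span_singleton)
    then have q: "q = s *\<^sub>R a + t *\<^sub>R b" by (simp add: algebra_simps)
    have "q \<bullet> y = 0" using y by (simp add: q inner_add_left)
    moreover have "q \<bullet> p = 0" using pq(2)[OF pq(1)] by (simp add: orthogonal_def)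
    ultimately have "q \<bullet> q = 0" using pq(3) by (simp add: inner_add_right)
    then show "y \<in> V" using pq(3) pV by simp
  qed
  moreover have "w \<in> span {a, b}" if "\<And>v. v \<in> V \<Longrightarrow> w \<bullet> v = 0" for w
    unfolding span W_def orthogonal_def using that by (simp add: inner_commute)
  ultimately show ?thesis using that tp by blast
qed

section \<open>The wall system of a branched hypersurface\<close>

locale bending =
  fixes \<Gamma> :: "'n::finite mink_mat set" and \<Delta> B :: "'n mink set set"
    and N :: "'n mink set set \<Rightarrow> 'n mink \<Rightarrow> 'n mink"
  assumes \<Gamma>: "subgroup \<Gamma> SO_plus"
    and branched: "branched_hypersurface \<Gamma> \<Delta> B"
    and N: "w \<in> components_in \<Gamma> (\<Delta> - B) \<Longrightarrow> transverse_orientation \<Gamma> w (N w)"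
begin

abbreviation "M \<equiv> quotient_manifold \<Gamma>"
abbreviation "walls \<equiv> components_in \<Gamma> (\<Delta> - B)"
abbreviation "bindings \<equiv> components_in \<Gamma> B"

definition cone_over :: "'n mink set set \<Rightarrow> 'n mink set" where
  "cone_over S = {x \<in> future_cone. to_hyp x \<in> lift \<Gamma> S}"

definition wall_at :: "'n mink \<Rightarrow> 'n mink set set" where
  "wall_at x = connected_component_of_set (subtopology M (\<Delta> - B)) (orbit \<Gamma> (to_hyp x))"

definition unit_normal :: "'n mink \<Rightarrow> 'n mink" where
  "unit_normal x = N (wall_at x) (to_hyp x)"

definition conormal :: "'n mink \<Rightarrow> 'n mink" where
  "conormal x = gram *v unit_normal x"

abbreviation "off_walls \<equiv> future_cone - cone_over \<Delta>"

lemma \<Gamma>_carrier: "\<gamma> \<in> \<Gamma> \<Longrightarrow> \<gamma> \<in> carrier SO_plus"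
  using subgroup.subset[OF \<Gamma>] by blast

lemma \<Gamma>_one: "mat 1 \<in> \<Gamma>"
  using subgroup.one_closed[OF \<Gamma>] by (simp add: SO_plus_def)

lemma \<Gamma>_mult: "\<gamma> \<in> \<Gamma> \<Longrightarrow> \<eta> \<in> \<Gamma> \<Longrightarrow> \<gamma> ** \<eta> \<in> \<Gamma>"
  using subgroup.m_closed[OF \<Gamma>, of \<gamma> \<eta>] by (simp add: SO_plus_def)

lemma \<Gamma>_inv: "\<gamma> \<in> \<Gamma> \<Longrightarrow> matrix_inv \<gamma> \<in> \<Gamma>"
proof -
  assume \<gamma>: "\<gamma> \<in> \<Gamma>"
  then have c: "\<gamma> \<in> carrier SO_plus" by (rule \<Gamma>_carrier)
  have "inv\<^bsub>SO_plus\<^esub> \<gamma> = matrix_inv \<gamma>"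
    by (rule group.inv_equality[OF group_SO_plus])
      (use SO_plus_matrix_inv[OF c] c in \<open>auto simp: SO_plus_def\<close>)
  then show ?thesis using subgroup.m_inv_closed[OF \<Gamma> \<gamma>] by simp
qed

lemma orbit_invariant: "\<gamma> \<in> \<Gamma> \<Longrightarrow> orbit \<Gamma> (\<gamma> *v x) = orbit \<Gamma> x"
proof -
  assume \<gamma>: "\<gamma> \<in> \<Gamma>"
  have "orbit \<Gamma> (\<eta> *v y) \<subseteq> orbit \<Gamma> y" if "\<eta> \<in> \<Gamma>" for \<eta> y
    using that \<Gamma>_mult by (auto simp: orbit_def matrix_vector_mul_assoc)
  from this[OF \<gamma>, of x] this[OF \<Gamma>_inv[OF \<gamma>], of "\<gamma> *v x"] show ?thesis
    using SO_plus_matrix_inv(1)[OF \<Gamma>_carrier[OF \<gamma>]] by (simp add: matrix_vector_mul_assoc)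
qed

lemma topspace_quotient: "topspace M = orbit \<Gamma> ` hyp"
  using quotient_map_orbit[of \<Gamma>] by (auto simp: quotient_map_def)

lemma continuous_map_orbit: "continuous_map (top_of_set hyp) M (orbit \<Gamma>)"
  using quotient_map_orbit by (rule quotient_imp_continuous_map)

lemma closed_lift: "closedin M S \<Longrightarrow> closedin (top_of_set hyp) (lift \<Gamma> S)"
  using closedin_continuous_map_preimage[OF continuous_map_orbit] by (simp add: lift_def)

text \<open>
  Components are closed, and finitely many of them are therefore also open.
\<close>

lemma component_isolated:
  assumes fin: "finite (components_in \<Gamma> S)" and w: "w \<in> components_in \<Gamma> S" and x: "x \<in> lift \<Gamma> w"
  obtains U where "open U" "x \<in> U" "\<And>y. y \<in> U \<Longrightarrow> y \<in> lift \<Gamma> S \<Longrightarrow> y \<in> lift \<Gamma> w"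
proof -
  have "openin (subtopology M S) w"
    by (rule open_in_finite_connected_components[OF fin w])
  then obtain T where T: "openin M T" "w = T \<inter> S"
    by (auto simp: openin_subtopology)
  have "openin (top_of_set hyp) {y \<in> topspace (top_of_set hyp). orbit \<Gamma> y \<in> T}"
    by (rule openin_continuous_map_preimage[OF continuous_map_orbit T(1)])
  then obtain U where U: "open U" "{y \<in> hyp. orbit \<Gamma> y \<in> T} = hyp \<inter> U"
    by (auto simp: openin_open)
  have "x \<in> U" using U x T by (auto simp: lift_def)
  moreover have "y \<in> lift \<Gamma> w" if "y \<in> U" "y \<in> lift \<Gamma> S" for y
    using U T that by (auto simp: lift_def)
  ultimately show ?thesis using that U by blast
qed

lemmas branched_unfolded = branched[unfolded branched_hypersurface_def]

lemma B_closed: "closedin M B"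
  and \<Delta>_closed: "closedin M \<Delta>" and B_\<Delta>: "B \<subseteq> \<Delta>"
  and finite_bindings: "finite bindings" and finite_walls: "finite walls"
  using branched_unfolded by simp_all

lemma bindings_geodesic: "b \<in> bindings \<Longrightarrow> totally_geodesic_piece \<Gamma> 2 b"
  using branched_unfolded by simp

lemma adjacent:
  assumes "\<beta> \<in> components (lift \<Gamma> B)"
  obtains \<omega> where "\<omega> \<in> components (lift \<Gamma> (\<Delta> - B))" "\<beta> \<subseteq> closure \<omega>"
proof -
  have "\<forall>\<beta> \<in> components (lift \<Gamma> B).
        \<exists>\<omega> \<in> components (lift \<Gamma> (\<Delta> - B)). \<exists>\<omega>' \<in> components (lift \<Gamma> (\<Delta> - B)).
          \<omega> \<noteq> \<omega>' \<and> \<beta> \<subseteq> closure \<omega> \<and> \<beta> \<subseteq> closure \<omega>'"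
    using branched_unfolded by simp
  from bspec[OF this assms] show ?thesis using that by blast
qed

lemma closed_lift_avoid:
  assumes "closedin M S" "x \<in> hyp" "x \<notin> lift \<Gamma> S"
  obtains U where "open U" "x \<in> U" "U \<inter> lift \<Gamma> S = {}"
proof -
  obtain K where K: "closed K" "lift \<Gamma> S = hyp \<inter> K"
    using closed_lift[OF assms(1)] by (auto simp: closedin_closed)
  have "lift \<Gamma> S \<subseteq> hyp" by (auto simp: lift_def)
  then show ?thesis using that[of "- K"] K assms by (auto simp: open_Compl)
qed

lemma component_of_lift:
  assumes S: "S \<subseteq> topspace M" and x: "x \<in> lift \<Gamma> S"
  shows "connected_component_of_set (subtopology M S) (orbit \<Gamma> x) \<in> components_in \<Gamma> S"
    "x \<in> lift \<Gamma> (connected_component_of_set (subtopology M S) (orbit \<Gamma> x))"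
proof -
  have t: "orbit \<Gamma> x \<in> topspace (subtopology M S)"
    using S x by (auto simp: lift_def)
  then show "connected_component_of_set (subtopology M S) (orbit \<Gamma> x) \<in> components_in \<Gamma> S"
    by (simp add: connected_component_in_connected_components_of)
  show "x \<in> lift \<Gamma> (connected_component_of_set (subtopology M S) (orbit \<Gamma> x))"
    using t x by (simp add: lift_def connected_component_of_refl)
qed

lemma component_eq:
  assumes w: "w \<in> components_in \<Gamma> S" and x: "x \<in> lift \<Gamma> w"
  shows "connected_component_of_set (subtopology M S) (orbit \<Gamma> x) = w"
proof -
  obtain p where p: "w = connected_component_of_set (subtopology M S) p"
    using w by (auto simp: connected_components_of_def)
  then have "connected_component_of (subtopology M S) p (orbit \<Gamma> x)"
    using x by (simp add: lift_def)
  then show ?thesis using p by (metis connected_component_of_equiv)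
qed

lemma \<Delta>_topspace: "\<Delta> - B \<subseteq> topspace M" "B \<subseteq> topspace M"
  using closedin_subset[OF \<Delta>_closed] closedin_subset[OF B_closed] by auto

lemma cone_over_diff: "cone_over \<Delta> - cone_over B = cone_over (\<Delta> - B)"
  by (auto simp: cone_over_def lift_def)

lemma wall_at_wall:
  assumes "x \<in> cone_over (\<Delta> - B)"
  shows "wall_at x \<in> walls" "to_hyp x \<in> lift \<Gamma> (wall_at x)"
proof -
  have "to_hyp x \<in> lift \<Gamma> (\<Delta> - B)" using assms by (simp add: cone_over_def)
  from component_of_lift[OF \<Delta>_topspace(1) this]
  show "wall_at x \<in> walls" "to_hyp x \<in> lift \<Gamma> (wall_at x)" unfolding wall_at_def .
qed

lemma unit_normal_unit: "x \<in> cone_over (\<Delta> - B) \<Longrightarrow> lorentz (unit_normal x) (unit_normal x) = 1"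
proof -
  assume x: "x \<in> cone_over (\<Delta> - B)"
  have "transverse_orientation \<Gamma> (wall_at x) (N (wall_at x))" by (rule N[OF wall_at_wall(1)[OF x]])
  then show ?thesis
    unfolding unit_normal_def transverse_orientation_def using wall_at_wall(2)[OF x] by simp
qed

lemma inner_conormal: "conormal x \<bullet> y = lorentz y (unit_normal x)"
  by (simp add: conormal_def lorentz_def inner_commute)

lemma gram_conormal: "gram *v conormal x = unit_normal x"
  by (simp add: conormal_def matrix_vector_mul_assoc gram_gram)

lemma conormal_nonzero: "x \<in> cone_over (\<Delta> - B) \<Longrightarrow> conormal x \<noteq> 0"
  using unit_normal_unit[of x] inner_conormal[of x "unit_normal x"] by auto

lemma lorentz_to_hyp_zero: "x \<in> future_cone \<Longrightarrow> lorentz (to_hyp x) v = 0 \<longleftrightarrow> lorentz x v = 0"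
proof -
  assume "x \<in> future_cone"
  then obtain s where "s > 0" "to_hyp x = s *\<^sub>R x" by (rule to_hyp_scale)
  then show ?thesis by (simp add: lorentz_scaleR_left)
qed

lemma wall_chart:
  assumes x: "x \<in> cone_over (\<Delta> - B)"
  obtains U where "open U" "x \<in> U" "U \<subseteq> future_cone - cone_over B"
    "\<And>y. y \<in> U \<Longrightarrow> y \<in> cone_over \<Delta> \<longleftrightarrow> conormal x \<bullet> y = 0"
    "\<And>y. y \<in> U \<Longrightarrow> y \<in> cone_over \<Delta> \<Longrightarrow> wall_at y = wall_at x"
proof -
  have hx: "to_hyp x \<in> hyp" "x \<in> future_cone" "to_hyp x \<notin> lift \<Gamma> B"
    using x to_hyp_in_hyp by (auto simp: cone_over_def lift_def)
  note w = wall_at_wall[OF x]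
  obtain U1 where U1: "open U1" "to_hyp x \<in> U1"
      "\<And>y. y \<in> U1 \<Longrightarrow> y \<in> lift \<Gamma> (\<Delta> - B) \<Longrightarrow> y \<in> lift \<Gamma> (wall_at x)"
    by (rule component_isolated[OF finite_walls w]) blast
  obtain U2 where U2: "open U2" "to_hyp x \<in> U2" "U2 \<inter> lift \<Gamma> B = {}"
    by (rule closed_lift_avoid[OF B_closed hx(1,3)])
  obtain U3 where U3: "open U3" "to_hyp x \<in> U3"
      "lift \<Gamma> (wall_at x) \<inter> U3 = {y \<in> hyp. lorentz y (unit_normal x) = 0} \<inter> U3"
    using N[OF w(1)] w(2) unfolding transverse_orientation_def unit_normal_def by blast
  obtain V where V: "open V" "x \<in> V" "V \<subseteq> future_cone" "\<And>y. y \<in> V \<Longrightarrow> to_hyp y \<in> U1 \<inter> U2 \<inter> U3"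
    by (rule to_hyp_neighbourhood[of x "U1 \<inter> U2 \<inter> U3"]) (use U1 U2 U3 hx in \<open>auto simp: open_Int\<close>)
  have sub: "lift \<Gamma> (wall_at x) \<subseteq> lift \<Gamma> (\<Delta> - B)"
    using connected_components_of_subset[OF w(1)] by (auto simp: lift_def)
  have D: "y \<in> cone_over \<Delta> \<longleftrightarrow> to_hyp y \<in> lift \<Gamma> (wall_at x)" if "y \<in> V" for y
  proof -
    have "to_hyp y \<notin> lift \<Gamma> B" using V(4)[OF that] U2 by blast
    then have "y \<in> cone_over \<Delta> \<longleftrightarrow> to_hyp y \<in> lift \<Gamma> (\<Delta> - B)"
      using V(3) that by (auto simp: cone_over_def lift_def)
    also have "\<dots> \<longleftrightarrow> to_hyp y \<in> lift \<Gamma> (wall_at x)" using U1(3) V(4)[OF that] sub by blast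
    finally show ?thesis .
  qed
  show ?thesis
  proof (rule that[OF V(1,2)])
    show "V \<subseteq> future_cone - cone_over B" using V U2 by (auto simp: cone_over_def)
    fix y assume y: "y \<in> V"
    have yh: "to_hyp y \<in> hyp" "y \<in> future_cone" using to_hyp_in_hyp V y by auto
    have "to_hyp y \<in> lift \<Gamma> (wall_at x) \<longleftrightarrow> lorentz (to_hyp y) (unit_normal x) = 0"
      using U3(3) V(4)[OF y] yh by blast
    then show "y \<in> cone_over \<Delta> \<longleftrightarrow> conormal x \<bullet> y = 0"
      unfolding D[OF y] inner_conormal lorentz_to_hyp_zero[OF yh(2)] .
    show "wall_at y = wall_at x" if "y \<in> cone_over \<Delta>"
      using component_eq[OF w(1)] that D[OF y] by (simp add: wall_at_def)
  qed
qed

text \<open>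
  Nearby points of the lifted walls lie on the same linear hyperplane, so their unit normals agree up to
  sign, and continuity of the transverse orientation fixes the sign.
\<close>

lemma wall_chart_normal:
  assumes x: "x \<in> cone_over (\<Delta> - B)"
  obtains U where "open U" "x \<in> U" "U \<subseteq> future_cone - cone_over B"
    "\<And>y. y \<in> U \<Longrightarrow> y \<in> cone_over \<Delta> \<longleftrightarrow> conormal x \<bullet> y = 0"
    "\<And>y. y \<in> U \<Longrightarrow> y \<in> cone_over \<Delta> \<Longrightarrow> wall_at y = wall_at x \<and> unit_normal y = unit_normal x"
proof -
  obtain U where U: "open U" "x \<in> U" "U \<subseteq> future_cone - cone_over B"
    "\<And>y. y \<in> U \<Longrightarrow> y \<in> cone_over \<Delta> \<longleftrightarrow> conormal x \<bullet> y = 0"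
    "\<And>y. y \<in> U \<Longrightarrow> y \<in> cone_over \<Delta> \<Longrightarrow> wall_at y = wall_at x"
    by (rule wall_chart[OF x]) blast
  note w = wall_at_wall[OF x]
  have ux: "unit_normal x \<noteq> 0" using unit_normal_unit[OF x] by (auto simp: lorentz_def)
  have "continuous_on (lift \<Gamma> (wall_at x)) (N (wall_at x))"
    using N[OF w(1)] unfolding transverse_orientation_def by blast
  then obtain d where d: "d > 0" "\<And>z. z \<in> lift \<Gamma> (wall_at x) \<Longrightarrow> dist z (to_hyp x) < d \<Longrightarrow>
      dist (N (wall_at x) z) (N (wall_at x) (to_hyp x)) < norm (unit_normal x)"
    using w(2) ux unfolding continuous_on_iff by (metis zero_less_norm_iff)
  obtain V where V: "open V" "x \<in> V" "\<And>y. y \<in> V \<Longrightarrow> to_hyp y \<in> ball (to_hyp x) d"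
    by (rule to_hyp_neighbourhood[of x "ball (to_hyp x) d"]) (use d x in \<open>auto simp: cone_over_def\<close>)
  show ?thesis
  proof (rule that[of "U \<inter> V"])
    fix y assume y: "y \<in> U \<inter> V"
    show "y \<in> cone_over \<Delta> \<longleftrightarrow> conormal x \<bullet> y = 0" using U y by blast
    assume yD: "y \<in> cone_over \<Delta>"
    have yw: "wall_at y = wall_at x" using U y yD by blast
    have yB: "y \<in> cone_over (\<Delta> - B)" using U(3) y yD cone_over_diff by blast
    obtain U' where U': "open U'" "y \<in> U'" "\<And>z. z \<in> U' \<Longrightarrow> z \<in> cone_over \<Delta> \<longleftrightarrow> conormal y \<bullet> z = 0"
      by (rule wall_chart[OF yB]) blast
    have "\<exists>c. conormal y = c *\<^sub>R conormal x"
    proof (rule parallel_of_local_hyperplane[of "U \<inter> U'" y])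
      show "open (U \<inter> U')" "y \<in> U \<inter> U'" using U U' y by auto
      show "conormal y \<bullet> y = 0" using U'(3)[OF U'(2)] yD by simp
      show "conormal x \<bullet> y = 0" using U(4)[of y] y yD by simp
      fix z assume z: "z \<in> U \<inter> U'" "conormal x \<bullet> z = 0"
      then have "z \<in> cone_over \<Delta>" using U(4)[of z] by simp
      then show "conormal y \<bullet> z = 0" using U'(3)[of z] z by simp
    qed
    then obtain c where "conormal y = c *\<^sub>R conormal x" by blast
    then have c: "unit_normal y = c *\<^sub>R unit_normal x"
      by (metis gram_conormal matrix_vector_mult_scaleR)
    have "c * c = 1"
      using unit_normal_unit[OF yB] unit_normal_unit[OF x]
      by (simp add: c lorentz_scaleR_left lorentz_scaleR_right)
    then have c1: "c = 1 \<or> c = - 1" by (simp add: square_eq_1_iff)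
    have "dist (unit_normal y) (unit_normal x) < norm (unit_normal x)"
      using d(2)[of "to_hyp y"] wall_at_wall(2)[OF yB] V(3)[of y] y
      by (simp add: unit_normal_def yw dist_commute)
    moreover have "dist (- unit_normal x) (unit_normal x) = 2 * norm (unit_normal x)"
    proof -
      have "- unit_normal x - unit_normal x = (- 2) *\<^sub>R unit_normal x" by (simp add: scaleR_2)
      then show ?thesis unfolding dist_norm by simp
    qed
    ultimately have "c \<noteq> - 1" using ux by (auto simp: c)
    then show "wall_at y = wall_at x \<and> unit_normal y = unit_normal x" using c c1 yw by simp
  qed (use U V in auto)
qed

lemma conormal_constant_on_connected:
  assumes "connected \<omega>" "\<omega> \<subseteq> cone_over (\<Delta> - B)" "x \<in> \<omega>" "y \<in> \<omega>"
  shows "conormal x = conormal y"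
proof -
  have "conormal constant_on \<omega>"
  proof (rule locally_constant_imp_constant[OF assms(1)])
    fix a assume a: "a \<in> \<omega>"
    then have aD: "a \<in> cone_over (\<Delta> - B)" using assms(2) by blast
    obtain U where U: "open U" "a \<in> U"
      "\<And>y. y \<in> U \<Longrightarrow> y \<in> cone_over \<Delta> \<Longrightarrow> wall_at y = wall_at a \<and> unit_normal y = unit_normal a"
      by (rule wall_chart_normal[OF aD]) blast
    have "conormal y = conormal a" if "y \<in> \<omega> \<inter> U" for y
    proof -
      have "y \<in> cone_over \<Delta>" using that assms(2) cone_over_diff by blast
      then show ?thesis using U(3)[of y] that by (simp add: conormal_def)
    qed
    then show "\<exists>T. openin (top_of_set \<omega>) T \<and> a \<in> T \<and> (\<forall>x\<in>T. conormal x = conormal a)"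
      using openin_open_Int[OF U(1), of \<omega>] U(2) a by blast
  qed
  then obtain k where "\<And>z. z \<in> \<omega> \<Longrightarrow> conormal z = k" unfolding constant_on_def by blast
  then show ?thesis using assms(3,4) by simp
qed

lemma binding_chart:
  assumes x: "x \<in> cone_over B"
  obtains a b V U where "transverse_pair a b" "subspace V" "V = {y. a \<bullet> y = 0 \<and> b \<bullet> y = 0}"
    "\<And>w. (\<And>v. v \<in> V \<Longrightarrow> w \<bullet> v = 0) \<Longrightarrow> w \<in> span {a, b}"
    "open U" "x \<in> U" "U \<subseteq> future_cone" "\<And>y. y \<in> U \<Longrightarrow> y \<in> cone_over B \<longleftrightarrow> y \<in> V"
proof -
  have xl: "to_hyp x \<in> lift \<Gamma> B" "x \<in> future_cone" using x by (auto simp: cone_over_def)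
  define b where "b = connected_component_of_set (subtopology M B) (orbit \<Gamma> (to_hyp x))"
  have b: "b \<in> bindings" "to_hyp x \<in> lift \<Gamma> b"
    unfolding b_def using component_of_lift[OF \<Delta>_topspace(2) xl(1)] by auto
  obtain U1 where U1: "open U1" "to_hyp x \<in> U1"
      "\<And>y. y \<in> U1 \<Longrightarrow> y \<in> lift \<Gamma> B \<Longrightarrow> y \<in> lift \<Gamma> b"
    by (rule component_isolated[OF finite_bindings b]) blast
  obtain P U2 where P: "P \<in> hyp_planes 2" and U2: "open U2" "to_hyp x \<in> U2" "lift \<Gamma> b \<inter> U2 = P \<inter> U2"
    using bindings_geodesic[OF b(1)] b(2) unfolding totally_geodesic_piece_def by blast
  obtain V where V: "subspace V" "dim V + 2 = CARD('n option)" "P = V \<inter> hyp"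
    using P unfolding hyp_planes_def by blast
  have "dim V + 2 = DIM('n mink)" using V(2) by simp
  then obtain a c where ac: "transverse_pair a c" "V = {y. a \<bullet> y = 0 \<and> c \<bullet> y = 0}"
    "\<And>w. (\<And>v. v \<in> V \<Longrightarrow> w \<bullet> v = 0) \<Longrightarrow> w \<in> span {a, c}"
    by (rule subspace_codim2_equations[OF V(1)]) blast
  obtain U where U: "open U" "x \<in> U" "U \<subseteq> future_cone" "\<And>y. y \<in> U \<Longrightarrow> to_hyp y \<in> U1 \<inter> U2"
    by (rule to_hyp_neighbourhood[of x "U1 \<inter> U2"]) (use U1 U2 xl in \<open>auto simp: open_Int\<close>)
  have sub: "lift \<Gamma> b \<subseteq> lift \<Gamma> B"
    using connected_components_of_subset[OF b(1)] by (auto simp: lift_def)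
  have "y \<in> cone_over B \<longleftrightarrow> y \<in> V" if y: "y \<in> U" for y
  proof -
    have yf: "y \<in> future_cone" "to_hyp y \<in> hyp" using U y to_hyp_in_hyp by auto
    obtain s where s: "to_hyp y = s *\<^sub>R y" "y = (1 / s) *\<^sub>R to_hyp y" by (rule to_hyp_scale[OF yf(1)])
    have "y \<in> cone_over B \<longleftrightarrow> to_hyp y \<in> lift \<Gamma> B" using yf by (simp add: cone_over_def)
    also have "\<dots> \<longleftrightarrow> to_hyp y \<in> lift \<Gamma> b" using U1(3) sub U(4)[OF y] by blast
    also have "\<dots> \<longleftrightarrow> to_hyp y \<in> V" using U2(3) U(4)[OF y] V(3) yf by blast
    also have "\<dots> \<longleftrightarrow> y \<in> V" using s by (metis V(1) subspace_scale)
    finally show ?thesis .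
  qed
  with that[OF ac(1) V(1) ac(2,3) U(1-3)] show ?thesis by blast
qed

text \<open>
  Let \<open>\<omega>\<close> be a lifted wall adjacent to the lifted binding through \<open>x\<close>. Its conormal is constant, so the
  closure of \<open>\<omega>\<close> stays in one hyperplane. This hyperplane contains the binding, hence a neighbourhood of \<open>x\<close>
  in the codimension 2 subspace \<open>V\<close>, hence all of \<open>V\<close>.
\<close>

lemma adjacent_wall_through_binding:
  assumes x: "x \<in> cone_over B" and O: "open O'" "x \<in> O'"
    and V: "subspace V" and U: "open U" "x \<in> U" "U \<subseteq> future_cone" "\<And>y. y \<in> U \<Longrightarrow> y \<in> cone_over B \<longleftrightarrow> y \<in> V"
  shows "\<exists>y\<in>O'. y \<in> cone_over (\<Delta> - B) \<and> (\<forall>v\<in>V. conormal y \<bullet> v = 0)"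
proof -
  have xl: "to_hyp x \<in> lift \<Gamma> B" "x \<in> future_cone" using x by (auto simp: cone_over_def)
  define \<beta> where "\<beta> = connected_component_set (lift \<Gamma> B) (to_hyp x)"
  have "\<beta> \<in> components (lift \<Gamma> B)" using xl by (auto simp: \<beta>_def components_def)
  then obtain \<omega> where \<omega>: "\<omega> \<in> components (lift \<Gamma> (\<Delta> - B))" "\<beta> \<subseteq> closure \<omega>" by (rule adjacent)
  have \<omega>c: "connected \<omega>" "\<omega> \<noteq> {}" "\<omega> \<subseteq> lift \<Gamma> (\<Delta> - B)"
    using \<omega> in_components_connected in_components_nonempty in_components_subset by blast+
  have \<omega>h: "\<omega> \<subseteq> hyp" using \<omega>c(3) by (auto simp: lift_def)
  have \<omega>D: "\<omega> \<subseteq> cone_over (\<Delta> - B)"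
    using \<omega>c(3) \<omega>h hyp_subset_future_cone to_hyp_hyp by (fastforce simp: cone_over_def)
  obtain z0 where z0: "z0 \<in> \<omega>" using \<omega>c by blast
  have nz: "conormal z0 \<bullet> z = 0" if "z \<in> \<omega>" for z
  proof -
    have zD: "z \<in> cone_over (\<Delta> - B)" using that \<omega>D by blast
    obtain W where W: "z \<in> W" "\<And>y. y \<in> W \<Longrightarrow> y \<in> cone_over \<Delta> \<longleftrightarrow> conormal z \<bullet> y = 0"
      by (rule wall_chart[OF zD]) blast
    have "conormal z \<bullet> z = 0" using W zD cone_over_diff by blast
    then show ?thesis using conormal_constant_on_connected[OF \<omega>c(1) \<omega>D z0 that] by simp
  qed
  have "closure \<omega> \<subseteq> {z. conormal z0 \<bullet> z = 0}"
    by (rule closure_minimal) (use nz closed_hyperplane in auto)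
  then have n\<beta>: "conormal z0 \<bullet> z = 0" if "z \<in> \<beta>" for z using \<omega>(2) that by blast
  obtain e where e: "e > 0" "ball x e \<subseteq> U" using U open_contains_ball by metis
  have xV: "x \<in> V" using U x by blast
  have n_ball: "conormal z0 \<bullet> y = 0" if y: "y \<in> V \<inter> ball x e" for y
  proof -
    let ?L = "to_hyp ` (V \<inter> ball x e)"
    have sub: "V \<inter> ball x e \<subseteq> cone_over B" using e U by blast
    have "connected ?L"
    proof (rule connected_continuous_image)
      show "continuous_on (V \<inter> ball x e) to_hyp"
        by (rule continuous_on_subset[OF continuous_on_to_hyp]) (use e U in blast)
      show "connected (V \<inter> ball x e)"
        by (intro convex_connected convex_Int subspace_imp_convex V convex_ball)
    qed
    moreover have "?L \<subseteq> lift \<Gamma> B" using sub by (auto simp: cone_over_def)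
    moreover have "to_hyp x \<in> ?L" using xV e by auto
    ultimately have "?L \<subseteq> \<beta>" unfolding \<beta>_def by (rule connected_component_maximal[rotated 1])
    then have "conormal z0 \<bullet> to_hyp y = 0" using n\<beta> y by blast
    moreover have "y \<in> future_cone" using y e U by blast
    ultimately show ?thesis by (simp add: inner_conormal lorentz_to_hyp_zero)
  qed
  have nV: "conormal z0 \<bullet> v = 0" if v: "v \<in> V" for v
  proof -
    obtain t where t: "t > 0" "x + t *\<^sub>R v \<in> ball x e"
      using open_contains_ray[of "ball x e" x v] e by auto
    have "x + t *\<^sub>R v \<in> V" using V xV v by (simp add: subspace_add subspace_scale)
    then have "conormal z0 \<bullet> (x + t *\<^sub>R v) = 0" using n_ball t by blast
    moreover have "conormal z0 \<bullet> x = 0" using n_ball xV e by simp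
    ultimately show ?thesis using t by (simp add: inner_add_right)
  qed
  \<comment> \<open>A point of \<open>\<omega>\<close> close to \<open>to_hyp x\<close>, rescaled to be close to \<open>x\<close>.\<close>
  obtain s where s: "s > 0" "to_hyp x = s *\<^sub>R x" "x = (1 / s) *\<^sub>R to_hyp x" by (rule to_hyp_scale[OF xl(2)])
  have "to_hyp x \<in> closure \<omega>" using \<omega>(2) xl by (auto simp: \<beta>_def)
  moreover have "open ((\<lambda>z. (1 / s) *\<^sub>R z) -` O')"
    by (rule open_vimage[OF O(1)]) (intro continuous_intros)
  moreover have "to_hyp x \<in> (\<lambda>z. (1 / s) *\<^sub>R z) -` O'" using s O by simp
  ultimately obtain z where z: "z \<in> \<omega>" "(1 / s) *\<^sub>R z \<in> O'"
    by (metis (no_types, lifting) closure_iff_nhds_not_empty disjoint_iff subset_refl vimageE)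
  define y where "y = (1 / s) *\<^sub>R z"
  have th: "to_hyp y = to_hyp z" unfolding y_def using s by (simp add: to_hyp_scaleR)
  have "y \<in> cone_over (\<Delta> - B)"
    using z \<omega>D s th by (auto simp: y_def cone_over_def intro: future_cone_scaleR)
  moreover have "conormal y = conormal z0"
    using th conormal_constant_on_connected[OF \<omega>c(1) \<omega>D z(1) z0]
    by (simp add: conormal_def unit_normal_def wall_at_def)
  ultimately show ?thesis using z(2) nV by (intro bexI[of _ y]) (auto simp: y_def)
qed

lemma wall_system_cone: "wall_system future_cone (cone_over \<Delta>) (cone_over B) conormal"
proof
  show "open (future_cone :: 'n mink set)" by (rule open_future_cone)
  show "convex (future_cone :: 'n mink set)" by (rule convex_future_cone)
  show "cone_over B \<subseteq> cone_over \<Delta>" using B_\<Delta> by (auto simp: cone_over_def lift_def)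
  show "cone_over \<Delta> \<subseteq> future_cone" by (auto simp: cone_over_def)
next
  fix x assume x: "x \<in> off_walls"
  then have "to_hyp x \<in> hyp" "to_hyp x \<notin> lift \<Gamma> \<Delta>" using to_hyp_in_hyp by (auto simp: cone_over_def)
  then obtain U where U: "open U" "to_hyp x \<in> U" "U \<inter> lift \<Gamma> \<Delta> = {}"
    using closed_lift_avoid[OF \<Delta>_closed] by metis
  obtain V where "open V" "x \<in> V" "V \<subseteq> future_cone" "\<And>y. y \<in> V \<Longrightarrow> to_hyp y \<in> U"
    by (rule to_hyp_neighbourhood[of x U]) (use x U in auto)
  then show "\<exists>U. open U \<and> x \<in> U \<and> U \<subseteq> off_walls"
    using U by (intro exI[of _ V]) (auto simp: cone_over_def)
next
  fix x assume "x \<in> cone_over \<Delta> - cone_over B"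
  then have x: "x \<in> cone_over (\<Delta> - B)" by (simp add: cone_over_diff)
  show "conormal x \<noteq> 0" by (rule conormal_nonzero[OF x])
  obtain U where U: "open U" "x \<in> U" "U \<subseteq> future_cone - cone_over B"
    "\<And>y. y \<in> U \<Longrightarrow> y \<in> cone_over \<Delta> \<longleftrightarrow> conormal x \<bullet> y = 0"
    "\<And>y. y \<in> U \<Longrightarrow> y \<in> cone_over \<Delta> \<Longrightarrow> wall_at y = wall_at x \<and> unit_normal y = unit_normal x"
    by (rule wall_chart_normal[OF x]) blast
  show "\<exists>U. open U \<and> x \<in> U \<and> U \<subseteq> future_cone - cone_over B \<and>
      (\<forall>y\<in>U. (y \<in> cone_over \<Delta> \<longleftrightarrow> conormal x \<bullet> y = 0) \<and> (y \<in> cone_over \<Delta> \<longrightarrow> conormal y = conormal x))"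
    by (rule exI[of _ U]) (use U in \<open>auto simp: conormal_def\<close>)
next
  fix x assume x: "x \<in> cone_over B"
  obtain a b V U where ab: "transverse_pair a b" and V: "subspace V" "V = {y. a \<bullet> y = 0 \<and> b \<bullet> y = 0}"
    "\<And>w. (\<And>v. v \<in> V \<Longrightarrow> w \<bullet> v = 0) \<Longrightarrow> w \<in> span {a, b}"
    and U: "open U" "x \<in> U" "U \<subseteq> future_cone" "\<And>y. y \<in> U \<Longrightarrow> y \<in> cone_over B \<longleftrightarrow> y \<in> V"
    by (rule binding_chart[OF x]) blast
  have "\<exists>y\<in>O' \<inter> (cone_over \<Delta> - cone_over B). conormal y \<in> span {a, b}" if O: "open O'" "x \<in> O'" for O'
  proof -
    obtain y where y: "y \<in> O'" "y \<in> cone_over (\<Delta> - B)" "\<And>v. v \<in> V \<Longrightarrow> conormal y \<bullet> v = 0"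
      using adjacent_wall_through_binding[OF x O V(1) U] by blast
    then show ?thesis using V(3)[of "conormal y"] by (auto simp: cone_over_diff)
  qed
  then show "\<exists>a b U. transverse_pair a b \<and> open U \<and> x \<in> U \<and> U \<subseteq> future_cone \<and>
      (\<forall>y\<in>U. y \<in> cone_over B \<longleftrightarrow> a \<bullet> y = 0 \<and> b \<bullet> y = 0) \<and>
      (\<forall>O'. open O' \<longrightarrow> x \<in> O' \<longrightarrow> (\<exists>y\<in>O' \<inter> (cone_over \<Delta> - cone_over B). conormal y \<in> span {a, b}))"
    using ab U V(2) by (intro exI[of _ a] exI[of _ b] exI[of _ U]) simp
qed

end

sublocale bending \<subseteq> wall_system future_cone "cone_over \<Delta>" "cone_over B" conormal
  by (rule wall_system_cone)

context bending begin

section \<open>Bending functions\<close>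

definition wall_jump :: "'n mink set set \<Rightarrow> 'n mink \<Rightarrow> 'n mink_mat" where
  "wall_jump w x = (if wall_at x = w then bend (unit_normal x) else 0)"

definition jump :: "('n mink set set \<Rightarrow> real) \<Rightarrow> 'n mink \<Rightarrow> 'n mink_mat" where
  "jump c x = (\<Sum>w\<in>walls. c w *\<^sub>R wall_jump w x)"

lemma jump_at_wall:
  assumes "x \<in> cone_over (\<Delta> - B)"
  shows "jump c x = c (wall_at x) *\<^sub>R bend (unit_normal x)"
  using wall_at_wall(1)[OF assms] finite_walls
  by (simp add: jump_def wall_jump_def if_distrib[of "\<lambda>t. _ *\<^sub>R t"] sum.delta' cong: if_cong)

lemma wall_jump_locally_const: "locally_const (wall_jump w)"
  unfolding locally_const_def cone_over_diff
proof
  fix x assume x: "x \<in> cone_over (\<Delta> - B)"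
  obtain U where U: "open U" "x \<in> U"
    "\<And>y. y \<in> U \<Longrightarrow> y \<in> cone_over \<Delta> \<Longrightarrow> wall_at y = wall_at x \<and> unit_normal y = unit_normal x"
    by (rule wall_chart_normal[OF x]) blast
  then show "\<exists>U. open U \<and> x \<in> U \<and> (\<forall>y\<in>U \<inter> cone_over \<Delta>. wall_jump w y = wall_jump w x)"
    by (intro exI[of _ U]) (simp add: wall_jump_def)
qed

lemma jump_locally_const: "locally_const (jump c)"
  unfolding locally_const_def cone_over_diff
proof
  fix x assume x: "x \<in> cone_over (\<Delta> - B)"
  obtain U where U: "open U" "x \<in> U"
    "\<And>y. y \<in> U \<Longrightarrow> y \<in> cone_over \<Delta> \<Longrightarrow> wall_at y = wall_at x \<and> unit_normal y = unit_normal x"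
    by (rule wall_chart_normal[OF x]) blast
  then show "\<exists>U. open U \<and> x \<in> U \<and> (\<forall>y\<in>U \<inter> cone_over \<Delta>. jump c y = jump c x)"
    by (intro exI[of _ U]) (simp add: jump_def wall_jump_def cong: if_cong)
qed

lemma future_cone_invariant:
  assumes \<gamma>: "\<gamma> \<in> \<Gamma>"
  shows "\<gamma> *v x \<in> future_cone \<longleftrightarrow> x \<in> future_cone"
proof
  assume "\<gamma> *v x \<in> future_cone"
  then have "matrix_inv \<gamma> *v (\<gamma> *v x) \<in> future_cone"
    by (rule SO_plus_future_cone[OF \<Gamma>_carrier[OF \<Gamma>_inv[OF \<gamma>]]])
  then show "x \<in> future_cone"
    using SO_plus_matrix_inv(1)[OF \<Gamma>_carrier[OF \<gamma>]] by (simp add: matrix_vector_mul_assoc)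
qed (rule SO_plus_future_cone[OF \<Gamma>_carrier[OF \<gamma>]])

lemma to_hyp_\<Gamma>: "\<gamma> \<in> \<Gamma> \<Longrightarrow> to_hyp (\<gamma> *v x) = \<gamma> *v to_hyp x"
  by (rule SO_plus_to_hyp[OF \<Gamma>_carrier])

lemma cone_over_invariant:
  assumes \<gamma>: "\<gamma> \<in> \<Gamma>"
  shows "\<gamma> *v x \<in> cone_over S \<longleftrightarrow> x \<in> cone_over S"
proof -
  have "x \<in> cone_over S \<longleftrightarrow> x \<in> future_cone \<and> orbit \<Gamma> (to_hyp x) \<in> S" for x
    using to_hyp_in_hyp by (auto simp: cone_over_def lift_def)
  then show ?thesis
    by (simp add: future_cone_invariant[OF \<gamma>] to_hyp_\<Gamma>[OF \<gamma>] orbit_invariant[OF \<gamma>])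
qed

lemma wall_at_invariant: "\<gamma> \<in> \<Gamma> \<Longrightarrow> wall_at (\<gamma> *v x) = wall_at x"
  by (simp add: wall_at_def to_hyp_\<Gamma> orbit_invariant)

lemma unit_normal_equivariant:
  assumes \<gamma>: "\<gamma> \<in> \<Gamma>" and x: "x \<in> cone_over (\<Delta> - B)"
  shows "unit_normal (\<gamma> *v x) = \<gamma> *v unit_normal x"
proof -
  have "\<forall>y\<in>lift \<Gamma> (wall_at x). \<forall>\<gamma>\<in>\<Gamma>. N (wall_at x) (\<gamma> *v y) = \<gamma> *v N (wall_at x) y"
    using N[OF wall_at_wall(1)[OF x]] by (simp add: transverse_orientation_def)
  then show ?thesis
    using wall_at_wall(2)[OF x] \<gamma> by (simp add: unit_normal_def wall_at_invariant to_hyp_\<Gamma>)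
qed

text \<open>
  Here the \<open>\<Gamma>\<close>-equivariance of the transverse orientations enters.
\<close>

lemma jump_equivariant:
  assumes \<gamma>: "\<gamma> \<in> \<Gamma>" and x: "x \<in> cone_over (\<Delta> - B)"
  shows "jump c (\<gamma> *v x) = Ad \<gamma> (jump c x)"
proof -
  have x': "\<gamma> *v x \<in> cone_over (\<Delta> - B)" using x by (simp add: cone_over_invariant[OF \<gamma>])
  show ?thesis
    unfolding jump_at_wall[OF x'] jump_at_wall[OF x] wall_at_invariant[OF \<gamma>]
      unit_normal_equivariant[OF \<gamma> x] bend_equivariant[OF \<Gamma>_carrier[OF \<gamma>]]
    by (simp add: linear_cmul[OF linear_Ad])
qed

lemma good_\<Gamma>_transport:
  assumes \<gamma>: "\<gamma> \<in> \<Gamma>" and f: "good (jump c) W f"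
  shows "good (jump c) ((*v) (matrix_inv \<gamma>) -` W) (\<lambda>y. Ad \<gamma> (f (matrix_inv \<gamma> *v y)))"
proof (rule good_transport[OF f, where T = "(*v) \<gamma>"])
  note inv = SO_plus_matrix_inv[OF \<Gamma>_carrier[OF \<gamma>]]
  show "continuous_on UNIV ((*v) (matrix_inv \<gamma>))"
    by (rule linear_continuous_on) (simp add: linear_conv_bounded_linear[symmetric])
  show "\<gamma> *v (matrix_inv \<gamma> *v y) = y" for y
    using inv(2) by (simp add: matrix_vector_mul_assoc)
  show "linear (Ad \<gamma>)" by (rule linear_Ad)
  fix x y
  show "(\<gamma> *v x \<in> cone_over \<Delta>) = (x \<in> cone_over \<Delta>)" "(\<gamma> *v x \<in> cone_over B) = (x \<in> cone_over B)"
    by (rule cone_over_invariant[OF \<gamma>])+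
  assume "x \<in> cone_over \<Delta> - cone_over B"
  then have x: "x \<in> cone_over (\<Delta> - B)" by (simp add: cone_over_diff)
  show "jump c (\<gamma> *v x) = Ad \<gamma> (jump c x)" by (rule jump_equivariant[OF \<gamma> x])
  have "lorentz y (\<gamma> *v unit_normal x) = lorentz (\<gamma> *v (matrix_inv \<gamma> *v y)) (\<gamma> *v unit_normal x)"
    using inv(2) by (simp add: matrix_vector_mul_assoc)
  also have "\<dots> = lorentz (matrix_inv \<gamma> *v y) (unit_normal x)"
    by (rule lorentz_isometry[OF \<Gamma>_carrier[OF \<gamma>]])
  finally show "(conormal (\<gamma> *v x) \<bullet> y > 0) = (conormal x \<bullet> (matrix_inv \<gamma> *v y) > 0)"
    by (simp add: inner_conormal unit_normal_equivariant[OF \<gamma> x])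
qed

lemma locally_good_\<Gamma>:
  assumes \<gamma>: "\<gamma> \<in> \<Gamma>" and x: "locally_good (jump c) x"
  shows "locally_good (jump c) (\<gamma> *v x)"
proof -
  obtain U f where U: "open U" "x \<in> U" "good (jump c) U f"
    using x unfolding locally_good_def by blast
  have "continuous_on UNIV ((*v) (matrix_inv \<gamma>))"
    by (rule linear_continuous_on) (simp add: linear_conv_bounded_linear[symmetric])
  then have "open ((*v) (matrix_inv \<gamma>) -` U)" using U(1) by (simp add: continuous_on_open_vimage)
  moreover have "\<gamma> *v x \<in> (*v) (matrix_inv \<gamma>) -` U"
    using SO_plus_matrix_inv(1)[OF \<Gamma>_carrier[OF \<gamma>]] U(2) by (simp add: matrix_vector_mul_assoc)
  ultimately show ?thesis
    unfolding locally_good_def using good_\<Gamma>_transport[OF \<gamma> U(3)] by blast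
qed

lemma cone_over_scale: "s > 0 \<Longrightarrow> s *\<^sub>R x \<in> cone_over S \<longleftrightarrow> x \<in> cone_over S"
proof -
  assume s: "s > 0"
  have "s *\<^sub>R x \<in> future_cone \<longleftrightarrow> x \<in> future_cone"
    using future_cone_scaleR[of x s] future_cone_scaleR[of "s *\<^sub>R x" "1 / s"] s by auto
  then show ?thesis by (simp add: cone_over_def to_hyp_scaleR[OF s])
qed

lemma locally_good_scale:
  assumes s: "s > 0" and x: "locally_good (jump c) x"
  shows "locally_good (jump c) (s *\<^sub>R x)"
proof -
  obtain U f where U: "open U" "x \<in> U" "good (jump c) U f"
    using x unfolding locally_good_def by blast
  have cont: "continuous_on UNIV (\<lambda>y :: 'n mink. (1 / s) *\<^sub>R y)" by (intro continuous_intros)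
  have "good (jump c) ((\<lambda>y. (1 / s) *\<^sub>R y) -` U) (\<lambda>y. f ((1 / s) *\<^sub>R y))"
  proof (rule good_transport[OF U(3) cont, where T = "\<lambda>y. s *\<^sub>R y" and L = "\<lambda>X. X"])
    fix x y :: "'n mink"
    show "(s *\<^sub>R x \<in> cone_over \<Delta>) = (x \<in> cone_over \<Delta>)" "(s *\<^sub>R x \<in> cone_over B) = (x \<in> cone_over B)"
      by (rule cone_over_scale[OF s])+
    have eq: "wall_at (s *\<^sub>R x) = wall_at x" "unit_normal (s *\<^sub>R x) = unit_normal x"
      by (simp_all add: wall_at_def unit_normal_def to_hyp_scaleR[OF s])
    show "jump c (s *\<^sub>R x) = jump c x" by (simp add: jump_def wall_jump_def eq cong: if_cong)
    show "(conormal (s *\<^sub>R x) \<bullet> y > 0) = (conormal x \<bullet> ((1 / s) *\<^sub>R y) > 0)"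
      using s by (simp add: conormal_def eq zero_less_divide_iff)
    show "linear (\<lambda>X :: 'n mink_mat. X)" by (rule linear_ident)
  qed (use s in auto)
  moreover have "open ((\<lambda>y. (1 / s) *\<^sub>R y) -` U)" using cont U(1) by (simp add: continuous_on_open_vimage)
  ultimately show ?thesis
    unfolding locally_good_def using U(2) s by (intro exI[of _ "(\<lambda>y. (1 / s) *\<^sub>R y) -` U"] exI) auto
qed

lemma lift_B_cone: "x \<in> hyp \<Longrightarrow> x \<in> cone_over B \<longleftrightarrow> x \<in> lift \<Gamma> B"
  using hyp_subset_future_cone by (auto simp: cone_over_def to_hyp_hyp)

text \<open>
  The points of the lifted bindings near which the jump problem is solvable form a set that is open,
  closed, and invariant under \<open>\<Gamma>\<close>. Its image in the quotient is clopen in \<open>B\<close>, so it contains every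
  binding that it meets.
\<close>

lemma locally_good_spreads:
  assumes loc: "\<And>b. b \<in> bindings \<Longrightarrow> \<exists>x\<in>lift \<Gamma> b. locally_good (jump c) x"
    and x: "x \<in> cone_over B"
  shows "locally_good (jump c) x"
proof -
  define G where "G = {y \<in> lift \<Gamma> B. locally_good (jump c) y}"
  have lh: "lift \<Gamma> S \<subseteq> hyp" for S by (auto simp: lift_def)
  have G_inv: "y \<in> G" if y: "y \<in> hyp" "orbit \<Gamma> y = orbit \<Gamma> z" "z \<in> G" for y z
  proof -
    have "y \<in> orbit \<Gamma> y" using \<Gamma>_one by (auto simp: orbit_def intro: image_eqI[of _ _ "mat 1"])
    then obtain \<gamma> where \<gamma>: "\<gamma> \<in> \<Gamma>" "y = \<gamma> *v z" using y(2) by (auto simp: orbit_def)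
    have "locally_good (jump c) y" unfolding \<gamma>(2) by (rule locally_good_\<Gamma>[OF \<gamma>(1)]) (use y(3) in \<open>simp add: G_def\<close>)
    moreover have "y \<in> lift \<Gamma> B" using y by (auto simp: lift_def G_def)
    ultimately show ?thesis by (simp add: G_def)
  qed
  have lift_image: "lift \<Gamma> (orbit \<Gamma> ` G) = G"
  proof (intro equalityI subsetI)
    fix y assume "y \<in> lift \<Gamma> (orbit \<Gamma> ` G)"
    then obtain z where "y \<in> hyp" "orbit \<Gamma> y = orbit \<Gamma> z" "z \<in> G" by (auto simp: lift_def)
    then show "y \<in> G" by (rule G_inv)
  next
    fix y assume "y \<in> G"
    then show "y \<in> lift \<Gamma> (orbit \<Gamma> ` G)" by (simp add: lift_def G_def)
  qed
  have lift_image': "lift \<Gamma> (B - orbit \<Gamma> ` G) = lift \<Gamma> B - G"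
  proof -
    have "lift \<Gamma> (B - orbit \<Gamma> ` G) = lift \<Gamma> B - lift \<Gamma> (orbit \<Gamma> ` G)" unfolding lift_def by blast
    then show ?thesis by (simp only: lift_image)
  qed
  have closure_B: "y \<in> lift \<Gamma> B" if "y \<in> hyp" "y \<in> closure A" "A \<subseteq> lift \<Gamma> B" for y A
  proof -
    obtain K where K: "closed K" "lift \<Gamma> B = hyp \<inter> K"
      using closed_lift[OF B_closed] by (auto simp: closedin_closed)
    have "closure A \<subseteq> K" by (rule closure_minimal) (use that K in auto)
    then show ?thesis using that K by blast
  qed
  have closedin_from_closure: "closedin (top_of_set hyp) A"
    if "A \<subseteq> hyp" "\<And>y. y \<in> hyp \<Longrightarrow> y \<in> closure A \<Longrightarrow> y \<in> A" for A :: "'n mink set"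
  proof -
    have "A = hyp \<inter> closure A" using that closure_subset by blast
    then show ?thesis by (metis closed_closure closedin_closed_Int)
  qed
  have closed_G: "closedin (top_of_set hyp) G"
  proof (rule closedin_from_closure)
    show "G \<subseteq> hyp" using lh by (auto simp: G_def)
    fix y assume y: "y \<in> hyp" "y \<in> closure G"
    have yB: "y \<in> lift \<Gamma> B" by (rule closure_B[OF y]) (auto simp: G_def)
    have sub: "G \<subseteq> {z \<in> cone_over B. \<exists>U f. open U \<and> z \<in> U \<and> good (jump c) U f}"
      using lh lift_B_cone by (auto simp: G_def locally_good_def)
    have "\<exists>U f. open U \<and> y \<in> U \<and> good (jump c) U f"
    proof (rule good_locus_closed[OF jump_locally_const])
      show "y \<in> cone_over B" using yB y lift_B_cone by blast
      show "y \<in> closure {z \<in> cone_over B. \<exists>U f. open U \<and> z \<in> U \<and> good (jump c) U f}"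
        using closure_mono[OF sub] y(2) by blast
    qed
    then show "y \<in> G" using yB by (simp add: G_def locally_good_def)
  qed
  have closed_G': "closedin (top_of_set hyp) (lift \<Gamma> B - G)"
  proof (rule closedin_from_closure)
    show "lift \<Gamma> B - G \<subseteq> hyp" using lh by blast
    fix y assume y: "y \<in> hyp" "y \<in> closure (lift \<Gamma> B - G)"
    have yB: "y \<in> lift \<Gamma> B" by (rule closure_B[OF y]) auto
    have "y \<notin> G"
    proof
      assume "y \<in> G"
      then obtain U f where U: "open U" "y \<in> U" "good (jump c) U f"
        by (auto simp: G_def locally_good_def)
      then have "U \<inter> (lift \<Gamma> B - G) \<noteq> {}" using y(2) unfolding closure_iff_nhds_not_empty by blast
      then obtain z where "z \<in> U" "z \<in> lift \<Gamma> B" "z \<notin> G" by blast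
      then show False using U by (auto simp: G_def locally_good_def)
    qed
    then show "y \<in> lift \<Gamma> B - G" using yB by blast
  qed
  have closedin_of_lift: "closedin M S"
    if "S \<subseteq> B" "closedin (top_of_set hyp) (lift \<Gamma> S)" for S
  proof -
    have "\<forall>U. U \<subseteq> topspace M \<longrightarrow>
        closedin (top_of_set hyp) {x \<in> topspace (top_of_set hyp). orbit \<Gamma> x \<in> U} = closedin M U"
      using quotient_map_orbit[of \<Gamma>] unfolding quotient_map_closedin by (rule conjunct2)
    moreover have "S \<subseteq> topspace M" using that(1) \<Delta>_topspace(2) by blast
    ultimately show ?thesis using that(2) by (simp add: lift_def)
  qed
  have GB: "orbit \<Gamma> ` G \<subseteq> B" by (auto simp: G_def lift_def)
  have closed: "closedin M (orbit \<Gamma> ` G)"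
    by (rule closedin_of_lift[OF GB]) (simp add: lift_image closed_G)
  have closed': "closedin M (B - orbit \<Gamma> ` G)"
    by (rule closedin_of_lift) (auto simp: lift_image' closed_G')
  have xl: "to_hyp x \<in> lift \<Gamma> B" "x \<in> future_cone" using x by (auto simp: cone_over_def)
  define b where "b = connected_component_of_set (subtopology M B) (orbit \<Gamma> (to_hyp x))"
  have b: "b \<in> bindings" "to_hyp x \<in> lift \<Gamma> b"
    unfolding b_def using component_of_lift[OF \<Delta>_topspace(2) xl(1)] by auto
  have "connectedin (subtopology M B) b"
    by (rule connectedin_connected_components_of[OF b(1)])
  then have con: "connectedin M b" "b \<subseteq> B" by (auto simp: connectedin_subtopology)
  obtain z where z: "z \<in> lift \<Gamma> b" "locally_good (jump c) z" using loc[OF b(1)] by blast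
  then have zG: "z \<in> G" using con(2) by (auto simp: G_def lift_def)
  have zb: "orbit \<Gamma> z \<in> b" using z by (simp add: lift_def)
  have "(B - orbit \<Gamma> ` G) \<inter> b = {}"
  proof (rule ccontr)
    assume "(B - orbit \<Gamma> ` G) \<inter> b \<noteq> {}"
    moreover have "orbit \<Gamma> ` G \<inter> b \<noteq> {}" using zG zb by blast
    moreover have "b \<subseteq> orbit \<Gamma> ` G \<union> (B - orbit \<Gamma> ` G)" using con(2) by blast
    moreover have "orbit \<Gamma> ` G \<inter> (B - orbit \<Gamma> ` G) \<inter> b = {}" by blast
    ultimately show False using con(1) closed closed' unfolding connectedin_closedin by blast
  qed
  then have "orbit \<Gamma> (to_hyp x) \<in> orbit \<Gamma> ` G" using b(2) con(2) by (auto simp: lift_def)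
  then have "to_hyp x \<in> lift \<Gamma> (orbit \<Gamma> ` G)" using to_hyp_in_hyp[OF xl(2)] by (simp add: lift_def)
  then have "locally_good (jump c) (to_hyp x)" unfolding lift_image by (simp add: G_def)
  moreover obtain s where "s > 0" "x = (1 / s) *\<^sub>R to_hyp x" by (rule to_hyp_scale[OF xl(2)])
  ultimately show ?thesis using locally_good_scale[of "1 / s" c "to_hyp x"] by simp
qed

lemma bend_span:
  assumes "v \<in> span {a, b}"
  shows "bend (gram *v v) \<in> span {bend (gram *v a), bend (gram *v b), bend (gram *v a + gram *v b)}"
proof -
  obtain s where "v - s *\<^sub>R a \<in> span {b}" using assms by (auto simp: span_breakdown_eq)
  then obtain t where "v - s *\<^sub>R a = t *\<^sub>R b" by (auto simp: span_singleton)
  then have "v = s *\<^sub>R a + t *\<^sub>R b" by (simp add: algebra_simps)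
  then have v: "gram *v v = s *\<^sub>R (gram *v a) + t *\<^sub>R (gram *v b)"
    by (simp add: matrix_vector_right_distrib matrix_vector_mult_scaleR)
  show ?thesis
    unfolding v bend_quadratic by (intro span_add span_scale span_base) auto
qed

text \<open>
  The three equations are the coordinates of the total jump around \<open>x\<close> with respect to \<open>e1\<close>, \<open>e2\<close>, \<open>e3\<close>,
  which span the values of \<open>bend\<close> on the normal plane of the binding.
\<close>

lemma binding_equations:
  assumes b: "b \<in> bindings"
  shows "\<exists>x\<in>lift \<Gamma> b. \<exists>A :: nat \<Rightarrow> 'n mink set set \<Rightarrow> real.
     \<forall>c. (\<forall>k<3. (\<Sum>w\<in>walls. c w * A k w) = 0) \<longrightarrow> locally_good (jump c) x"
proof -
  obtain q where q: "q \<in> b" using nonempty_connected_components_of[OF b] by blast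
  have bB: "b \<subseteq> topspace M \<inter> B"
    using connected_components_of_subset[OF b] by simp
  then obtain x where x: "x \<in> hyp" "orbit \<Gamma> x = q" using q topspace_quotient by auto
  have xb: "x \<in> lift \<Gamma> b" using x q by (simp add: lift_def)
  have xB: "x \<in> cone_over B" using x q bB lift_B_cone[OF x(1)] by (auto simp: lift_def)
  obtain u v where uv: "transverse_pair u v"
    "\<And>S J I. \<lbrakk>subspace S; finite I; \<And>i. i \<in> I \<Longrightarrow> locally_const (J i);
       \<And>i y. i \<in> I \<Longrightarrow> y \<in> cone_over \<Delta> - cone_over B \<Longrightarrow> conormal y \<in> span {u, v} \<Longrightarrow> J i y \<in> S\<rbrakk> \<Longrightarrow>
      \<exists>m. (\<forall>i\<in>I. m i \<in> S) \<and> (\<forall>c. (\<Sum>i\<in>I. c i *\<^sub>R m i) = 0 \<longrightarrow>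
        (\<exists>U f. open U \<and> x \<in> U \<and> good (\<lambda>y. \<Sum>i\<in>(I :: 'n mink set set set). c i *\<^sub>R (J i y :: 'n mink_mat)) U f))"
    by (rule binding_obstruction[OF xB]) blast
  define e1 e2 e3 where "e1 = bend (gram *v u)" and "e2 = bend (gram *v v)" and "e3 = bend (gram *v u + gram *v v)"
  have "\<exists>m. (\<forall>w\<in>walls. m w \<in> span {e1, e2, e3}) \<and> (\<forall>c. (\<Sum>w\<in>walls. c w *\<^sub>R m w) = 0 \<longrightarrow>
        (\<exists>U f. open U \<and> x \<in> U \<and> good (\<lambda>y. \<Sum>w\<in>walls. c w *\<^sub>R wall_jump w y) U f))"
  proof (rule uv(2)[OF subspace_span finite_walls wall_jump_locally_const])
    fix w y assume "conormal y \<in> span {u, v}"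
    then have "bend (unit_normal y) \<in> span {e1, e2, e3}"
      using bend_span[of "conormal y" u v] by (simp add: gram_conormal e1_def e2_def e3_def)
    then show "wall_jump w y \<in> span {e1, e2, e3}" by (simp add: wall_jump_def span_zero)
  qed
  then obtain m where m: "\<And>w. w \<in> walls \<Longrightarrow> m w \<in> span {e1, e2, e3}"
    "\<And>c. (\<Sum>w\<in>walls. c w *\<^sub>R m w) = 0 \<Longrightarrow> locally_good (jump c) x"
    unfolding locally_good_def jump_def[abs_def] by blast
  have "\<exists>r1 r2 r3. m w = r1 *\<^sub>R e1 + r2 *\<^sub>R e2 + r3 *\<^sub>R e3" if w: "w \<in> walls" for w
  proof -
    obtain r1 where "m w - r1 *\<^sub>R e1 \<in> span {e2, e3}" using m(1)[OF w] by (auto simp: span_breakdown_eq[of _ e1])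
    then obtain r2 where "m w - r1 *\<^sub>R e1 - r2 *\<^sub>R e2 \<in> span {e3}" by (auto simp: span_breakdown_eq[of _ e2])
    then obtain r3 where "m w - r1 *\<^sub>R e1 - r2 *\<^sub>R e2 = r3 *\<^sub>R e3" by (auto simp: span_singleton)
    then have "m w = r1 *\<^sub>R e1 + r2 *\<^sub>R e2 + r3 *\<^sub>R e3" by (simp add: algebra_simps)
    then show ?thesis by blast
  qed
  then obtain r1 r2 r3 where r: "\<And>w. w \<in> walls \<Longrightarrow> m w = r1 w *\<^sub>R e1 + r2 w *\<^sub>R e2 + r3 w *\<^sub>R e3"
    by metis
  define A where "A k = [r1, r2, r3] ! k" for k :: nat
  have "locally_good (jump c) x" if c: "\<forall>k<3. (\<Sum>w\<in>walls. c w * A k w) = 0" for c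
  proof (rule m(2))
    have "(\<Sum>w\<in>walls. c w *\<^sub>R m w) =
        (\<Sum>w\<in>walls. c w * r1 w) *\<^sub>R e1 + (\<Sum>w\<in>walls. c w * r2 w) *\<^sub>R e2 + (\<Sum>w\<in>walls. c w * r3 w) *\<^sub>R e3"
      by (simp add: r scaleR_sum_left sum.distrib[symmetric] scaleR_add_right)
    moreover have "(\<Sum>w\<in>walls. c w * r1 w) = 0" using c[rule_format, of 0] by (simp add: A_def)
    moreover have "(\<Sum>w\<in>walls. c w * r2 w) = 0" using c[rule_format, of 1] by (simp add: A_def)
    moreover have "(\<Sum>w\<in>walls. c w * r3 w) = 0" using c[rule_format, of 2] by (simp add: A_def)
    ultimately show "(\<Sum>w\<in>walls. c w *\<^sub>R m w) = 0" by simp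
  qed
  then show ?thesis using xb by blast
qed

definition base :: "'n mink" where
  "base = (SOME y. y \<in> off_walls)"

lemma base: "base \<in> off_walls"
  unfolding base_def
  using complement_dense[OF time_axis_in_future_cone open_future_cone time_axis_in_future_cone]
  by (rule someI_ex)

definition bending_function :: "('n mink set set \<Rightarrow> real) \<Rightarrow> ('n mink \<Rightarrow> 'n mink_mat) \<Rightarrow> bool" where
  "bending_function c f \<longleftrightarrow> good (jump c) future_cone f \<and> f base = 0 \<and>
     (\<forall>y\<in>off_walls. f y \<in> nu) \<and>
     (\<forall>\<gamma>\<in>\<Gamma>. \<forall>y\<in>off_walls. f (\<gamma> *v y) = Ad \<gamma> (f y) + f (\<gamma> *v base))"

text \<open>
  Transporting a solution by \<open>\<gamma>\<close> gives another solution of the same jump problem, so the two differ by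
  a constant; this is the equivariance up to translation.
\<close>

lemma bending_function_exists:
  assumes loc: "\<And>x. x \<in> cone_over B \<Longrightarrow> locally_good (jump c) x"
  shows "\<exists>f. bending_function c f"
proof -
  have "\<exists>f. good (jump c) future_cone f"
  proof (rule good_global[OF open_future_cone convex_future_cone subset_refl])
    fix x :: "'n mink" assume x: "x \<in> future_cone"
    show "\<exists>U f. open U \<and> x \<in> U \<and> good (jump c) U f"
    proof (cases "x \<in> cone_over B")
      case True then show ?thesis using loc unfolding locally_good_def by blast
    next
      case False then show ?thesis using x by (intro good_exists_off_bindings jump_locally_const) blast
    qed
  qed
  then obtain f0 where f0: "good (jump c) future_cone f0" by blast
  define f where "f y = f0 y + (- f0 base)" for y
  have f: "good (jump c) future_cone f" unfolding f_def by (rule good_shift[OF f0])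
  have f_base: "f base = 0" by (simp add: f_def)
  have conn: "connected (future_cone :: 'n mink set)" by (intro convex_connected convex_future_cone)
  have "f y \<in> nu" if y: "y \<in> off_walls" for y
  proof -
    have "f y - f base \<in> nu"
    proof (rule good_constant_mod[OF f conn open_future_cone subset_refl subspace_nu _ y base])
      fix x assume "x \<in> cone_over \<Delta> - cone_over B"
      then have "x \<in> cone_over (\<Delta> - B)" by (simp add: cone_over_diff)
      then show "jump c x \<in> nu"
        by (simp add: jump_at_wall subspace_scale[OF subspace_nu] bend_in_nu)
    qed
    then show ?thesis by (simp add: f_base)
  qed
  moreover have "f (\<gamma> *v y) = Ad \<gamma> (f y) + f (\<gamma> *v base)" if \<gamma>: "\<gamma> \<in> \<Gamma>" and y: "y \<in> off_walls" for \<gamma> y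
  proof -
    define g where "g z = Ad \<gamma> (f (matrix_inv \<gamma> *v z))" for z
    have "(*v) (matrix_inv \<gamma>) -` future_cone = future_cone"
      using future_cone_invariant[OF \<Gamma>_inv[OF \<gamma>]] by auto
    then have g: "good (jump c) future_cone g"
      using good_\<Gamma>_transport[OF \<gamma> f] by (simp add: g_def[abs_def])
    have inC: "\<gamma> *v z \<in> off_walls" if "z \<in> off_walls" for z
      using that by (simp add: future_cone_invariant[OF \<gamma>] cone_over_invariant[OF \<gamma>])
    have gz: "g (\<gamma> *v z) = Ad \<gamma> (f z)" for z
      using SO_plus_matrix_inv(1)[OF \<Gamma>_carrier[OF \<gamma>]] by (simp add: g_def matrix_vector_mul_assoc)
    have "f (\<gamma> *v y) - g (\<gamma> *v y) = f (\<gamma> *v base) - g (\<gamma> *v base)"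
      by (rule good_unique[OF f g conn open_future_cone subset_refl inC[OF y] inC[OF base]])
    then show ?thesis unfolding gz f_base by (simp add: linear_0[OF linear_Ad] algebra_simps)
  qed
  ultimately have "bending_function c f" using f f_base by (simp add: bending_function_def)
  then show ?thesis by blast
qed

lemma bending_functions_exist:
  "\<exists>F c f. F \<subseteq> walls \<and> card walls \<le> card F + 3 * card bindings \<and>
     (\<forall>j\<in>F. bending_function (c j) (f j)) \<and> (\<forall>j\<in>F. \<forall>i\<in>F. c j i = (if i = j then 1 else 0))"
proof -
  define P where "P b A \<longleftrightarrow> (\<forall>c. (\<forall>k<3. (\<Sum>w\<in>walls. c w * A k w) = 0) \<longrightarrow>
      (\<exists>x\<in>lift \<Gamma> b. locally_good (jump c) x))" for b and A :: "nat \<Rightarrow> 'n mink set set \<Rightarrow> real"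
  have "\<forall>b\<in>bindings. \<exists>A. P b A"
  proof
    fix b assume "b \<in> bindings"
    from binding_equations[OF this] show "\<exists>A. P b A" unfolding P_def by blast
  qed
  from bchoice[OF this] obtain A where A: "\<forall>b\<in>bindings. P b (A b)" by blast
  define E where "E = bindings \<times> {..<3::nat}"
  have "finite E" unfolding E_def using finite_bindings by simp
  from free_solutions[OF this finite_walls, of "\<lambda>e. A (fst e) (snd e)"]
  obtain F c where F: "F \<subseteq> walls" "card walls \<le> card F + card E"
    and sol: "\<forall>j\<in>F. \<forall>e\<in>E. (\<Sum>w\<in>walls. c j w * A (fst e) (snd e) w) = 0"
    and dual: "\<forall>j\<in>F. \<forall>i\<in>F. c j i = (if i = j then 1 else 0)" by blast
  have "\<exists>f. bending_function (c j) f" if j: "j \<in> F" for j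
  proof (rule bending_function_exists, rule locally_good_spreads)
    fix b assume b: "b \<in> bindings"
    have "(\<Sum>w\<in>walls. c j w * A b k w) = 0" if "k < 3" for k
      using bspec[OF bspec[OF sol j], of "(b, k)"] b that by (simp add: E_def)
    then show "\<exists>x\<in>lift \<Gamma> b. locally_good (jump (c j)) x"
      using bspec[OF A b] unfolding P_def by blast
  qed
  then have "\<forall>j\<in>F. \<exists>f. bending_function (c j) f" by blast
  from bchoice[OF this] obtain f where "\<forall>j\<in>F. bending_function (c j) (f j)" by blast
  moreover have "card E = 3 * card bindings" by (simp add: E_def card_cartesian_product)
  ultimately show ?thesis using F dual by (intro exI[of _ F] exI[of _ c] exI[of _ f]) simp
qed

end

section \<open>Bending cocycles\<close>

lemma coboundaries_combination:
  assumes I: "finite I" and z: "\<And>i. i \<in> I \<Longrightarrow> z i \<in> coboundaries \<Gamma> nu"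
  shows "(\<lambda>\<gamma>. \<Sum>i\<in>I. c i *\<^sub>R z i \<gamma>) \<in> coboundaries \<Gamma> nu"
proof -
  have "\<forall>i\<in>I. \<exists>X. X \<in> nu \<and> z i = (\<lambda>\<gamma>. if \<gamma> \<in> \<Gamma> then Ad \<gamma> X - X else 0)"
    using z unfolding coboundaries_def by blast
  from bchoice[OF this] obtain X where X: "\<And>i. i \<in> I \<Longrightarrow> X i \<in> nu"
    "\<And>i. i \<in> I \<Longrightarrow> z i = (\<lambda>\<gamma>. if \<gamma> \<in> \<Gamma> then Ad \<gamma> (X i) - X i else 0)" by blast
  define Y where "Y = (\<Sum>i\<in>I. c i *\<^sub>R X i)"
  have "Y \<in> nu" unfolding Y_def by (intro subspace_sum subspace_scale subspace_nu X(1))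
  moreover have "(\<lambda>\<gamma>. \<Sum>i\<in>I. c i *\<^sub>R z i \<gamma>) = (\<lambda>\<gamma>. if \<gamma> \<in> \<Gamma> then Ad \<gamma> Y - Y else 0)"
  proof
    fix \<gamma>
    have "Ad \<gamma> Y = (\<Sum>i\<in>I. c i *\<^sub>R Ad \<gamma> (X i))"
      by (simp add: Y_def linear_sum[OF linear_Ad] linear_cmul[OF linear_Ad])
    then show "(\<Sum>i\<in>I. c i *\<^sub>R z i \<gamma>) = (if \<gamma> \<in> \<Gamma> then Ad \<gamma> Y - Y else 0)"
      by (simp add: X(2) Y_def sum_subtractf[symmetric] scaleR_diff_right)
  qed
  ultimately show ?thesis unfolding coboundaries_def by blast
qed

text \<open>
  The classes of a family of cocycles that is independent modulo coboundaries are distinct, and their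
  independence does not depend on the representatives, which change combinations by coboundaries only.
\<close>

lemma independent_family_dim_H1:
  fixes \<Gamma> :: "'n::finite mink_mat set"
  assumes F: "finite F" and z: "\<And>j. j \<in> F \<Longrightarrow> z j \<in> cocycles \<Gamma> nu"
    and indep: "\<And>a. (\<lambda>\<gamma>. \<Sum>j\<in>F. a j *\<^sub>R z j \<gamma>) \<in> coboundaries \<Gamma> nu \<Longrightarrow> \<forall>j\<in>F. a j = 0"
  shows "enat (card F) \<le> dim_H1 \<Gamma> nu"
proof -
  define R where "R = {(z, z'). z \<in> cocycles \<Gamma> nu \<and> z' \<in> cocycles \<Gamma> nu \<and> (\<lambda>\<gamma>. z' \<gamma> - z \<gamma>) \<in> coboundaries \<Gamma> nu}"
  define h where "h j = R `` {z j}" for j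
  have zero: "(\<lambda>\<gamma>. 0) \<in> coboundaries \<Gamma> nu"
    using coboundaries_combination[of "{}"] by simp
  have self: "z j \<in> h j" if "j \<in> F" for j
    using z[OF that] zero by (simp add: h_def R_def)
  have member: "(\<lambda>\<gamma>. s \<gamma> - z j \<gamma>) \<in> coboundaries \<Gamma> nu" if "s \<in> h j" for s j
    using that by (simp add: h_def R_def)
  have inj: "inj_on h F"
  proof (rule inj_onI, rule ccontr)
    fix j k assume jk: "j \<in> F" "k \<in> F" "h j = h k" "j \<noteq> k"
    define a where "a i = (if i = j then 1 else if i = k then - 1 else 0 :: real)" for i
    have "(\<Sum>i\<in>F. a i *\<^sub>R z i \<gamma>) = z j \<gamma> - z k \<gamma>" for \<gamma>
    proof -
      have "(\<Sum>i\<in>F. a i *\<^sub>R z i \<gamma>) = (\<Sum>i\<in>{j, k}. a i *\<^sub>R z i \<gamma>)"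
        by (rule sum.mono_neutral_right[OF F]) (use jk in \<open>auto simp: a_def\<close>)
      then show ?thesis using jk(4) by (simp add: a_def)
    qed
    moreover have "(\<lambda>\<gamma>. z j \<gamma> - z k \<gamma>) \<in> coboundaries \<Gamma> nu"
      using member[of "z j" k] self[OF jk(1)] jk(3) by simp
    ultimately have "\<forall>i\<in>F. a i = 0" by (intro indep) simp
    then have "a j = 0" using jk(1) by blast
    then show False by (simp add: a_def)
  qed
  have "H1_independent \<Gamma> nu (h ` F)"
    unfolding H1_independent_def
  proof (intro conjI allI impI)
    show "finite (h ` F)" using F by simp
    show "h ` F \<subseteq> H1 \<Gamma> nu"
      unfolding H1_def R_def[symmetric] using z by (auto simp: h_def quotient_def)
    fix s :: "('n mink_mat \<Rightarrow> 'n mink_mat) set \<Rightarrow> 'n mink_mat \<Rightarrow> 'n mink_mat"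
      and c :: "('n mink_mat \<Rightarrow> 'n mink_mat) set \<Rightarrow> real"
    assume s: "\<forall>h\<in>h ` F. s h \<in> h" and cob: "(\<lambda>\<gamma>. \<Sum>h\<in>h ` F. c h *\<^sub>R s h \<gamma>) \<in> coboundaries \<Gamma> nu"
    \<comment> \<open>The given combination and the differences between representatives, as one family of coboundaries.\<close>
  define t where "t k = (case k of None \<Rightarrow> (\<lambda>\<gamma>. \<Sum>h\<in>h ` F. c h *\<^sub>R s h \<gamma>) | Some j \<Rightarrow> (\<lambda>\<gamma>. s (h j) \<gamma> - z j \<gamma>))" for k
    define b where "b k = (case k of None \<Rightarrow> 1 | Some j \<Rightarrow> - c (h j))" for k
    have "(\<lambda>\<gamma>. \<Sum>k\<in>insert None (Some ` F). b k *\<^sub>R t k \<gamma>) \<in> coboundaries \<Gamma> nu"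
      by (rule coboundaries_combination) (use F cob s member in \<open>auto simp: t_def\<close>)
    moreover have "(\<Sum>k\<in>insert None (Some ` F). b k *\<^sub>R t k \<gamma>) = (\<Sum>j\<in>F. c (h j) *\<^sub>R z j \<gamma>)" for \<gamma>
    proof -
      have "(\<Sum>k\<in>insert None (Some ` F). b k *\<^sub>R t k \<gamma>) =
          (\<Sum>h\<in>h ` F. c h *\<^sub>R s h \<gamma>) + (\<Sum>j\<in>F. - c (h j) *\<^sub>R (s (h j) \<gamma> - z j \<gamma>))"
        using F by (subst sum.insert) (auto simp: b_def t_def sum.reindex)
      also have "(\<Sum>h\<in>h ` F. c h *\<^sub>R s h \<gamma>) = (\<Sum>j\<in>F. c (h j) *\<^sub>R s (h j) \<gamma>)"
        by (simp add: sum.reindex[OF inj])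
      finally show ?thesis by (simp add: sum.distrib[symmetric] scaleR_diff_right sum_negf[symmetric] sum_subtractf[symmetric])
    qed
    ultimately have "(\<lambda>\<gamma>. \<Sum>j\<in>F. c (h j) *\<^sub>R z j \<gamma>) \<in> coboundaries \<Gamma> nu" by simp
    then show "\<forall>h\<in>h ` F. c h = 0" using indep[of "\<lambda>j. c (h j)"] by simp
  qed
  then have "enat (card (h ` F)) \<le> dim_H1 \<Gamma> nu"
    unfolding dim_H1_def by (intro SUP_upper) simp
  then show ?thesis by (simp add: card_image[OF inj])
qed

context bending begin

definition bending_cocycle :: "('n mink \<Rightarrow> 'n mink_mat) \<Rightarrow> 'n mink_mat \<Rightarrow> 'n mink_mat" where
  "bending_cocycle f \<gamma> = (if \<gamma> \<in> \<Gamma> then f (\<gamma> *v base) else 0)"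

lemma off_walls_invariant:
  "\<gamma> \<in> \<Gamma> \<Longrightarrow> y \<in> off_walls \<Longrightarrow> \<gamma> *v y \<in> off_walls"
  by (simp add: future_cone_invariant cone_over_invariant)

lemma bending_cocycle_in_cocycles:
  assumes f: "bending_function c f"
  shows "bending_cocycle f \<in> cocycles \<Gamma> nu"
proof -
  have nu: "\<And>y. y \<in> off_walls \<Longrightarrow> f y \<in> nu"
    and eq: "\<And>\<gamma> y. \<gamma> \<in> \<Gamma> \<Longrightarrow> y \<in> off_walls \<Longrightarrow> f (\<gamma> *v y) = Ad \<gamma> (f y) + f (\<gamma> *v base)"
    using f unfolding bending_function_def by blast+
  have "bending_cocycle f (\<gamma> ** \<eta>) = bending_cocycle f \<gamma> + Ad \<gamma> (bending_cocycle f \<eta>)"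
    if "\<gamma> \<in> \<Gamma>" "\<eta> \<in> \<Gamma>" for \<gamma> \<eta>
    using eq[OF that(1) off_walls_invariant[OF that(2) base]] that \<Gamma>_mult[OF that]
    by (simp add: bending_cocycle_def matrix_vector_mul_assoc)
  then show ?thesis
    unfolding cocycles_def using nu[OF off_walls_invariant[OF _ base]] by (auto simp: bending_cocycle_def)
qed

text \<open>
  The value of \<open>g\<close> on a region is fixed by the stabilizer of the region.
\<close>

lemma equivariant_locally_constant_zero:
  assumes n: "CARD('n) \<ge> 3"
    and dense: "\<And>\<delta>. \<delta> \<in> components (hyp - lift \<Gamma> \<Delta>) \<Longrightarrow> zariski_dense_in_SO_plus (region_stabilizer \<Gamma> \<delta>)"
    and g: "good J future_cone g" and nu: "\<And>y. y \<in> off_walls \<Longrightarrow> g y \<in> nu"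
    and eq: "\<And>\<gamma> y. \<gamma> \<in> \<Gamma> \<Longrightarrow> y \<in> off_walls \<Longrightarrow> g (\<gamma> *v y) = Ad \<gamma> (g y)"
    and y: "y \<in> off_walls"
  shows "g y = 0"
proof -
  have hyp_off: "hyp - lift \<Gamma> \<Delta> \<subseteq> off_walls"
    using hyp_subset_future_cone by (auto simp: cone_over_def to_hyp_hyp)
  have p: "to_hyp y \<in> hyp - lift \<Gamma> \<Delta>" using y to_hyp_in_hyp by (auto simp: cone_over_def)
  obtain s where s: "s > 0" "to_hyp y = s *\<^sub>R y" using to_hyp_scale[of y] y by blast
  have "g y = g (to_hyp y)"
  proof (rule good_constant_off_walls[OF g, of "closed_segment y (to_hyp y)"])
    show "closed_segment y (to_hyp y) \<subseteq> off_walls"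
    proof
      fix z assume "z \<in> closed_segment y (to_hyp y)"
      then obtain u where u: "0 \<le> u" "u \<le> 1" "z = (1 - u) *\<^sub>R y + u *\<^sub>R to_hyp y" by (auto simp: in_segment)
      define r where "r = (1 - u) + u * s"
      have z: "z = r *\<^sub>R y" by (simp add: u s r_def algebra_simps)
      have "r > 0"
      proof (cases "u = 0")
        case False
        then have "u * s > 0" using u(1) s(1) by simp
        then show ?thesis using u(2) by (simp add: r_def)
      qed (simp add: r_def)
      then show "z \<in> off_walls"
        using y by (simp add: z cone_over_scale future_cone_scaleR)
    qed
  qed auto
  moreover have "g (to_hyp y) = 0"
  proof (rule nu_invariant_zero[OF n])
    show "g (to_hyp y) \<in> nu" using nu p hyp_off by blast
    define \<delta> where "\<delta> = connected_component_set (hyp - lift \<Gamma> \<Delta>) (to_hyp y)"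
    have \<delta>: "\<delta> \<in> components (hyp - lift \<Gamma> \<Delta>)" using p by (auto simp: \<delta>_def components_def)
    have y\<delta>: "to_hyp y \<in> \<delta>" using p by (simp add: \<delta>_def)
    have \<delta>_off: "\<delta> \<subseteq> off_walls"
      using in_components_subset[OF \<delta>] hyp_off by blast
    fix A assume A: "A \<in> carrier (SO_plus :: 'n mink_mat monoid)"
    show "A ** g (to_hyp y) = g (to_hyp y) ** A"
    proof (rule zariski_dense_centralizer[OF dense[OF \<delta>] _ A])
      fix \<gamma> assume "\<gamma> \<in> region_stabilizer \<Gamma> \<delta>"
      then have \<gamma>: "\<gamma> \<in> \<Gamma>" "(\<lambda>x. \<gamma> *v x) ` \<delta> = \<delta>" by (auto simp: region_stabilizer_def)
      have "\<gamma> *v to_hyp y \<in> \<delta>" using \<gamma>(2) y\<delta> by blast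
      then have "g (\<gamma> *v to_hyp y) = g (to_hyp y)"
        by (rule good_constant_off_walls[OF g in_components_connected[OF \<delta>] \<delta>_off _ y\<delta>])
      then have "Ad \<gamma> (g (to_hyp y)) = g (to_hyp y)" using eq[OF \<gamma>(1)] y\<delta> \<delta>_off by auto
      then have "\<gamma> ** g (to_hyp y) ** matrix_inv \<gamma> ** \<gamma> = g (to_hyp y) ** \<gamma>" by (simp add: Ad_def)
      then show "\<gamma> ** g (to_hyp y) = g (to_hyp y) ** \<gamma>"
        using SO_plus_matrix_inv(1)[OF \<Gamma>_carrier[OF \<gamma>(1)]] by (simp add: matrix_mul_assoc[symmetric])
    qed
  qed
  ultimately show ?thesis by simp
qed

text \<open>
  If the combination is the coboundary of \<open>X\<close>, the corresponding combination of bending functions is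
  the constant \<open>- X\<close> and has no jumps. At a wall \<open>i\<close> of \<open>F\<close> only the \<open>i\<close>-th function jumps.
\<close>

lemma bending_cocycles_independent:
  assumes n: "CARD('n) \<ge> 3"
    and dense: "\<And>\<delta>. \<delta> \<in> components (hyp - lift \<Gamma> \<Delta>) \<Longrightarrow> zariski_dense_in_SO_plus (region_stabilizer \<Gamma> \<delta>)"
    and F: "F \<subseteq> walls" and f: "\<And>j. j \<in> F \<Longrightarrow> bending_function (c j) (f j)"
    and dual: "\<And>j i. j \<in> F \<Longrightarrow> i \<in> F \<Longrightarrow> c j i = (if i = j then 1 else 0)"
    and cob: "(\<lambda>\<gamma>. \<Sum>j\<in>F. a j *\<^sub>R bending_cocycle (f j) \<gamma>) \<in> coboundaries \<Gamma> nu"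
    and i: "i \<in> F"
  shows "a i = 0"
proof -
  have finF: "finite F" using F finite_walls finite_subset by blast
  have good: "\<And>j. j \<in> F \<Longrightarrow> good (jump (c j)) future_cone (f j)"
    and nu: "\<And>j y. j \<in> F \<Longrightarrow> y \<in> off_walls \<Longrightarrow> f j y \<in> nu"
    and eq: "\<And>j \<gamma> y. j \<in> F \<Longrightarrow> \<gamma> \<in> \<Gamma> \<Longrightarrow> y \<in> off_walls \<Longrightarrow>
      f j (\<gamma> *v y) = Ad \<gamma> (f j y) + f j (\<gamma> *v base)"
    using f unfolding bending_function_def by blast+
  obtain X where X: "X \<in> nu"
    "(\<lambda>\<gamma>. \<Sum>j\<in>F. a j *\<^sub>R bending_cocycle (f j) \<gamma>) = (\<lambda>\<gamma>. if \<gamma> \<in> \<Gamma> then Ad \<gamma> X - X else 0)"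
    using cob unfolding coboundaries_def by blast
  define J where "J x = (\<Sum>j\<in>F. a j *\<^sub>R jump (c j) x)" for x
  define g where "g y = (\<Sum>j\<in>F. a j *\<^sub>R f j y) + X" for y
  have g: "good J future_cone g"
    unfolding g_def J_def by (intro good_shift good_sum finF good)
  have g0: "g y = 0" if "y \<in> off_walls" for y
  proof (rule equivariant_locally_constant_zero[OF n dense g _ _ that])
    fix y assume y: "y \<in> off_walls"
    show "g y \<in> nu"
      unfolding g_def by (intro subspace_add subspace_sum subspace_scale subspace_nu nu y X(1))
    fix \<gamma> assume \<gamma>: "\<gamma> \<in> \<Gamma>"
    have "(\<Sum>j\<in>F. a j *\<^sub>R f j (\<gamma> *v base)) = Ad \<gamma> X - X"
      using fun_cong[OF X(2), of \<gamma>] \<gamma> by (simp add: bending_cocycle_def)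
    moreover have "(\<Sum>j\<in>F. a j *\<^sub>R f j (\<gamma> *v y)) =
        (\<Sum>j\<in>F. a j *\<^sub>R Ad \<gamma> (f j y)) + (\<Sum>j\<in>F. a j *\<^sub>R f j (\<gamma> *v base))"
      unfolding sum.distrib[symmetric] scaleR_add_right[symmetric]
      by (rule sum.cong) (use eq[OF _ \<gamma> y] in auto)
    ultimately show "g (\<gamma> *v y) = Ad \<gamma> (g y)"
      by (simp add: g_def linear_add[OF linear_Ad] linear_sum[OF linear_Ad] linear_cmul[OF linear_Ad])
  qed
  have iw: "i \<in> walls" using i F by blast
  obtain q where q: "q \<in> i" using nonempty_connected_components_of[OF iw] by blast
  have iD: "i \<subseteq> topspace M \<inter> (\<Delta> - B)"
    using connected_components_of_subset[OF iw] by simp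
  then obtain x where x: "x \<in> hyp" "orbit \<Gamma> x = q" using q topspace_quotient by auto
  have xi: "x \<in> lift \<Gamma> i" using x q by (simp add: lift_def)
  have "x \<in> lift \<Gamma> (\<Delta> - B)" using x q iD by (auto simp: lift_def)
  then have xD: "x \<in> cone_over (\<Delta> - B)"
    using x(1) hyp_subset_future_cone by (auto simp: cone_over_def to_hyp_hyp)
  have wx: "wall_at x = i" using component_eq[OF iw xi] by (simp add: wall_at_def to_hyp_hyp[OF x(1)])
  have "J x = 0"
    by (rule good_constant_jump_zero[OF g g0]) (use xD in \<open>simp_all add: cone_over_diff\<close>)
  moreover have "J x = a i *\<^sub>R bend (unit_normal x)"
  proof -
    have "J x = (\<Sum>j\<in>F. if j = i then a i *\<^sub>R bend (unit_normal x) else 0)"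
      unfolding J_def by (rule sum.cong) (use dual i in \<open>auto simp: jump_at_wall[OF xD] wx\<close>)
    then show ?thesis using finF i by simp
  qed
  ultimately show "a i = 0" using bend_nonzero[OF unit_normal_unit[OF xD]] by simp
qed

end

theorem theorem1p2:
  fixes \<Gamma> :: "'n::finite mink_mat set"
    and \<Delta> B :: "'n mink set set"
  assumes "CARD('n) \<ge> 3"
    and "torsion_free_lattice \<Gamma>"
    and "branched_hypersurface \<Gamma> \<Delta> B"
    and "\<forall>w \<in> components_in \<Gamma> (\<Delta> - B). \<exists>N. transverse_orientation \<Gamma> w N"
    and "\<forall>\<delta> \<in> components (hyp - lift \<Gamma> \<Delta>). zariski_dense_in_SO_plus (region_stabilizer \<Gamma> \<delta>)"
  shows "ereal_of_enat (dim_H1 \<Gamma> nu) \<ge>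
           ereal (real (card (components_in \<Gamma> (\<Delta> - B))) - 3 * real (card (components_in \<Gamma> B)))"
proof -
  from bchoice[OF assms(4)] obtain N where N: "\<forall>w\<in>components_in \<Gamma> (\<Delta> - B). transverse_orientation \<Gamma> w (N w)" by blast
  interpret bending \<Gamma> \<Delta> B N
  proof (rule bending.intro)
    show "subgroup \<Gamma> SO_plus" using assms(2) by (simp add: torsion_free_lattice_def)
    show "branched_hypersurface \<Gamma> \<Delta> B" by (rule assms(3))
    show "transverse_orientation \<Gamma> w (N w)" if "w \<in> components_in \<Gamma> (\<Delta> - B)" for w
      using N that by blast
  qed
  obtain F c f where F: "F \<subseteq> walls" and card: "card walls \<le> card F + 3 * card bindings"
    and f: "\<forall>j\<in>F. bending_function (c j) (f j)" and dual: "\<forall>j\<in>F. \<forall>i\<in>F. c j i = (if i = j then 1 else 0)"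
    using bending_functions_exist by blast
  have "enat (card F) \<le> dim_H1 \<Gamma> nu"
  proof (rule independent_family_dim_H1)
    show "finite F" using F finite_walls finite_subset by blast
    show "bending_cocycle (f j) \<in> cocycles \<Gamma> nu" if "j \<in> F" for j
      using f that by (intro bending_cocycle_in_cocycles) blast
    show "\<forall>j\<in>F. a j = 0"
      if "(\<lambda>\<gamma>. \<Sum>j\<in>F. a j *\<^sub>R bending_cocycle (f j) \<gamma>) \<in> coboundaries \<Gamma> nu" for a
      using bending_cocycles_independent[OF assms(1) _ F _ _ that] assms(5) f dual by blast
  qed
  then have "ereal_of_enat (enat (card F)) \<le> ereal_of_enat (dim_H1 \<Gamma> nu)"
    by (simp only: ereal_of_enat_le_iff)
  moreover have "ereal (real (card walls) - 3 * real (card bindings)) \<le> ereal_of_enat (enat (card F))"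
    using card by simp
  ultimately show ?thesis by (rule order_trans[rotated])
qed

end
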